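(* Let $\Omega\subset\mathbb{R}^n$ be a bounded domain, let $s\in(0,\infty]$ be fixed, and let $\Lambda:\Omega\times\mathbb{R}^+\times\mathbb{R}^+\to\mathbb{R}^+$, $\lambda$ and $\mu$ satisfy conditions $(\Lambda_s)$ and $(\lambda)$ stated in the context. If $u$ is a non-negative member of $DG^{-}_{p,\Lambda}(\Omega)\cap L^{s}_{loc}(\Omega)$ (with class parameters $c,q,p,\delta$), then there exist positive real numbers $C_1$, $C_2$ and $\beta$, depending only on $n$, $p$, $q$, $s$, $c$, $\delta$ and $d=\|u\|_{L^s_{loc}(\Omega)}$, such that for all $\theta$ with $$0<\theta<\frac{1}{C_1[\mu(\rho)]^{\beta}+\frac{2}{s}}$$ there holds $$\bigg(\frac{1}{|B_{\rho}(x_0)|}\int_{B_{\rho}(x_0)}u^{\theta}\,dx\bigg)^{\frac1\theta}\le \frac{C_2}{\lambda(\rho)}\,e^{C_1[\mu(\rho)]^{\beta}}\Big\{\inf_{B_{\rho/2}(x_0)}u+\rho\Big\},$$ provided that $B_{8\rho}(x_0)\subset\Omega$.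
   Context: Notation: $B_r(x_0)$ is the open ball of radius $r>0$ centred at $x_0$; $|E|$ is Lebesgue measure; $(u-k)_-=\max\{k-u,0\}$; infima of Sobolev functions are essential infima. For $s\in(0,\infty)$ set $s_\star=\frac{s}{n+s}$; for $s=\infty$ set $s_\star=1$ and read $1/s=0$. Condition $(\Lambda_s)$: there are a non-decreasing function $\lambda:(0,\infty)\to(0,1]$ and a non-increasing function $\mu:(0,\infty)\to[1,\infty)$ such that for any ball $B_{8r}(x_0)\subset\Omega$, $$\Lambda(x_0,r,k)\le \mu\Big(\big(\tfrac rk\big)^{s_\star}\Big)\quad\text{for all } r\le k\le \frac{\lambda(r)}{|B_r(x_0)|^{1/s}}.$$ Condition $(\lambda)$: for any $0<r\le\rho$, $\lambda(\rho)\le\frac{\rho}{r}\lambda(r)$. Class $DG^-_{p,\Lambda}(\Omega)$: a measurable $u:\Omega\to\mathbb{R}$ belongs to it if $u\in W^{1,p}_{loc}(\Omega)$ and there exist numbers $c>0$, $q\ge p>1$, $0\le\delta<\frac pn$ such that for any ball $B_{8r}(x_0)\subset\Omega$, any $k>0$ and any $0<\sigma<1$, $$\frac{1}{|B_{r(1-\sigma)}(x_0)|}\int_{B_{r(1-\sigma)}(x_0)}|\nabla(u-k)_-|^p\,dx\le\frac{c}{\sigma^q}\,\Lambda(x_0,r,k)\Big(\frac kr\Big)^p\bigg(\frac{|B_r(x_0)\cap\{u\le k\}|}{|B_r(x_0)|}\bigg)^{1-\delta}.$$ The quantity $d=\|u\|_{L^s_{loc}(\Omega)}$ stands for the local $L^s$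 size of $u$: a finite number with $\|u\|_{L^s(B_{2\rho}(x_0))}\le d$ for the balls under consideration, where $\|u\|_{L^s(E)}=(\int_E|u|^s\,dx)^{1/s}$ for $s<\infty$ (also for $s<1$) and the essential supremum of $|u|$ for $s=\infty$. The constants do not depend on $x_0$, $\rho$, $\theta$ nor on the functions $\lambda,\mu$. *)

theory Defs
  imports "HOL-Analysis.Analysis" "HOL-Probability.Essential_Supremum"
begin

section \<open>Weak gradients and local Sobolev spaces\<close>

definition partial_deriv :: "'n::finite \<Rightarrow> (real^'n \<Rightarrow> real) \<Rightarrow> real^'n \<Rightarrow> real" where
  "partial_deriv i f x = frechet_derivative f (at x) (axis i 1)"

primrec Ck :: "nat \<Rightarrow> (real^'n \<Rightarrow> real) \<Rightarrow> bool" where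
  "Ck 0 f \<longleftrightarrow> continuous_on UNIV f"
| "Ck (Suc k) f \<longleftrightarrow> (\<forall>x. f differentiable (at x)) \<and> (\<forall>i. Ck k (partial_deriv i f))"

definition test_function :: "(real^'n) set \<Rightarrow> (real^'n \<Rightarrow> real) \<Rightarrow> bool" where
  "test_function \<Omega> \<phi> \<longleftrightarrow> (\<forall>k. Ck k \<phi>) \<and>
     compact (closure {x. \<phi> x \<noteq> 0}) \<and> closure {x. \<phi> x \<noteq> 0} \<subseteq> \<Omega>"

text \<open>The exponent \<open>s\<close> ranges over \<open>(0,\<infinity>]\<close>; for \<open>s < 1\<close> this is only a quasi-norm. The
  value is \<open>\<infinity>\<close> when the function is not in \<open>L\<^sup>s(E)\<close>. For \<open>s = \<infinity>\<close> the essential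
  supremum is taken in \<open>ennreal\<close>, so it is \<open>0\<close> on null sets.\<close>

definition Lnorm :: "ennreal \<Rightarrow> (real^'n) set \<Rightarrow> (real^'n \<Rightarrow> 'b::real_normed_vector) \<Rightarrow> ennreal" where
  "Lnorm s E f =
     (if s = \<infinity> then esssup (lebesgue_on E) (\<lambda>x. ennreal (norm (f x)))
      else if set_integrable lebesgue E (\<lambda>x. norm (f x) powr enn2real s)
      then ennreal ((LINT x:E|lebesgue. norm (f x) powr enn2real s) powr (1 / enn2real s))
      else \<infinity>)"

definition L_loc :: "ennreal \<Rightarrow> (real^'n) set \<Rightarrow> (real^'n \<Rightarrow> 'b::real_normed_vector) set" where
  "L_loc s \<Omega> = {f. f \<in> borel_measurable (lebesgue_on \<Omega>) \<and>
                     (\<forall>K. compact K \<and> K \<subseteq> \<Omega> \<longrightarrow> Lnorm s K f < \<infinity>)}"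

definition has_weak_gradient ::
    "(real^'n) set \<Rightarrow> (real^'n \<Rightarrow> real) \<Rightarrow> (real^'n \<Rightarrow> real^'n) \<Rightarrow> bool" where
  "has_weak_gradient \<Omega> f G \<longleftrightarrow> f \<in> L_loc 1 \<Omega> \<and> G \<in> L_loc 1 \<Omega> \<and>
     (\<forall>\<phi> i. test_function \<Omega> \<phi> \<longrightarrow>
        (LINT x:\<Omega>|lebesgue. f x * partial_deriv i \<phi> x) = - (LINT x:\<Omega>|lebesgue. G x $ i * \<phi> x))"

definition W1_loc :: "real \<Rightarrow> (real^'n) set \<Rightarrow> (real^'n \<Rightarrow> real) set" where
  "W1_loc p \<Omega> = {f. f \<in> L_loc (ennreal p) \<Omega> \<and>
                     (\<exists>G. has_weak_gradient \<Omega> f G \<and> G \<in> L_loc (ennreal p) \<Omega>)}"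

definition ess_inf_on :: "(real^'n) set \<Rightarrow> (real^'n \<Rightarrow> real) \<Rightarrow> ereal" where
  "ess_inf_on E f = - esssup (lebesgue_on E) (\<lambda>x. - ereal (f x))"

section \<open>The structure conditions and the De Giorgi class\<close>

text \<open>\<open>1/s\<close>, with \<open>1/\<infinity> = 0\<close>.\<close>

definition recip :: "ennreal \<Rightarrow> real" where
  "recip s = enn2real (1 / s)"

definition s_star :: "nat \<Rightarrow> ennreal \<Rightarrow> real" where
  "s_star n s = (if s = \<infinity> then 1 else enn2real s / (real n + enn2real s))"

text \<open>The functions \<open>\<lambda>\<close>, \<open>\<mu>\<close>, and the levels and radii in \<open>\<Lambda>\<close>, live on \<open>(0,\<infinity>)\<close>; values of the
  total functions outside their mathematical domain are unconstrained and never used.\<close>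

definition cond_Lambda_s :: "ennreal \<Rightarrow> (real^'n) set \<Rightarrow> (real^'n \<Rightarrow> real \<Rightarrow> real \<Rightarrow> real) \<Rightarrow>
    (real \<Rightarrow> real) \<Rightarrow> (real \<Rightarrow> real) \<Rightarrow> bool" where
  "cond_Lambda_s s \<Omega> \<Lambda> lam mu \<longleftrightarrow>
     mono_on {0<..} lam \<and> lam ` {0<..} \<subseteq> {0<..1} \<and>
     antimono_on {0<..} mu \<and> mu ` {0<..} \<subseteq> {1..} \<and>
     (\<forall>x0 r k. r > 0 \<and> ball x0 (8 * r) \<subseteq> \<Omega> \<and>
        r \<le> k \<and> k \<le> lam r / measure lebesgue (ball x0 r) powr recip s \<longrightarrow>
        \<Lambda> x0 r k \<le> mu ((r / k) powr s_star CARD('n) s))"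

definition cond_lambda :: "(real \<Rightarrow> real) \<Rightarrow> bool" where
  "cond_lambda lam \<longleftrightarrow> (\<forall>r \<rho>. 0 < r \<and> r \<le> \<rho> \<longrightarrow> lam \<rho> \<le> \<rho> / r * lam r)"

text \<open>\<open>DG_minus p \<Lambda> \<Omega> c q \<delta>\<close> is the De Giorgi class with its parameters \<open>c\<close>, \<open>q\<close>, \<open>\<delta>\<close> made
  explicit. \<open>G\<close> is \<open>\<nabla>(u - k)\<^sub>-\<close>, which exists and is unique up to null sets for
  \<open>u\<close> in \<open>W1_loc p \<Omega>\<close>. When \<open>\<delta> \<ge> 1\<close> the convention \<open>0 powr a = 0\<close> is harmless: if
  \<open>{u \<le> k}\<close> is null in the ball, then \<open>(u - k)\<^sub>- = 0\<close> a.e. there and the left side vanishes.\<close>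

definition DG_minus :: "real \<Rightarrow> (real^'n \<Rightarrow> real \<Rightarrow> real \<Rightarrow> real) \<Rightarrow> (real^'n) set \<Rightarrow>
    real \<Rightarrow> real \<Rightarrow> real \<Rightarrow> (real^'n \<Rightarrow> real) set" where
  "DG_minus p \<Lambda> \<Omega> c q \<delta> = {u. u \<in> W1_loc p \<Omega> \<and>
     (\<forall>k>0. \<exists>G. has_weak_gradient \<Omega> (\<lambda>x. max (k - u x) 0) G \<and> G \<in> L_loc (ennreal p) \<Omega> \<and>
        (\<forall>x0 r \<sigma>. r > 0 \<and> ball x0 (8 * r) \<subseteq> \<Omega> \<and> 0 < \<sigma> \<and> \<sigma> < 1 \<longrightarrow>
           1 / measure lebesgue (ball x0 (r * (1 - \<sigma>))) *
             (LINT x:ball x0 (r * (1 - \<sigma>))|lebesgue. norm (G x) powr p)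
           \<le> c / \<sigma> powr q * \<Lambda> x0 r k * (k / r) powr p *
             (measure lebesgue {x \<in> ball x0 r. u x \<le> k} / measure lebesgue (ball x0 r))
               powr (1 - \<delta>)))}"

end

theory Submission
  imports Defs
begin

text \<open>
  A weak Harnack inequality says that a non-negative \<open>u\<close> which is large on a noticeable part of
  \<open>B\<^sub>\<rho>(x\<^sub>0)\<close> is bounded below on \<open>B\<^bsub>\<rho>/2\<^esub>(x\<^sub>0)\<close>, with a \<^emph>\<open>power-like\<close> dependence on the size of
  that part. Writing \<open>A(k)\<close> for the relative measure of \<open>{u \<ge> k}\<close> in \<open>B\<^sub>\<rho>(x\<^sub>0)\<close>, \<open>M = \<mu>(\<rho>)\<close> and
  \<open>I = inf u + \<rho>\<close>, the goal is \<open>A(k)\<^sup>Q \<le> E I / k\<close> with \<open>Q\<close> and \<open>ln E\<close> bounded by a constant times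
  a power of \<open>M\<close>, for all levels \<open>k\<close> below a cap \<open>K\<close> comparable to \<open>\<lambda>(\<rho>) \<rho>\<^bsup>-n/s\<^esup>\<close>. Integrating this
  decay bounds the part of the mean of \<open>u\<^sup>\<theta>\<close> that lives on levels below \<open>K\<close>; the levels above \<open>K\<close>
  are absorbed by Hoelder's inequality and the \<open>L\<^sup>s\<close> bound, which is where \<open>2/s\<close> enters the range of
  \<open>\<theta>\<close> and \<open>1/\<lambda>(\<rho>)\<close> enters the estimate (lemma \<open>integral_mean_from_decay\<close>).

  All information on \<open>u\<close> comes from the De Giorgi class through one inequality
  (\<open>de_giorgi_poincare\<close>): in a ball of radius \<open>r\<close>, for \<open>l < k\<close>, the product of
  \<open>(k - l) |{u \<le> l}|\<^bsup>1-\<alpha>\<^esup>\<close> and \<open>|{u \<ge> k}|\<close> is controlled by \<open>r |B|\<^bsup>1-\<alpha>\<^esup>\<close> times the integral of the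
  gradient over the layer \<open>{l < u < k}\<close> only, for every \<open>\<alpha> < 1/n\<close>. Its proof follows \<open>u\<close> along almost
  every segment joining the two sets, on which it must cross the layer. Since
  \<open>\<delta>/p < 1/n\<close>, one can choose \<open>\<delta>/p < \<alpha> < 1/n\<close>, and the gain \<open>\<alpha> - \<delta>/p\<close> drives everything below.

  \<^item> \<open>measure_to_pointwise\<close>: if \<open>{u \<le> k}\<close> occupies a fraction of a ball below a negative power of
    \<open>M\<close>, then \<open>u \<ge> k/2\<close> on the half ball (De Giorgi iteration).
  \<^item> \<open>expansion_of_positivity\<close>: if \<open>u \<ge> k\<close> on half of \<open>B\<^sub>r\<close>, then \<open>u \<ge> 2\<^bsup>-J-1\<^esup> k\<close> on \<open>B\<^bsub>2r\<^esub>\<close>, where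
    \<open>J\<close> is of the order of a power of \<open>M\<close>: the dyadic layers are disjoint, so one of \<open>J\<close> of them is
    thin, and a thin layer forces the set below it to be small.
  \<^item> \<open>local_clustering\<close>: if \<open>u \<ge> k\<close> on a fraction \<open>A\<close> of \<open>B\<^sub>\<rho>\<close>, then \<open>u \<ge> k/2\<close> on half of some ball
    of radius proportional to \<open>A \<rho>\<close>; otherwise every small ball would carry too much gradient.
  \<^item> \<open>power_like_positivity\<close>: starting from that small ball, about \<open>log (1/A)\<close> doublings bring the
    radius back to the size of \<open>\<rho>\<close>. Each costs a factor \<open>2\<^bsup>-J-1\<^esup>\<close>, and
    \<open>(2\<^bsup>-J-1\<^esup>)\<^bsup>log (1/A)\<^esup>\<close> is a power of \<open>A\<close>.

  The structure conditions only bound \<open>\<Lambda>\<close> by \<open>M\<close> on a ball of radius \<open>r \<le> \<rho>\<close> for levels between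
  \<open>r\<close> and \<open>(r/\<rho>) K\<close> (lemma \<open>conditions_imp_admissible\<close>). The upper cap is harmless along the doubling
  chain, because the level is first lowered by the factor \<open>r/\<rho>\<close> (again a power of \<open>A\<close>) and afterwards
  decreases while the radius grows. The lower bound fails only once the level has dropped below
  \<open>\<rho>\<close>, and then it is at most \<open>I\<close> anyway; this is the reason for the term \<open>\<rho>\<close> in \<open>I\<close>.
\<close>

section \<open>Smooth test functions\<close>

text \<open>The function \<open>e\<^bsup>-1/t\<^esup> t\<^bsup>-m\<^esup>\<close>, extended by
  \<open>0\<close>. The negative powers of \<open>t\<close> are included so that the family is
  closed under differentiation.\<close>

definition flat :: "nat \<Rightarrow> real \<Rightarrow> real" where
  "flat m t = (if t > 0 then exp (- (1 / t)) / t ^ m else 0)"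

lemma flat_tendsto_0: "(flat m \<longlongrightarrow> 0) (at_right 0)"
proof -
  have "((\<lambda>t::real. (inverse t) ^ m / exp (inverse t)) \<longlongrightarrow> 0) (at_right 0)"
    by (rule filterlim_compose[OF tendsto_power_div_exp_0 filterlim_inverse_at_top_right])
  moreover have "eventually (\<lambda>t::real. (inverse t) ^ m / exp (inverse t) = flat m t) (at_right 0)"
    using eventually_at_right_less[of 0]
    by eventually_elim (auto simp: flat_def exp_minus field_simps)
  ultimately show ?thesis by (rule Lim_transform_eventually)
qed

lemma flat_has_derivative:
  "(flat m has_real_derivative (flat (m + 2) t - real m * flat (m + 1) t)) (at t)"
proof -
  consider "t > 0" | "t < 0" | "t = 0" by linarith
  then show ?thesis
  proof cases
    case 1
    have "((\<lambda>t. exp (- (1 / t)) / t ^ m) has_real_derivative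
        (flat (m + 2) t - real m * flat (m + 1) t)) (at t)"
      using 1
      by (auto intro!: derivative_eq_intros simp: flat_def field_simps power2_eq_square)
        (cases m; simp add: field_simps)
    then show ?thesis
      by (rule has_field_derivative_transform_within_open[where S = "{0<..}"])
        (use 1 in \<open>auto simp: flat_def\<close>)
  next
    case 2
    have "((\<lambda>t. 0) has_real_derivative (flat (m + 2) t - real m * flat (m + 1) t)) (at t)"
      using 2 by (simp add: flat_def)
    then show ?thesis
      by (rule has_field_derivative_transform_within_open[where S = "{..<0}"])
        (use 2 in \<open>auto simp: flat_def\<close>)
  next
    case 3
    have "((\<lambda>t. (flat m t - flat m 0) / (t - 0)) \<longlongrightarrow> 0) (at_right 0)"
      by (rule Lim_transform_eventually[OF flat_tendsto_0[of "Suc m"]])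
        (use eventually_at_right_less[of 0] in eventually_elim, auto simp: flat_def)
    moreover have "((\<lambda>t. (flat m t - flat m 0) / (t - 0)) \<longlongrightarrow> 0) (at_left (0::real))"
      by (rule Lim_transform_eventually[OF tendsto_const[of 0]])
        (auto simp: flat_def eventually_at_left_field intro!: exI[of _ "-1"])
    ultimately have "((\<lambda>t. (flat m t - flat m 0) / (t - 0)) \<longlongrightarrow> 0) (at (0::real))"
      by (simp add: filterlim_at_split)
    then show ?thesis
      using 3 by (simp add: has_field_derivative_iff flat_def)
  qed
qed

text \<open>An inductively generated class of functions that is closed under partial derivatives; hence each
  member satisfies \<open>Ck k\<close> for all \<open>k\<close>, by one induction on
  \<open>k\<close>.\<close>

inductive smooth_expr :: "(real^'n::finite \<Rightarrow> real) \<Rightarrow> bool" where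
  const: "smooth_expr (\<lambda>x. c)"
| coord: "smooth_expr (\<lambda>x. x $ i)"
| add: "smooth_expr f \<Longrightarrow> smooth_expr g \<Longrightarrow> smooth_expr (\<lambda>x. f x + g x)"
| mult: "smooth_expr f \<Longrightarrow> smooth_expr g \<Longrightarrow> smooth_expr (\<lambda>x. f x * g x)"
| exp: "smooth_expr f \<Longrightarrow> smooth_expr (\<lambda>x. exp (f x))"
| flat: "smooth_expr f \<Longrightarrow> smooth_expr (\<lambda>x. flat m (f x))"

lemma smooth_expr_derivative:
  "smooth_expr f \<Longrightarrow>
    \<exists>D. (\<forall>x. (f has_derivative D x) (at x)) \<and> (\<forall>i. smooth_expr (\<lambda>x. D x (axis i 1)))"
proof (induction rule: smooth_expr.induct)
  case (const c)
  show ?case by (rule exI[of _ "\<lambda>x y. 0"]) (auto intro: smooth_expr.intros)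
next
  case (coord i)
  show ?case
    by (rule exI[of _ "\<lambda>x y. y $ i"])
      (auto intro: smooth_expr.intros bounded_linear_imp_has_derivative bounded_linear_vec_nth)
next
  case (add f g)
  then obtain D E where D: "\<And>x. (f has_derivative D x) (at x)" "\<And>i. smooth_expr (\<lambda>x. D x (axis i 1))"
    and E: "\<And>x. (g has_derivative E x) (at x)" "\<And>i. smooth_expr (\<lambda>x. E x (axis i 1))"
    by auto
  show ?case
    by (rule exI[of _ "\<lambda>x y. D x y + E x y"])
      (auto intro!: smooth_expr.intros D E has_derivative_add)
next
  case (mult f g)
  then obtain D E where D: "\<And>x. (f has_derivative D x) (at x)" "\<And>i. smooth_expr (\<lambda>x. D x (axis i 1))"
    and E: "\<And>x. (g has_derivative E x) (at x)" "\<And>i. smooth_expr (\<lambda>x. E x (axis i 1))"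
    by auto
  show ?case
    by (rule exI[of _ "\<lambda>x y. f x * E x y + D x y * g x"])
      (auto intro!: smooth_expr.intros D E has_derivative_mult mult.hyps)
next
  case (exp f)
  then obtain D where D: "\<And>x. (f has_derivative D x) (at x)" "\<And>i. smooth_expr (\<lambda>x. D x (axis i 1))"
    by auto
  have "((\<lambda>x. exp (f x)) has_derivative (\<lambda>y. exp (f x) * D x y)) (at x)" for x
    using DERIV_compose_FDERIV[OF DERIV_exp D(1)[of x]] by (simp add: mult.commute)
  then show ?case
    by (intro exI[of _ "\<lambda>x y. exp (f x) * D x y"])
      (auto intro!: smooth_expr.intros D exp.hyps)
next
  case (flat f m)
  then obtain D where D: "\<And>x. (f has_derivative D x) (at x)" "\<And>i. smooth_expr (\<lambda>x. D x (axis i 1))"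
    by auto
  let ?E = "\<lambda>x y. D x y * (flat (m + 2) (f x) + (- real m) * flat (m + 1) (f x))"
  have "((\<lambda>x. flat m (f x)) has_derivative ?E x) (at x)" for x
    using DERIV_compose_FDERIV[OF flat_has_derivative D(1)] by simp
  then show ?case
    by (intro exI[of _ ?E] conjI allI smooth_expr.intros D flat.hyps)
qed

lemma smooth_expr_Ck: "smooth_expr f \<Longrightarrow> Ck k f"
proof (induction k arbitrary: f)
  case 0
  then obtain D where "\<And>x. (f has_derivative D x) (at x)"
    using smooth_expr_derivative by blast
  then show ?case
    by (auto intro!: continuous_at_imp_continuous_on has_derivative_continuous)
next
  case (Suc k)
  then obtain D where D: "\<And>x. (f has_derivative D x) (at x)" "\<And>i. smooth_expr (\<lambda>x. D x (axis i 1))"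
    using smooth_expr_derivative by blast
  have "partial_deriv i f = (\<lambda>x. D x (axis i 1))" for i
    using frechet_derivative_at[OF D(1)] by (auto simp: partial_deriv_def fun_eq_iff)
  then show ?case
    using Suc.IH D by (auto simp: differentiable_def)
qed

lemma smooth_expr_prod:
  assumes "finite I" "\<And>i. i \<in> I \<Longrightarrow> smooth_expr (f i)"
  shows "smooth_expr (\<lambda>x. \<Prod>i\<in>I. f i x)"
  using assms by (induction I rule: finite_induct) (auto intro: smooth_expr.intros)

text \<open>The product is positive exactly on the open box; composing it with \<open>1 - e\<^bsup>-j
  t\<^esup>\<close> gives test functions with values in \<open>[0,1]\<close> that increase to the
  indicator of the box as \<open>j\<close> grows.\<close>

definition bump :: "real^'n \<Rightarrow> real^'n \<Rightarrow> nat \<Rightarrow> real^'n::finite \<Rightarrow> real" where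
  "bump a b j x =
     1 - exp (- (real j * (\<Prod>i\<in>UNIV. flat 0 (x $ i - a $ i) * flat 0 (b $ i - x $ i))))"

lemma bump_smooth: "smooth_expr (bump a b j)"
proof -
  have "smooth_expr (\<lambda>x. \<Prod>i\<in>UNIV. flat 0 (x $ i + (- a $ i)) * flat 0 (b $ i + (-1) * x $ i))"
    by (intro smooth_expr_prod smooth_expr.intros) auto
  then have "smooth_expr (\<lambda>x. 1 + (-1) * exp ((- real j) *
      (\<Prod>i\<in>UNIV. flat 0 (x $ i + (- a $ i)) * flat 0 (b $ i + (-1) * x $ i))))"
    by (intro smooth_expr.intros)
  then show ?thesis unfolding bump_def[abs_def] by simp
qed

lemma flat_nonneg: "flat m t \<ge> 0"
  by (simp add: flat_def)

lemma flat_pos_iff: "flat 0 t > 0 \<longleftrightarrow> t > 0"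
  by (simp add: flat_def)

lemma bump_prod_pos_iff:
  fixes a b x :: "real^'n::finite"
  shows "(\<Prod>i\<in>UNIV. flat 0 (x $ i - a $ i) * flat 0 (b $ i - x $ i)) > 0 \<longleftrightarrow> x \<in> box a b"
proof
  assume "x \<in> box a b"
  then show "(\<Prod>i\<in>UNIV. flat 0 (x $ i - a $ i) * flat 0 (b $ i - x $ i)) > 0"
    by (intro prod_pos) (auto simp: mem_box_cart flat_pos_iff)
next
  assume *: "(\<Prod>i\<in>UNIV. flat 0 (x $ i - a $ i) * flat 0 (b $ i - x $ i)) > 0"
  then have "\<forall>i. flat 0 (x $ i - a $ i) * flat 0 (b $ i - x $ i) \<noteq> 0"
    by (metis (no_types, lifting) finite_UNIV less_irrefl prod_zero_iff UNIV_I finite)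
  then show "x \<in> box a b"
    by (auto simp: mem_box_cart flat_def split: if_splits)
qed

lemma bump_outside: "x \<notin> box a b \<Longrightarrow> bump a b j x = 0"
proof -
  assume "x \<notin> box a b"
  moreover have "(\<Prod>i\<in>UNIV. flat 0 (x $ i - a $ i) * flat 0 (b $ i - x $ i)) \<ge> 0"
    by (intro prod_nonneg) (auto simp: flat_nonneg)
  ultimately have "(\<Prod>i\<in>UNIV. flat 0 (x $ i - a $ i) * flat 0 (b $ i - x $ i)) = 0"
    using bump_prod_pos_iff[where x=x and a=a and b=b] by linarith
  then show ?thesis by (simp add: bump_def)
qed

lemma bump_bounds: "0 \<le> bump a b j x" "bump a b j x \<le> 1"
proof -
  have "(\<Prod>i\<in>UNIV. flat 0 (x $ i - a $ i) * flat 0 (b $ i - x $ i)) \<ge> 0"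
    by (intro prod_nonneg) (auto simp: flat_nonneg)
  then show "0 \<le> bump a b j x" "bump a b j x \<le> 1" by (auto simp: bump_def)
qed

lemma bump_tendsto_indicator: "(\<lambda>j. bump a b j x) \<longlonglongrightarrow> indicator (box a b) x"
proof (cases "x \<in> box a b")
  case True
  let ?P = "\<Prod>i\<in>UNIV. flat 0 (x $ i - a $ i) * flat 0 (b $ i - x $ i)"
  have "filterlim (\<lambda>j. real j * ?P) at_top sequentially"
    using bump_prod_pos_iff[where x=x and a=a and b=b] True
    by (intro filterlim_at_top_mult_tendsto_pos[OF tendsto_const] filterlim_real_sequentially) auto
  then have "(\<lambda>j. exp (- (real j * ?P))) \<longlonglongrightarrow> 0"
    by (intro filterlim_compose[OF exp_at_bot] filterlim_compose[OF filterlim_uminus_at_bot_at_top])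
  then have "(\<lambda>j. 1 - exp (- (real j * ?P))) \<longlonglongrightarrow> 1 - 0"
    by (intro tendsto_intros)
  then show ?thesis using True by (simp add: bump_def)
qed (simp add: bump_outside)

lemma bump_test_function:
  assumes "cbox a b \<subseteq> U"
  shows "test_function U (bump a b j)"
proof -
  have "closure {x. bump a b j x \<noteq> 0} \<subseteq> cbox a b"
    by (rule closure_minimal[OF _ closed_cbox])
      (use bump_outside[of _ a b j] box_subset_cbox[of a b] in auto)
  moreover from this have "compact (closure {x. bump a b j x \<noteq> 0})"
    using compact_cbox bounded_subset compact_imp_bounded compact_eq_bounded_closed
    by (metis closed_closure)
  ultimately show ?thesis
    using assms by (auto simp: test_function_def intro: smooth_expr_Ck bump_smooth)
qed

section \<open>The fundamental lemma of the calculus of variations\<close>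

text \<open>Boxes form an intersection-stable generator of the Borel sets, so the positive and the negative
  part of \<open>F\<close> on the box define the same finite measure.\<close>

lemma fundamental_lemma_box:
  fixes F :: "real^'n::finite \<Rightarrow> real"
  assumes F: "integrable lborel F"
    and zero: "\<And>c d. box c d \<subseteq> box a b \<Longrightarrow> (\<integral>x. F x * indicator (box c d) x \<partial>lborel) = 0"
  shows "AE x in lborel. x \<in> box a b \<longrightarrow> F x = 0"
proof -
  have [measurable]: "F \<in> borel_measurable borel" using F by auto
  define H where "H x = F x * indicator (box a b) x" for x
  have [measurable]: "H \<in> borel_measurable borel" unfolding H_def by measurable
  have H: "integrable lborel H"
    by (rule Bochner_Integration.integrable_bound[OF F]) (auto simp: H_def split: split_indicator)
  have fin: "(\<integral>\<^sup>+x. ennreal (H x) \<partial>lborel) < \<infinity>" "(\<integral>\<^sup>+x. ennreal (- H x) \<partial>lborel) < \<infinity>"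
    using H integrable_minus[OF H] by (auto simp: real_integrable_def less_top)
  have eq: "density lborel (\<lambda>x. ennreal (H x)) = density lborel (\<lambda>x. ennreal (- H x))"
  proof (rule measure_eqI_generator_eq)
    let ?E = "range (\<lambda>(a, b). box a b::(real^'n) set)"
    show "Int_stable ?E" by (auto simp: Int_stable_def box_Int_box)
    show "?E \<subseteq> Pow UNIV"
      "sets (density lborel (\<lambda>x. ennreal (H x))) = sigma_sets UNIV ?E"
      "sets (density lborel (\<lambda>x. ennreal (- H x))) = sigma_sets UNIV ?E"
      by (simp_all add: borel_eq_box)
    let ?A = "\<lambda>n::nat. box (- (real n *\<^sub>R One)) (real n *\<^sub>R One) :: (real^'n) set"
    show "range ?A \<subseteq> ?E" "(\<Union>i. ?A i) = UNIV" unfolding UN_box_eq_UNIV by auto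
    show "emeasure (density lborel (\<lambda>x. ennreal (H x))) (?A i) \<noteq> \<infinity>" for i
    proof -
      have "emeasure (density lborel (\<lambda>x. ennreal (H x))) (?A i) \<le> (\<integral>\<^sup>+x. ennreal (H x) \<partial>lborel)"
        by (subst emeasure_density) (auto intro!: nn_integral_mono split: split_indicator)
      then show ?thesis using fin by (auto simp: top_unique)
    qed
    fix X assume "X \<in> ?E"
    then obtain c d where X: "X = box c d" by auto
    have "\<exists>c' d'. box a b \<inter> X = box c' d'" unfolding X box_Int_box by blast
    then obtain c' d' where cd: "box a b \<inter> X = box c' d'" by blast
    define K where "K x = H x * indicator X x" for x
    have [measurable]: "K \<in> borel_measurable borel" unfolding K_def X by measurable
    have "K = (\<lambda>x. F x * indicator (box c' d') x)"
      unfolding K_def H_def cd[symmetric] by (auto split: split_indicator)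
    moreover have "box c' d' \<subseteq> box a b" using cd by auto
    ultimately have 0: "(\<integral>x. K x \<partial>lborel) = 0" using zero by simp
    have K: "integrable lborel K"
      by (rule Bochner_Integration.integrable_bound[OF H]) (auto simp: K_def split: split_indicator)
    have f1: "(\<integral>\<^sup>+x. ennreal (K x) \<partial>lborel) \<noteq> \<infinity>" "(\<integral>\<^sup>+x. ennreal (- K x) \<partial>lborel) \<noteq> \<infinity>"
      using K by (auto simp: real_integrable_def)
    have "enn2real (\<integral>\<^sup>+x. ennreal (K x) \<partial>lborel) = enn2real (\<integral>\<^sup>+x. ennreal (- K x) \<partial>lborel)"
      using 0 real_lebesgue_integral_def[OF K] by simp
    then have "(\<integral>\<^sup>+x. ennreal (K x) \<partial>lborel) = (\<integral>\<^sup>+x. ennreal (- K x) \<partial>lborel)"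
      using f1 by (metis ennreal_enn2real infinity_ennreal_def less_top)
    moreover have "emeasure (density lborel (\<lambda>x. ennreal (H x))) X = (\<integral>\<^sup>+x. ennreal (K x) \<partial>lborel)"
      by (subst emeasure_density) (auto simp: K_def X intro!: nn_integral_cong split: split_indicator)
    moreover have "emeasure (density lborel (\<lambda>x. ennreal (- H x))) X = (\<integral>\<^sup>+x. ennreal (- K x) \<partial>lborel)"
      by (subst emeasure_density) (auto simp: K_def X intro!: nn_integral_cong split: split_indicator)
    ultimately show "emeasure (density lborel (\<lambda>x. ennreal (H x))) X =
        emeasure (density lborel (\<lambda>x. ennreal (- H x))) X" by simp
  qed
  have "AE x in lborel. ennreal (H x) = ennreal (- H x)"
    by (rule sigma_finite_measure.density_unique[OF sigma_finite_lborel _ _ eq]) auto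
  then show ?thesis
  proof eventually_elim
    case (elim x)
    then show ?case
      by (cases "H x \<ge> 0") (auto simp: H_def ennreal_neg ennreal_eq_0_iff)
  qed
qed

text \<open>Testing with bumps and passing to the limit by dominated convergence shows that \<open>F\<close>
  has zero integral over every box whose closure lies in \<open>U\<close>.\<close>

lemma fundamental_lemma:
  fixes F :: "real^'n::finite \<Rightarrow> real"
  assumes F: "integrable lborel F" and U: "open U"
    and zero: "\<And>\<psi>. test_function U \<psi> \<Longrightarrow> (\<integral>x. F x * \<psi> x \<partial>lborel) = 0"
  shows "AE x in lborel. x \<in> U \<longrightarrow> F x = 0"
proof -
  have [measurable]: "F \<in> borel_measurable borel" using F by auto
  have box0: "(\<integral>x. F x * indicator (box c d) x \<partial>lborel) = 0" if "cbox c d \<subseteq> U" for c d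
  proof -
    have [measurable]: "bump c d j \<in> borel_measurable borel" for j
      using smooth_expr_Ck[OF bump_smooth, of 0 c d j] by (auto intro: borel_measurable_continuous_onI)
    have "(\<lambda>j. \<integral>x. F x * bump c d j x \<partial>lborel) \<longlonglongrightarrow> (\<integral>x. F x * indicator (box c d) x \<partial>lborel)"
    proof (rule integral_dominated_convergence[where w = "\<lambda>x. \<bar>F x\<bar>"])
      show "AE x in lborel. norm (F x * bump c d j x) \<le> \<bar>F x\<bar>" for j
        using bump_bounds[of c d j] by (auto simp: abs_mult intro!: mult_left_le)
      show "AE x in lborel. (\<lambda>j. F x * bump c d j x) \<longlonglongrightarrow> F x * indicator (box c d) x"
        by (intro AE_I2 tendsto_intros bump_tendsto_indicator)
    qed (use F in auto)
    moreover have "(\<integral>x. F x * bump c d j x \<partial>lborel) = 0" for j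
      by (rule zero[OF bump_test_function[OF that]])
    ultimately show ?thesis by (simp add: LIMSEQ_const_iff)
  qed
  have cb: "AE x in lborel. x \<in> cbox a b \<longrightarrow> F x = 0" if ab: "cbox a b \<subseteq> U" for a b
  proof -
    have "AE x in lborel. x \<in> box a b \<longrightarrow> F x = 0"
    proof (rule fundamental_lemma_box[OF F])
      fix c d assume cd: "box c d \<subseteq> box a b"
      show "(\<integral>x. F x * indicator (box c d) x \<partial>lborel) = 0"
      proof (cases "box c d = {}")
        case False
        then have "cbox c d \<subseteq> cbox a b"
          using closure_mono[OF cd] cd False
          by (cases "box a b = {}") (auto simp: closure_box)
        then show ?thesis using box0 ab by blast
      qed simp
    qed
    moreover have "AE x in lborel. x \<notin> cbox a b - box a b"
    proof -
      have "cbox a b - box a b \<in> null_sets lebesgue"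
        using negligible_frontier_interval negligible_iff_null_sets by blast
      then have "cbox a b - box a b \<in> null_sets lborel"
        by (subst (asm) null_sets_completion_iff) auto
      then show ?thesis by (rule AE_not_in)
    qed
    ultimately show ?thesis by eventually_elim auto
  qed
  obtain D where D: "countable D" "D \<subseteq> Pow U" "\<And>X. X \<in> D \<Longrightarrow> \<exists>a b. X = cbox a b" "\<Union>D = U"
    using open_countable_Union_open_cbox[OF U] by metis
  have "AE x in lborel. \<forall>X\<in>D. x \<in> X \<longrightarrow> F x = 0"
    unfolding AE_ball_countable[OF D(1)]
  proof
    fix X assume "X \<in> D"
    then obtain a b where "X = cbox a b" "cbox a b \<subseteq> U" using D by blast
    then show "AE x in lborel. x \<in> X \<longrightarrow> F x = 0" using cb by blast
  qed
  then show ?thesis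
    by eventually_elim (use D in blast)
qed

section \<open>Test functions: derivatives and translations\<close>

lemma test_function_continuous:
  assumes "test_function U \<psi>" shows "continuous_on UNIV \<psi>"
proof -
  have "Ck 0 \<psi>" using assms unfolding test_function_def by blast
  then show ?thesis by simp
qed

lemma test_function_partial:
  assumes "test_function U \<psi>"
  shows "\<psi> differentiable (at x)" "continuous_on UNIV (partial_deriv i \<psi>)"
proof -
  have "Ck 1 \<psi>" using assms unfolding test_function_def by blast
  then show "\<psi> differentiable (at x)" "continuous_on UNIV (partial_deriv i \<psi>)" by auto
qed

lemma test_function_has_derivative:
  assumes "test_function U \<psi>"
  shows "(\<psi> has_derivative (\<lambda>h. \<Sum>i\<in>UNIV. h $ i * partial_deriv i \<psi> x)) (at x)"
proof -
  let ?D = "frechet_derivative \<psi> (at x)"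
  have D: "(\<psi> has_derivative ?D) (at x)"
    using test_function_partial(1)[OF assms] frechet_derivative_works by blast
  then have lin: "linear ?D" by (rule has_derivative_linear)
  have "?D h = (\<Sum>i\<in>UNIV. h $ i * partial_deriv i \<psi> x)" for h
  proof -
    have "?D h = ?D (\<Sum>i\<in>UNIV. h $ i *\<^sub>R axis i 1)"
      using basis_expansion[of h] by (simp add: scalar_mult_eq_scaleR)
    also have "\<dots> = (\<Sum>i\<in>UNIV. h $ i * partial_deriv i \<psi> x)"
      by (simp add: linear_sum[OF lin] linear_scale[OF lin] partial_deriv_def)
    finally show ?thesis .
  qed
  then have "?D = (\<lambda>h. \<Sum>i\<in>UNIV. h $ i * partial_deriv i \<psi> x)" by auto
  with D show ?thesis by metis
qed

lemma test_function_outside: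
  assumes "test_function U \<psi>" "x \<notin> U"
  shows "\<psi> x = 0"
  using assms closure_subset[of "{x. \<psi> x \<noteq> 0}"] unfolding test_function_def by auto

lemma partial_deriv_outside:
  assumes "test_function U \<psi>" "x \<notin> closure {x. \<psi> x \<noteq> 0}"
  shows "partial_deriv i \<psi> x = 0"
proof -
  have "(\<psi> has_derivative (\<lambda>h. 0)) (at x)"
    by (rule has_derivative_transform_within_open[OF has_derivative_const[of 0], of "- closure {x. \<psi> x \<noteq> 0}"])
      (use assms closure_subset[of "{x. \<psi> x \<noteq> 0}"] in auto)
  then show ?thesis
    using frechet_derivative_at[of \<psi> "\<lambda>h. 0" x, symmetric] by (simp add: partial_deriv_def)
qed

lemma continuous_compact_support_bounded:
  fixes f :: "real^'n::finite \<Rightarrow> real"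
  assumes "continuous_on UNIV f" "compact S" "\<And>x. x \<notin> S \<Longrightarrow> f x = 0"
  shows "\<exists>C. \<forall>x. \<bar>f x\<bar> \<le> C"
proof -
  have "bounded (f ` S)"
    by (intro compact_imp_bounded compact_continuous_image continuous_on_subset[OF assms(1)] assms(2)) auto
  then obtain C where C: "\<And>x. x \<in> S \<Longrightarrow> \<bar>f x\<bar> \<le> C"
    by (auto simp: bounded_iff)
  have "\<bar>f x\<bar> \<le> max C 0" for x
    using C[of x] assms(3)[of x] by (cases "x \<in> S") auto
  then show ?thesis by blast
qed

lemma test_function_bounded:
  assumes "test_function U \<psi>"
  shows "\<exists>C. \<forall>x. \<bar>\<psi> x\<bar> \<le> C" "\<exists>C. \<forall>x. \<bar>partial_deriv i \<psi> x\<bar> \<le> C"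
proof -
  have c: "compact (closure {x. \<psi> x \<noteq> 0})" using assms by (simp add: test_function_def)
  show "\<exists>C. \<forall>x. \<bar>\<psi> x\<bar> \<le> C"
    by (rule continuous_compact_support_bounded[OF test_function_continuous[OF assms] c])
      (use closure_subset[of "{x. \<psi> x \<noteq> 0}"] in auto)
  show "\<exists>C. \<forall>x. \<bar>partial_deriv i \<psi> x\<bar> \<le> C"
    by (rule continuous_compact_support_bounded[OF test_function_partial(2)[OF assms] c])
      (rule partial_deriv_outside[OF assms])
qed

lemma partial_deriv_translate:
  fixes \<psi> :: "real^'n::finite \<Rightarrow> real"
  assumes "\<And>x. \<psi> differentiable (at x)"
  shows "partial_deriv i (\<lambda>x. \<psi> (x - v)) x = partial_deriv i \<psi> (x - v)"
    and "(\<lambda>x. \<psi> (x - v)) differentiable (at x)"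
proof -
  have D: "(\<psi> has_derivative frechet_derivative \<psi> (at (x - v))) (at (x - v))"
    using assms frechet_derivative_works by blast
  have "((\<lambda>x. x - v) has_derivative (\<lambda>h. h)) (at x)"
    by (auto intro!: derivative_eq_intros)
  from has_derivative_compose[OF this D]
  have *: "((\<lambda>x. \<psi> (x - v)) has_derivative frechet_derivative \<psi> (at (x - v))) (at x)" .
  then show "partial_deriv i (\<lambda>x. \<psi> (x - v)) x = partial_deriv i \<psi> (x - v)"
    unfolding partial_deriv_def using frechet_derivative_at by metis
  from * show "(\<lambda>x. \<psi> (x - v)) differentiable (at x)"
    unfolding differentiable_def by blast
qed

lemma Ck_translate: "Ck k \<psi> \<Longrightarrow> Ck k (\<lambda>x. \<psi> (x - v))"
proof (induction k arbitrary: \<psi>)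
  case 0
  then show ?case
    by (auto intro!: continuous_intros continuous_on_compose2[of UNIV \<psi>])
next
  case (Suc k)
  have "partial_deriv i (\<lambda>x. \<psi> (x - v)) = (\<lambda>x. partial_deriv i \<psi> (x - v))" for i
    using Suc.prems by (intro ext partial_deriv_translate(1)) auto
  then show ?case
    using Suc partial_deriv_translate(2)[of \<psi>] by auto
qed

lemma test_function_translate:
  assumes \<psi>: "test_function U \<psi>" and sub: "\<And>x. x \<in> U \<Longrightarrow> x + v \<in> V"
  shows "test_function V (\<lambda>x. \<psi> (x - v))"
proof -
  let ?S = "closure {x. \<psi> x \<noteq> 0}"
  have S: "compact ?S" "?S \<subseteq> U" using \<psi> by (auto simp: test_function_def)
  have c: "compact ((+) v ` ?S)"
    using S(1) by (rule compact_translation)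
  have "{x. \<psi> (x - v) \<noteq> 0} \<subseteq> (+) v ` ?S"
  proof
    fix x assume "x \<in> {x. \<psi> (x - v) \<noteq> 0}"
    then have "x - v \<in> ?S" using closure_subset[of "{x. \<psi> x \<noteq> 0}"] by auto
    then show "x \<in> (+) v ` ?S" by (rule rev_image_eqI) simp
  qed
  then have cl: "closure {x. \<psi> (x - v) \<noteq> 0} \<subseteq> (+) v ` ?S"
    by (rule closure_minimal) (rule compact_imp_closed[OF c])
  then have "compact (closure {x. \<psi> (x - v) \<noteq> 0})"
    using closed_Int_compact[OF closed_closure c, of "{x. \<psi> (x - v) \<noteq> 0}"] by (simp only: Int_absorb2)
  moreover have "(+) v ` ?S \<subseteq> V" using S(2) sub by (auto simp: add.commute)
  ultimately show ?thesis
    using \<psi> cl by (auto simp: test_function_def intro: Ck_translate)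
qed

section \<open>Increments of a weakly differentiable function\<close>

lemma nn_integral_lborel_translate:
  fixes v :: "'a::euclidean_space"
  assumes "f \<in> borel_measurable borel"
  shows "(\<integral>\<^sup>+x. f (x + v) \<partial>lborel) = (\<integral>\<^sup>+x. f x \<partial>lborel)"
  using assms by (subst (2) lborel_distr_plus[symmetric, of v])
    (simp add: nn_integral_distr add.commute)

lemma integral_lborel_translate:
  fixes v :: "'a::euclidean_space" and f :: "'a \<Rightarrow> real"
  assumes "f \<in> borel_measurable borel"
  shows "(\<integral>x. f (x + v) \<partial>lborel) = (\<integral>x. f x \<partial>lborel)"
  using assms by (subst (2) lborel_distr_plus[symmetric, of v])
    (simp add: integral_distr add.commute)

lemma integrable_lborel_translate:
  fixes v :: "'a::euclidean_space" and f :: "'a \<Rightarrow> real"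
  assumes "integrable lborel f"
  shows "integrable lborel (\<lambda>x. f (x + v))"
proof -
  have "integrable (distr lborel borel ((+) v)) f"
    using assms by (simp add: lborel_distr_plus)
  then show ?thesis
    by (subst (asm) integrable_distr_eq) (use assms in \<open>auto simp: add.commute\<close>)
qed

text \<open>The joint integrability that justifies each exchange of the segment parameter \<open>t\<close>
  with the space variable.\<close>

lemma segment_kernel_integrable:
  fixes g :: "real^'n::finite \<Rightarrow> real" and K :: "real \<times> (real^'n) \<Rightarrow> real"
  assumes g: "integrable lborel g" and K[measurable]: "K \<in> borel_measurable (lborel \<Otimes>\<^sub>M lborel)"
    and C: "\<And>z. \<bar>K z\<bar> \<le> C"
  shows "integrable (lborel \<Otimes>\<^sub>M lborel)
    (\<lambda>(t, x). indicator {0..1} t * g (x + t *\<^sub>R h) * K (t, x))"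
proof (rule integrableI_bounded)
  have [measurable]: "g \<in> borel_measurable borel" using g by auto
  have C0: "C \<ge> 0" using C[of undefined] by linarith
  have m1: "(\<lambda>z::real \<times> (real^'n). g (snd z + fst z *\<^sub>R h)) \<in> borel_measurable (lborel \<Otimes>\<^sub>M lborel)"
    by measurable
  show m: "(\<lambda>(t, x). indicator {0..1} t * g (x + t *\<^sub>R h) * K (t, x))
      \<in> borel_measurable (lborel \<Otimes>\<^sub>M lborel)"
    using m1 by (simp add: case_prod_beta) 
  have "(\<integral>\<^sup>+z. ennreal (norm (case z of (t, x) \<Rightarrow> indicator {0..1} t * g (x + t *\<^sub>R h) * K (t, x)))
          \<partial>(lborel \<Otimes>\<^sub>M lborel))
      \<le> (\<integral>\<^sup>+z. indicator {0..1} (fst z) * (ennreal C * ennreal \<bar>g (snd z + fst z *\<^sub>R h)\<bar>)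
          \<partial>(lborel \<Otimes>\<^sub>M lborel))"
  proof (rule nn_integral_mono)
    fix z :: "real \<times> (real^'n)"
    obtain t x where z: "z = (t, x)" by (cases z)
    have "\<bar>g (x + t *\<^sub>R h)\<bar> * \<bar>K (t, x)\<bar> \<le> C * \<bar>g (x + t *\<^sub>R h)\<bar>"
      using mult_right_mono[OF C[of "(t, x)"], of "\<bar>g (x + t *\<^sub>R h)\<bar>"] by (simp add: mult.commute)
    then show "ennreal (norm (case z of (t, x) \<Rightarrow> indicator {0..1} t * g (x + t *\<^sub>R h) * K (t, x)))
      \<le> indicator {0..1} (fst z) * (ennreal C * ennreal \<bar>g (snd z + fst z *\<^sub>R h)\<bar>)"
      using C0 by (auto simp: z abs_mult ennreal_mult[symmetric] split: split_indicator)
  qed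
  also have "\<dots> = (\<integral>\<^sup>+t. \<integral>\<^sup>+x. indicator {0..1} t * (ennreal C * ennreal \<bar>g (x + t *\<^sub>R h)\<bar>)
      \<partial>lborel \<partial>lborel)"
    by (subst lborel.nn_integral_fst[symmetric]) (auto intro!: m1 borel_measurable_times borel_measurable_abs measurable_compose[OF _ measurable_ennreal])
  also have "\<dots> = (\<integral>\<^sup>+t. indicator {0..1::real} t * (ennreal C * (\<integral>\<^sup>+x. ennreal \<bar>g x\<bar> \<partial>lborel)) \<partial>lborel)"
    by (intro nn_integral_cong, subst nn_integral_cmult, measurable, subst nn_integral_cmult, measurable,
        subst nn_integral_lborel_translate[of "\<lambda>x. ennreal \<bar>g x\<bar>"]) auto
  also have "\<dots> = ennreal C * (\<integral>\<^sup>+x. ennreal \<bar>g x\<bar> \<partial>lborel)"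
    by (subst nn_integral_multc) auto
  also have "\<dots> < \<infinity>"
    using g by (auto simp: integrable_iff_bounded ennreal_mult_less_top)
  finally show "(\<integral>\<^sup>+z. ennreal (norm (case z of (t, x) \<Rightarrow>
      indicator {0..1} t * g (x + t *\<^sub>R h) * K (t, x))) \<partial>(lborel \<Otimes>\<^sub>M lborel)) < \<infinity>" .
qed

lemma integrable_mult_bounded:
  fixes g K :: "'a \<Rightarrow> real"
  assumes g: "integrable M g" and K[measurable]: "K \<in> borel_measurable M"
    and C: "\<And>x. \<bar>K x\<bar> \<le> C"
  shows "integrable M (\<lambda>x. g x * K x)"
proof (rule Bochner_Integration.integrable_bound[of M "\<lambda>x. C * g x"])
  have "\<bar>g x\<bar> * \<bar>K x\<bar> \<le> \<bar>C * g x\<bar>" for x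
  proof -
    have "\<bar>g x\<bar> * \<bar>K x\<bar> \<le> \<bar>g x\<bar> * \<bar>C\<bar>" using C[of x] by (intro mult_left_mono) auto
    then show ?thesis by (simp add: abs_mult mult.commute)
  qed
  then show "AE x in M. norm (g x * K x) \<le> norm (C * g x)" by (auto simp: abs_mult)
qed (use g in auto)

text \<open>This is the fundamental theorem of calculus for \<open>t \<mapsto> \<psi>(y - t h)\<close>.\<close>

lemma test_function_increment:
  fixes \<psi> :: "real^'n::finite \<Rightarrow> real"
  assumes \<psi>: "test_function U \<psi>"
  shows "(\<integral>t. indicator {0..1} t * (\<Sum>i\<in>UNIV. h $ i * partial_deriv i \<psi> (y - t *\<^sub>R h)) \<partial>lborel)
      = \<psi> y - \<psi> (y - h)"
proof -
  have "(\<integral>t. (\<Sum>i\<in>UNIV. h $ i * partial_deriv i \<psi> (y - t *\<^sub>R h)) * indicator {0..1} t \<partial>lborel)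
      = - \<psi> (y - 1 *\<^sub>R h) - - \<psi> (y - 0 *\<^sub>R h)"
  proof (rule integral_FTC_Icc_real)
    fix t :: real
    have "((\<lambda>t. y - t *\<^sub>R h) has_derivative (\<lambda>s. - (s *\<^sub>R h))) (at t)"
      by (auto intro!: derivative_eq_intros)
    from has_derivative_compose[OF this test_function_has_derivative[OF \<psi>]]
    have "((\<lambda>t. - \<psi> (y - t *\<^sub>R h)) has_derivative
        (\<lambda>s. - (\<Sum>i\<in>UNIV. (- (s *\<^sub>R h)) $ i * partial_deriv i \<psi> (y - t *\<^sub>R h)))) (at t)"
      by (rule has_derivative_minus)
    moreover have "(\<lambda>s. - (\<Sum>i\<in>UNIV. (- (s *\<^sub>R h)) $ i * partial_deriv i \<psi> (y - t *\<^sub>R h)))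
        = (\<lambda>s. (\<Sum>i\<in>UNIV. h $ i * partial_deriv i \<psi> (y - t *\<^sub>R h)) * s)"
      by (auto simp: sum_negf[symmetric] sum_distrib_right intro!: ext sum.cong)
    ultimately show "((\<lambda>t. - \<psi> (y - t *\<^sub>R h)) has_real_derivative
        (\<Sum>i\<in>UNIV. h $ i * partial_deriv i \<psi> (y - t *\<^sub>R h))) (at t)"
      by (simp add: has_field_derivative_def)
    have "continuous_on UNIV (\<lambda>t. (\<Sum>i\<in>UNIV. h $ i * partial_deriv i \<psi> (y - t *\<^sub>R h)))"
      by (intro continuous_intros continuous_on_compose2[OF test_function_partial(2)[OF \<psi>]]) auto
    then show "isCont (\<lambda>t. (\<Sum>i\<in>UNIV. h $ i * partial_deriv i \<psi> (y - t *\<^sub>R h))) t"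
      by (simp add: continuous_on_eq_continuous_at)
  qed auto
  then show ?thesis by (simp add: mult.commute)
qed

text \<open>The increment of \<open>f\<close> by \<open>h\<close> is the integral of its gradient along the
  segment. Tested against \<open>\<psi>\<close>, the difference of the two sides becomes, after
  translations, the definition of the weak gradient applied to the translated test functions
  \<open>\<psi>(\<cdot> - t h)\<close>, which are admissible because \<open>B\<close> is convex;
  the fundamental lemma does the rest.\<close>

lemma weak_increment_formula:
  fixes f :: "real^'n::finite \<Rightarrow> real" and G :: "real^'n \<Rightarrow> real^'n"
  assumes f: "integrable lborel f" and G: "integrable lborel G"
    and B: "open B" "convex B"
    and ibp: "\<And>\<psi> i. test_function B \<psi> \<Longrightarrow>
      (\<integral>x. f x * partial_deriv i \<psi> x \<partial>lborel) = - (\<integral>x. G x $ i * \<psi> x \<partial>lborel)"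
  shows "AE x in lborel. x \<in> B \<and> x + h \<in> B \<longrightarrow>
    f (x + h) - f x = (\<integral>t. indicator {0..1} t * (G (x + t *\<^sub>R h) \<bullet> h) \<partial>lborel)"
proof -
  define U where "U = B \<inter> (\<lambda>x. x + h) -` B"
  have U: "open U" unfolding U_def
    by (intro open_Int B open_vimage continuous_intros)
  define g where "g x = G x \<bullet> h" for x
  have g: "integrable lborel g" unfolding g_def by (intro integrable_inner_left G)
  have [measurable]: "f \<in> borel_measurable borel" "g \<in> borel_measurable borel" "G \<in> borel_measurable borel"
    using f g G by auto
  define J where "J x = (\<integral>t. indicator {0..1} t * g (x + t *\<^sub>R h) \<partial>lborel)" for x
  have gi: "integrable (lborel \<Otimes>\<^sub>M lborel) (\<lambda>(t, x). indicator {0..1} t * g (x + t *\<^sub>R h))"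
    using segment_kernel_integrable[OF g, of "\<lambda>z. 1" 1 h] by simp
  have J: "integrable lborel J"
    unfolding J_def by (rule lborel_pair.integrable_snd[OF gi])
  have [measurable]: "J \<in> borel_measurable borel" using J by auto
  define F where "F x = f (x + h) - f x - J x" for x
  have F: "integrable lborel F"
    unfolding F_def by (intro Bochner_Integration.integrable_diff integrable_lborel_translate f J)
  have "AE x in lborel. x \<in> U \<longrightarrow> F x = 0"
  proof (rule fundamental_lemma[OF F U])
    fix \<psi> assume \<psi>: "test_function U \<psi>"
    obtain C where C: "\<And>x. \<bar>\<psi> x\<bar> \<le> C" using test_function_bounded(1)[OF \<psi>] by auto
    have [measurable]: "\<psi> \<in> borel_measurable borel" "partial_deriv i \<psi> \<in> borel_measurable borel" for i
      using test_function_continuous[OF \<psi>] test_function_partial(2)[OF \<psi>]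
      by (auto intro: borel_measurable_continuous_onI)
    define D where "D z = (\<Sum>i\<in>UNIV. h $ i * partial_deriv i \<psi> (snd z - fst z *\<^sub>R h))"
      for z :: "real \<times> (real^'n)"
    have Dm[measurable]: "D \<in> borel_measurable (lborel \<Otimes>\<^sub>M lborel)" unfolding D_def by measurable
    obtain E where E: "\<And>i x. \<bar>partial_deriv i \<psi> x\<bar> \<le> E i"
      using test_function_bounded(2)[OF \<psi>] by metis
    have DE: "\<bar>D z\<bar> \<le> (\<Sum>i\<in>UNIV. \<bar>h $ i\<bar> * E i)" for z
      unfolding D_def by (rule order_trans[OF sum_abs])
        (auto intro!: sum_mono mult_left_mono E simp: abs_mult)
    have trans: "(\<integral>x. g (x + t *\<^sub>R h) * \<psi> x \<partial>lborel) = - (\<integral>y. f y * D (t, y) \<partial>lborel)"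
      if t: "t \<in> {0..1}" for t
    proof -
      let ?\<psi> = "\<lambda>x. \<psi> (x - t *\<^sub>R h)"
      have t\<psi>: "test_function B ?\<psi>"
      proof (rule test_function_translate[OF \<psi>])
        fix x assume x: "x \<in> U"
        have "(1 - t) *\<^sub>R x + t *\<^sub>R (x + h) \<in> B"
          using x t by (intro convexD B) (auto simp: U_def)
        then show "x + t *\<^sub>R h \<in> B" by (simp add: algebra_simps)
      qed
      have pd: "partial_deriv i ?\<psi> y = partial_deriv i \<psi> (y - t *\<^sub>R h)" for i y
        by (rule partial_deriv_translate(1)[OF test_function_partial(1)[OF \<psi>]])
      have Gi: "integrable lborel (\<lambda>x. G x $ i * ?\<psi> x)" for i
      proof (rule integrable_mult_bounded[of _ _ _ C])
        show "integrable lborel (\<lambda>x. G x $ i)"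
          using integrable_inner_left[OF G, of "axis i 1"] by (simp add: inner_axis)
      qed (use C in auto)
      have fi: "integrable lborel (\<lambda>x. f x * partial_deriv i ?\<psi> x)" for i
        unfolding pd by (rule integrable_mult_bounded[OF f, of _ "E i"]) (use E in auto)
      have "(\<integral>x. g (x + t *\<^sub>R h) * \<psi> x \<partial>lborel) = (\<integral>x. g x * ?\<psi> x \<partial>lborel)"
        using integral_lborel_translate[of "\<lambda>x. g x * ?\<psi> x" "t *\<^sub>R h"] by simp
      also have "\<dots> = (\<integral>x. (\<Sum>i\<in>UNIV. h $ i * (G x $ i * ?\<psi> x)) \<partial>lborel)"
        by (simp add: g_def inner_vec_def sum_distrib_right sum_distrib_left mult_ac)
      also have "\<dots> = (\<Sum>i\<in>UNIV. h $ i * (\<integral>x. G x $ i * ?\<psi> x \<partial>lborel))"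
        by (subst Bochner_Integration.integral_sum) (use Gi in auto)
      also have "\<dots> = (\<Sum>i\<in>UNIV. - (h $ i * (\<integral>x. f x * partial_deriv i ?\<psi> x \<partial>lborel)))"
        by (simp add: ibp[OF t\<psi>])
      also have "\<dots> = - (\<integral>x. (\<Sum>i\<in>UNIV. h $ i * (f x * partial_deriv i ?\<psi> x)) \<partial>lborel)"
        by (subst Bochner_Integration.integral_sum) (use fi in \<open>auto simp: sum_negf\<close>)
      also have "\<dots> = - (\<integral>y. f y * D (t, y) \<partial>lborel)"
        by (simp add: D_def pd sum_distrib_left mult_ac)
      finally show ?thesis .
    qed
    have k1: "integrable (lborel \<Otimes>\<^sub>M lborel) (\<lambda>(t, x). indicator {0..1} t * g (x + t *\<^sub>R h) * \<psi> x)"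
      using segment_kernel_integrable[OF g, of "\<lambda>z. \<psi> (snd z)" C h] C by simp
    have k2: "integrable (lborel \<Otimes>\<^sub>M lborel) (\<lambda>(t, y). indicator {0..1} t * f y * D (t, y))"
      using segment_kernel_integrable[OF f Dm DE, of 0] by simp
    have "(\<integral>x. J x * \<psi> x \<partial>lborel)
        = (\<integral>x. (\<integral>t. indicator {0..1} t * g (x + t *\<^sub>R h) * \<psi> x \<partial>lborel) \<partial>lborel)"
      unfolding J_def by simp
    also have "\<dots> = (\<integral>t. (\<integral>x. indicator {0..1} t * g (x + t *\<^sub>R h) * \<psi> x \<partial>lborel) \<partial>lborel)"
      by (rule lborel_pair.Fubini_integral[OF k1])
    also have "\<dots> = (\<integral>t. indicator {0..1} t * (\<integral>x. g (x + t *\<^sub>R h) * \<psi> x \<partial>lborel) \<partial>lborel)"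
      by (simp add: mult.assoc)
    also have "\<dots> = (\<integral>t. - (\<integral>y. indicator {0..1} t * f y * D (t, y) \<partial>lborel) \<partial>lborel)"
      by (rule Bochner_Integration.integral_cong) (auto simp: trans mult.assoc split: split_indicator)
    also have "\<dots> = - (\<integral>y. (\<integral>t. indicator {0..1} t * f y * D (t, y) \<partial>lborel) \<partial>lborel)"
      by (simp add: lborel_pair.Fubini_integral[OF k2])
    also have "\<dots> = - (\<integral>y. f y * (\<integral>t. indicator {0..1} t * D (t, y) \<partial>lborel) \<partial>lborel)"
      by (simp add: mult_ac flip: Bochner_Integration.integral_mult_right_zero)
    also have "\<dots> = - (\<integral>y. f y * (\<psi> y - \<psi> (y - h)) \<partial>lborel)"
      using test_function_increment[OF \<psi>, of h] by (simp add: D_def)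
    finally have 1: "(\<integral>x. J x * \<psi> x \<partial>lborel) = - (\<integral>y. f y * (\<psi> y - \<psi> (y - h)) \<partial>lborel)" .
    have i1: "integrable lborel (\<lambda>y. f y * \<psi> y)" "integrable lborel (\<lambda>y. f y * \<psi> (y - h))"
      "integrable lborel (\<lambda>x. J x * \<psi> x)"
      using C by (auto intro!: integrable_mult_bounded[where C = C] f J)
    have i2: "integrable lborel (\<lambda>x. f (x + h) * \<psi> x)"
      using integrable_lborel_translate[OF i1(2), of h] by simp
    have 2: "(\<integral>x. f (x + h) * \<psi> x \<partial>lborel) = (\<integral>y. f y * \<psi> (y - h) \<partial>lborel)"
      using integral_lborel_translate[of "\<lambda>y. f y * \<psi> (y - h)" h] by simp
    have "(\<integral>x. F x * \<psi> x \<partial>lborel) = (\<integral>x. f (x + h) * \<psi> x - f x * \<psi> x - J x * \<psi> x \<partial>lborel)"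
      by (simp add: F_def algebra_simps)
    also have "\<dots> = (\<integral>x. f (x + h) * \<psi> x \<partial>lborel) - (\<integral>x. f x * \<psi> x \<partial>lborel) - (\<integral>x. J x * \<psi> x \<partial>lborel)"
      using i1 i2 by simp
    also have "\<dots> = 0"
      unfolding 1 2 using i1 by (simp add: right_diff_distrib)
    finally show "(\<integral>x. F x * \<psi> x \<partial>lborel) = 0" .
  qed
  then show ?thesis
    by eventually_elim (auto simp: U_def F_def J_def g_def)
qed

section \<open>The De Giorgi--Poincare inequality\<close>

lemma indefinite_integral_continuous:
  fixes g :: "real \<Rightarrow> real"
  assumes g: "integrable lborel (\<lambda>t. indicator {0..1} t * g t)"
  shows "continuous_on {0..1} (\<lambda>s. \<integral>t. indicator {0..s} t * g t \<partial>lborel)"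
proof -
  have int: "set_integrable lborel {0..1} g" using g by (simp add: set_integrable_def)
  have "(\<integral>t. indicator {0..s} t * g t \<partial>lborel) = integral {0..s} g" if "s \<in> {0..1}" for s
  proof -
    have "set_integrable lborel {0..s} g"
      by (rule set_integrable_subset[OF int]) (use that in auto)
    from set_borel_integral_eq_integral(2)[OF this] show ?thesis
      by (simp add: set_lebesgue_integral_def)
  qed
  moreover have "continuous_on {0..1} (\<lambda>s. integral {0..s} g)"
    by (rule indefinite_integral_continuous_1) (rule set_borel_integral_eq_integral(1)[OF int])
  ultimately show ?thesis
    by (subst continuous_on_cong[OF refl, of _ _ "\<lambda>s. integral {0..s} g"]) auto
qed

text \<open>A continuous path that descends from \<open>b\<close> to \<open>a\<close> has a subinterval on
  which it stays strictly between the two values while its endpoints realise the full drop. Only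
  the derivative on that subinterval is paid for, which localises the gradient to the layer
  \<open>{a < W < b}\<close>.\<close>

lemma crossing_bound:
  fixes g :: "real \<Rightarrow> real" and a b w :: real
  assumes g: "integrable lborel (\<lambda>t. indicator {0..1} t * g t)"
  defines "W \<equiv> \<lambda>s. w + (\<integral>t. indicator {0..s} t * g t \<partial>lborel)"
  assumes b: "W 0 \<ge> b" and a: "W 1 \<le> a" and ab: "a < b"
  shows "ennreal (b - a) \<le>
    (\<integral>\<^sup>+t. indicator {0..1} t * ennreal \<bar>g t\<bar> * indicator {a<..<b} (W t) \<partial>lborel)"
proof -
  have W: "continuous_on {0..1} W"
    unfolding W_def by (intro continuous_intros indefinite_integral_continuous g)
  define S where "S = {t \<in> {0..1}. W t \<ge> b}"
  have S: "compact S" "S \<noteq> {}"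
  proof -
    have "closed ({0..1} \<inter> W -` {b..})" by (rule continuous_closed_preimage[OF W]) auto
    moreover have "S = {0..1} \<inter> W -` {b..}" by (auto simp: S_def)
    ultimately show "compact S" by (simp add: compact_eq_bounded_closed bounded_Int)
    show "S \<noteq> {}" using b by (auto simp: S_def intro!: exI[of _ 0])
  qed
  \<comment> \<open>\<open>s\<close> is the last time at which the path is at least
    \<open>b\<close>, and \<open>r\<close> below the first later time at which it is at most
    \<open>a\<close>.\<close>
  obtain s where s: "s \<in> S" "\<And>t. t \<in> S \<Longrightarrow> t \<le> s"
    using compact_attains_sup[OF S] by blast
  define T where "T = {t \<in> {s..1}. W t \<le> a}"
  have s01: "0 \<le> s" "s \<le> 1" and Ws: "W s \<ge> b" using s by (auto simp: S_def)
  have T: "compact T" "T \<noteq> {}"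
  proof -
    have "closed ({s..1} \<inter> W -` {..a})"
      by (rule continuous_closed_preimage[OF continuous_on_subset[OF W]]) (use s01 in auto)
    moreover have "T = {s..1} \<inter> W -` {..a}" by (auto simp: T_def)
    ultimately show "compact T" by (simp add: compact_eq_bounded_closed bounded_Int)
    show "T \<noteq> {}" using a s01 by (auto simp: T_def intro!: exI[of _ 1])
  qed
  obtain r where r: "r \<in> T" "\<And>t. t \<in> T \<Longrightarrow> r \<le> t"
    using compact_attains_inf[OF T] by blast
  have r01: "s \<le> r" "r \<le> 1" and Wr: "W r \<le> a" using r by (auto simp: T_def)
  have mid: "W t \<in> {a<..<b}" if "s < t" "t < r" for t
    using s(2)[of t] r(2)[of t] that s01 r01 by (force simp: S_def T_def)
  have ii: "integrable lborel (\<lambda>t. indicator I t * g t)" if "I \<subseteq> {0..1}" "I \<in> sets borel" for I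
  proof -
    have "integrable lborel (\<lambda>t. indicator I t *\<^sub>R (indicator {0..1} t * g t))"
      by (rule integrable_mult_indicator[OF _ g]) (use that in simp)
    moreover have "(\<lambda>t. indicator I t *\<^sub>R (indicator {0..1} t * g t)) = (\<lambda>t. indicator I t * g t)"
      using that(1) by (intro ext) (auto split: split_indicator)
    ultimately show ?thesis by simp
  qed
  have "(\<integral>t. indicator {0..r} t * g t \<partial>lborel) - (\<integral>t. indicator {0..s} t * g t \<partial>lborel)
      = (\<integral>t. indicator {0..r} t * g t - indicator {0..s} t * g t \<partial>lborel)"
    by (intro Bochner_Integration.integral_diff[symmetric] ii) (use s01 r01 in auto)
  also have "\<dots> = (\<integral>t. indicator {s<..r} t * g t \<partial>lborel)"
    by (intro Bochner_Integration.integral_cong) (use s01 r01 in \<open>auto split: split_indicator\<close>)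
  finally have "W r - W s = (\<integral>t. indicator {s<..r} t * g t \<partial>lborel)" by (simp add: W_def)
  then have "b - a \<le> norm (\<integral>t. indicator {s<..r} t * g t \<partial>lborel)" using Ws Wr by auto
  then have "ennreal (b - a) \<le> ennreal (norm (\<integral>t. indicator {s<..r} t * g t \<partial>lborel))"
    by (rule ennreal_leI)
  also have "\<dots> \<le> (\<integral>\<^sup>+t. ennreal (norm (indicator {s<..r} t * g t)) \<partial>lborel)"
    by (rule integral_norm_bound_ennreal) (rule ii, use s01 r01 in auto)
  also have "\<dots> \<le> (\<integral>\<^sup>+t. indicator {0..1} t * ennreal \<bar>g t\<bar> * indicator {a<..<b} (W t) \<partial>lborel)"
  proof (rule nn_integral_mono_AE)
    have "AE t in lborel. t \<noteq> r" by (rule AE_lborel_singleton)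
    then show "AE t in lborel. ennreal (norm (indicator {s<..r} t * g t))
        \<le> indicator {0..1} t * ennreal \<bar>g t\<bar> * indicator {a<..<b} (W t)"
    proof eventually_elim
      case (elim t)
      show ?case
      proof (cases "s < t \<and> t < r")
        case True
        then have "t \<in> {0..1}" using s01 r01 by auto
        then show ?thesis using mid True by (auto simp: abs_mult split: split_indicator)
      qed (use elim in \<open>auto split: split_indicator\<close>)
    qed
  qed
  finally show ?thesis .
qed

text \<open>For almost every \<open>x\<close>, the increment formula holds for almost every parameter
  \<open>s\<close> simultaneously (Fubini), so \<open>s \<mapsto> f(x + s h)\<close> agrees almost
  everywhere with a continuous path to which \<open>crossing_bound\<close> applies.\<close>

lemma weak_crossing_bound:
  fixes f :: "real^'n::finite \<Rightarrow> real" and G :: "real^'n \<Rightarrow> real^'n"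
  assumes f: "integrable lborel f" and G: "integrable lborel G"
    and B: "open B" "convex B"
    and ibp: "\<And>\<psi> i. test_function B \<psi> \<Longrightarrow>
      (\<integral>x. f x * partial_deriv i \<psi> x \<partial>lborel) = - (\<integral>x. G x $ i * \<psi> x \<partial>lborel)"
    and ab: "a < b"
  shows "AE x in lborel. x \<in> B \<and> x + h \<in> B \<and> f x \<ge> b \<and> f (x + h) \<le> a \<longrightarrow>
    ennreal (b - a) \<le> (\<integral>\<^sup>+t. indicator {0..1} t * ennreal (norm h) *
      (ennreal (norm (G (x + t *\<^sub>R h))) * indicator {y \<in> B. a < f y \<and> f y < b} (x + t *\<^sub>R h)) \<partial>lborel)"
proof -
  define g where "g x = G x \<bullet> h" for x
  have g: "integrable lborel g" unfolding g_def by (intro integrable_inner_left G)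
  have [measurable]: "f \<in> borel_measurable borel" "g \<in> borel_measurable borel" "G \<in> borel_measurable borel"
    using f g G by auto
  have [measurable]: "B \<in> sets borel" using B by auto
  define V where "V x s = (\<integral>t. indicator {0..s} t * g (x + t *\<^sub>R h) \<partial>lborel)" for x s
  have V': "V x s = (\<integral>t. (if 0 \<le> t \<and> t \<le> s then g (x + t *\<^sub>R h) else 0) \<partial>lborel)" for x s
    unfolding V_def by (intro Bochner_Integration.integral_cong) (auto split: split_indicator)
  have Vm[measurable]: "(\<lambda>z. V (fst z) (snd z)) \<in> borel_measurable (lborel \<Otimes>\<^sub>M lborel)"
    unfolding V' by measurable
  have each: "AE x in lborel. x \<in> B \<and> x + h \<in> B \<longrightarrow> f (x + s *\<^sub>R h) = f x + V x s"
    if s: "s \<in> {0..1}" for s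
  proof (cases "s = 0")
    case True
    have "V x 0 = 0" for x
    proof -
      have "AE t in lborel. indicator {0..0} t * g (x + t *\<^sub>R h) = 0"
        using AE_lborel_singleton[of 0] by eventually_elim auto
      then show ?thesis unfolding V_def by (rule integral_eq_zero_AE)
    qed
    then show ?thesis using True by simp
  next
    case False
    then have s0: "0 < s" using s by auto
    have "AE x in lborel. x \<in> B \<and> x + s *\<^sub>R h \<in> B \<longrightarrow>
      f (x + s *\<^sub>R h) - f x =
        (\<integral>t. indicator {0..1} t * (G (x + t *\<^sub>R (s *\<^sub>R h)) \<bullet> (s *\<^sub>R h)) \<partial>lborel)"
      by (rule weak_increment_formula[OF f G B ibp])
    then show ?thesis
    proof eventually_elim
      case (elim x)
      show ?case
      proof safe
        assume x: "x \<in> B" "x + h \<in> B"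
        have "(1 - s) *\<^sub>R x + s *\<^sub>R (x + h) \<in> B" using x s by (intro convexD B) auto
        then have "x + s *\<^sub>R h \<in> B" by (simp add: algebra_simps)
        with elim x have "f (x + s *\<^sub>R h) - f x =
            (\<integral>t. indicator {0..1} t * (G (x + t *\<^sub>R (s *\<^sub>R h)) \<bullet> (s *\<^sub>R h)) \<partial>lborel)" by auto
        also have "\<dots> = s * (\<integral>t. indicator {0..s} (0 + s * t) * g (x + (0 + s * t) *\<^sub>R h) \<partial>lborel)"
          unfolding integral_mult_right_zero[symmetric]
          by (intro Bochner_Integration.integral_cong)
            (use s0 in \<open>auto simp: g_def mult.commute mult_le_cancel_left1 zero_le_mult_iff split: split_indicator\<close>)
        also have "\<dots> = V x s"
          unfolding V_def using s0
          by (subst (2) lborel_integral_real_affine[of s _ 0]) auto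
        finally show "f (x + s *\<^sub>R h) = f x + V x s" by simp
      qed
    qed
  qed
  \<comment> \<open>The exceptional null set of \<open>each\<close> depends on \<open>s\<close>;
    Fubini exchanges the quantifiers.\<close>
  have ae1: "AE x in lborel. AE s in lborel. s \<in> {0..1} \<longrightarrow> x \<in> B \<longrightarrow> x + h \<in> B \<longrightarrow>
      f (x + s *\<^sub>R h) = f x + V x s"
  proof (subst lborel_pair.AE_commute)
    show "AE s in lborel. AE x in lborel. s \<in> {0..1} \<longrightarrow> x \<in> B \<longrightarrow> x + h \<in> B \<longrightarrow>
        f (x + s *\<^sub>R h) = f x + V x s"
    proof (rule AE_I2)
      fix s
      show "AE x in lborel. s \<in> {0..1} \<longrightarrow> x \<in> B \<longrightarrow> x + h \<in> B \<longrightarrow> f (x + s *\<^sub>R h) = f x + V x s"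
      proof (cases "s \<in> {0..1}")
        case True
        from each[OF this] show ?thesis by eventually_elim auto
      qed (intro AE_I2, blast)
    qed
  qed measurable
  have ae2: "AE x in lborel. integrable lborel (\<lambda>t. indicator {0..1} t * g (x + t *\<^sub>R h))"
    by (rule lborel_pair.AE_integrable_snd)
      (use segment_kernel_integrable[OF g, of "\<lambda>z. 1" 1 h] in simp)
  have ae3: "AE x in lborel. x \<in> B \<and> x + h \<in> B \<longrightarrow> f (x + h) = f x + V x 1"
    using each[of 1] by simp
  show ?thesis
    using ae1 ae2 ae3
  proof eventually_elim
    case (elim x)
    show ?case
    proof safe
      assume x: "x \<in> B" "x + h \<in> B" "b \<le> f x" "f (x + h) \<le> a"
      have V0: "V x 0 = 0"
      proof -
        have "AE t in lborel. indicator {0..0} t * g (x + t *\<^sub>R h) = 0"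
          using AE_lborel_singleton[of 0] by eventually_elim auto
        then show ?thesis unfolding V_def by (rule integral_eq_zero_AE)
      qed
      have "ennreal (b - a) \<le> (\<integral>\<^sup>+t. indicator {0..1} t * ennreal \<bar>g (x + t *\<^sub>R h)\<bar> *
          indicator {a<..<b} (f x + V x t) \<partial>lborel)"
        unfolding V_def
        by (rule crossing_bound[OF elim(2) _ _ ab]) (use x V0 elim(3) in \<open>auto simp: V_def\<close>)
      also have "\<dots> \<le> (\<integral>\<^sup>+t. indicator {0..1} t * ennreal (norm h) *
          (ennreal (norm (G (x + t *\<^sub>R h))) * indicator {y \<in> B. a < f y \<and> f y < b} (x + t *\<^sub>R h)) \<partial>lborel)"
      proof (rule nn_integral_mono_AE)
        show "AE t in lborel. indicator {0..1} t * ennreal \<bar>g (x + t *\<^sub>R h)\<bar> *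
            indicator {a<..<b} (f x + V x t) \<le> indicator {0..1} t * ennreal (norm h) *
          (ennreal (norm (G (x + t *\<^sub>R h))) * indicator {y \<in> B. a < f y \<and> f y < b} (x + t *\<^sub>R h))"
          using elim(1)
        proof eventually_elim
          case t: (elim t)
          show ?case
          proof (cases "t \<in> {0..1} \<and> f x + V x t \<in> {a<..<b}")
            case True
            have "(1 - t) *\<^sub>R x + t *\<^sub>R (x + h) \<in> B" using x True by (intro convexD B) auto
            then have "x + t *\<^sub>R h \<in> B" by (simp add: algebra_simps)
            moreover have "f (x + t *\<^sub>R h) = f x + V x t" using t True x by auto
            moreover have "\<bar>g (x + t *\<^sub>R h)\<bar> \<le> norm h * norm (G (x + t *\<^sub>R h))"
              unfolding g_def using Cauchy_Schwarz_ineq2[of "G (x + t *\<^sub>R h)" h] by (simp add: mult.commute)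
            ultimately show ?thesis
              using True by (simp add: ennreal_mult[symmetric] ennreal_leI)
          qed (auto split: split_indicator)
        qed
      qed
      finally show "ennreal (b - a) \<le> (\<integral>\<^sup>+t. indicator {0..1} t * ennreal (norm h) *
          (ennreal (norm (G (x + t *\<^sub>R h))) * indicator {y \<in> B. a < f y \<and> f y < b} (x + t *\<^sub>R h)) \<partial>lborel)" .
    qed
  qed
qed

lemma nn_integral_powr_from_0:
  assumes "b < 1"
  shows "(\<integral>\<^sup>+t. indicator {0..1} t * ennreal (t powr (- b)) \<partial>lborel) = ennreal (1 / (1 - b))"
proof -
  have "((\<lambda>t. t powr (- b)) has_integral (1 powr (- b + 1) / (- b + 1))) {0..1}"
    by (rule has_integral_powr_from_0) (use assms in auto)
  then have "(\<integral>\<^sup>+t. ennreal (t powr (- b)) * indicator {0..1} t \<partial>lborel) = ennreal (1 powr (- b + 1) / (- b + 1))"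
    by (intro nn_integral_has_integral_lebesgue') auto
  then show ?thesis by (simp add: mult.commute add.commute)
qed

text \<open>The set of directions has measure at most \<open>|C|\<close>, and at most \<open>|A| /
  t\<^sup>n\<close> by scaling; the right-hand side is the geometric mean of the two bounds with
  weights \<open>1 - \<alpha>\<close> and \<open>\<alpha>\<close>. For \<open>n \<alpha> <
  1\<close> it is integrable in \<open>t\<close> at \<open>0\<close>.\<close>

lemma dilated_overlap_bound:
  fixes A C :: "'a::euclidean_space set" and \<alpha> t :: real
  assumes A: "A \<in> sets borel" "emeasure lborel A < \<infinity>" and C: "C \<in> sets borel" "emeasure lborel C < \<infinity>"
    and t: "0 < t" and \<alpha>: "0 \<le> \<alpha>" "\<alpha> \<le> 1"
  shows "(\<integral>\<^sup>+h. indicator C h * indicator A (y - t *\<^sub>R h) \<partial>lborel)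
    \<le> ennreal (measure lborel C powr (1 - \<alpha>) * measure lborel A powr \<alpha> * t powr (- (DIM('a) * \<alpha>)))"
proof -
  note [measurable] = A(1) C(1)
  let ?X = "\<integral>\<^sup>+h. indicator C h * indicator A (y - t *\<^sub>R h) \<partial>lborel"
  have XC: "?X \<le> emeasure lborel C"
  proof -
    have "?X \<le> (\<integral>\<^sup>+h. indicator C h \<partial>lborel)"
      by (intro nn_integral_mono) (auto split: split_indicator)
    then show ?thesis by simp
  qed
  then have fin: "?X < \<infinity>" using C(2) by (rule le_less_trans)
  define X where "X = enn2real ?X"
  have X: "?X = ennreal X" "X \<ge> 0"
    using fin by (auto simp: X_def ennreal_enn2real_if top.not_eq_extremum)
  have X1: "X \<le> measure lborel C"
    using enn2real_mono[OF XC] C(2) by (simp add: X_def measure_def)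
  have "emeasure lborel A =
      emeasure (density (distr lborel borel (\<lambda>x. y + (- t) *\<^sub>R x)) (\<lambda>_. \<bar>- t\<bar>^DIM('a))) A"
    using lborel_affine[of "- t" y] t by (intro arg_cong2[where f = emeasure] refl) auto
  also have "\<dots> = (\<integral>\<^sup>+h. ennreal (t ^ DIM('a)) * indicator A (y - t *\<^sub>R h) \<partial>lborel)"
    using t by (simp add: emeasure_density nn_integral_distr)
  also have "\<dots> \<ge> ennreal (t ^ DIM('a)) * ?X"
    by (subst nn_integral_cmult[symmetric]) (auto intro!: nn_integral_mono split: split_indicator)
  finally have "ennreal (t ^ DIM('a) * X) \<le> ennreal (measure lborel A)"
    using A(2) t X by (simp add: ennreal_mult emeasure_eq_ennreal_measure)
  then have X2: "X \<le> measure lborel A / t ^ DIM('a)"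
    using t by (simp add: field_simps)
  have "X = X powr (1 - \<alpha>) * X powr \<alpha>"
    using X(2) by (cases "X = 0") (simp_all flip: powr_add)
  also have "\<dots> \<le> measure lborel C powr (1 - \<alpha>) * (measure lborel A / t ^ DIM('a)) powr \<alpha>"
    using X1 X2 X(2) \<alpha> by (intro mult_mono powr_mono2) auto
  also have "(measure lborel A / t ^ DIM('a)) powr \<alpha> = measure lborel A powr \<alpha> * t powr (- (DIM('a) * \<alpha>))"
  proof -
    have "(t ^ DIM('a)) powr \<alpha> = t powr (DIM('a) * \<alpha>)"
      using t by (simp add: powr_realpow[symmetric] powr_powr)
    then show ?thesis using t by (simp add: powr_divide powr_minus field_simps)
  qed
  finally show ?thesis using X by (simp add: mult.assoc ennreal_leI)
qed

text \<open>Every pair \<open>x \<in> A\<close>, \<open>x + h \<in> N\<close> forces the gradient in the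
  layer, integrated along the segment, to be at least \<open>(b - a) / |h|\<close>. Integrating
  over all pairs and collecting, for a fixed point of the layer, the segments that pass through it
  at time \<open>t\<close> leads to \<open>dilated_overlap_bound\<close>. The exponent
  \<open>\<alpha>\<close> may be any number below \<open>1/n\<close>; the endpoint would be the
  isoperimetric inequality.\<close>

lemma de_giorgi_poincare:
  fixes f :: "real^'n::finite \<Rightarrow> real" and G :: "real^'n \<Rightarrow> real^'n" and \<alpha> :: real
  assumes f: "integrable lborel f" and G: "integrable lborel G"
    and r: "0 < r"
    and ibp: "\<And>\<psi> i. test_function (ball y r) \<psi> \<Longrightarrow>
      (\<integral>x. f x * partial_deriv i \<psi> x \<partial>lborel) = - (\<integral>x. G x $ i * \<psi> x \<partial>lborel)"
    and ab: "a < b"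
    and A: "A \<in> sets borel" "A \<subseteq> {x \<in> ball y r. b \<le> f x}"
    and N: "N \<in> sets borel" "N \<subseteq> {x \<in> ball y r. f x \<le> a}"
    and \<alpha>: "0 \<le> \<alpha>" "CARD('n) * \<alpha> < 1"
  shows "(b - a) * measure lborel A powr (1 - \<alpha>) * measure lborel N
    \<le> 2 ^ (CARD('n) + 1) / (1 - CARD('n) * \<alpha>) * r * measure lborel (ball y r) powr (1 - \<alpha>) *
      (\<integral>x. indicator {x \<in> ball y r. a < f x \<and> f x < b} x * norm (G x) \<partial>lborel)"
proof -
  note [measurable] = A(1) N(1)
  have [measurable]: "f \<in> borel_measurable borel" "G \<in> borel_measurable borel" using f G by auto
  let ?n = "CARD('n)"
  define C where "C = (cball 0 (2 * r) :: (real^'n) set)"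
  have Cm[measurable]: "C \<in> sets borel" unfolding C_def by simp
  let ?B = "ball y r"
  have n1: "?n \<ge> 1" by (simp add: Suc_leI)
  have \<alpha>1: "\<alpha> < 1"
  proof -
    have "1 * \<alpha> \<le> ?n * \<alpha>" using n1 \<alpha>(1) by (intro mult_right_mono) auto
    then show ?thesis using \<alpha>(2) by simp
  qed
  define D where "D = {x \<in> ?B. a < f x \<and> f x < b}"
  have [measurable]: "D \<in> sets borel" unfolding D_def by measurable
  define k where "k x = ennreal (norm (G x)) * indicator D x" for x
  have [measurable]: "k \<in> borel_measurable borel" unfolding k_def by measurable
  define I where "I = (\<integral>x. indicator D x * norm (G x) \<partial>lborel)"
  have I0: "I \<ge> 0" unfolding I_def by (intro integral_nonneg_AE) auto
  have kI: "(\<integral>\<^sup>+x. k x \<partial>lborel) = ennreal I"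
  proof -
    have i: "integrable lborel (\<lambda>x. indicator D x * norm (G x))"
      by (rule Bochner_Integration.integrable_bound[OF G]) (auto split: split_indicator)
    have "(\<integral>\<^sup>+x. k x \<partial>lborel) = (\<integral>\<^sup>+x. ennreal (indicator D x * norm (G x)) \<partial>lborel)"
      by (intro nn_integral_cong) (auto simp: k_def split: split_indicator)
    also have "\<dots> = ennreal I"
      unfolding I_def by (rule nn_integral_eq_integral[OF i]) auto
    finally show ?thesis .
  qed
  have sub: "A \<subseteq> ?B" "N \<subseteq> ?B" using A N by auto
  have finB: "emeasure lborel ?B < \<infinity>" by (rule emeasure_lborel_ball_finite)
  have finA: "emeasure lborel A < \<infinity>" "emeasure lborel N < \<infinity>"
    using emeasure_mono[OF sub(1), of lborel] emeasure_mono[OF sub(2), of lborel] finB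
    by (auto intro: le_less_trans)
  have finC: "emeasure lborel C < \<infinity>" unfolding C_def by (rule emeasure_lborel_cball_finite)
  let ?c = "ennreal (b - a)"
  let ?bd = "\<lambda>t. measure lborel C powr (1 - \<alpha>) * measure lborel A powr \<alpha> * t powr (- (?n * \<alpha>))"
  \<comment> \<open>The left-hand side integrates \<open>b - a\<close> over all pairs \<open>(x, x
    + h)\<close> in \<open>A \<times> N\<close>.\<close>
  have "?c * emeasure lborel A * emeasure lborel N
      = (\<integral>\<^sup>+x. (\<integral>\<^sup>+h. indicator A x * indicator N (x + h) * ?c \<partial>lborel) \<partial>lborel)"
  proof -
    have "(\<integral>\<^sup>+h. indicator A x * indicator N (x + h) * ?c \<partial>lborel) = indicator A x * (emeasure lborel N * ?c)" for x
      using nn_integral_lborel_translate[of "\<lambda>h. indicator N h :: ennreal" x]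
      by (simp add: nn_integral_cmult nn_integral_multc mult.assoc add.commute)
    then show ?thesis by (simp add: nn_integral_multc mult_ac)
  qed
  also have "\<dots> = (\<integral>\<^sup>+h. (\<integral>\<^sup>+x. indicator A x * indicator N (x + h) * ?c \<partial>lborel) \<partial>lborel)"
    by (rule lborel_pair.Fubini'[symmetric]) measurable
  also have "\<dots> \<le> (\<integral>\<^sup>+h. (\<integral>\<^sup>+x. (\<integral>\<^sup>+t. indicator A x * indicator C h * (indicator {0..1} t * ennreal (2 * r)) *
      k (x + t *\<^sub>R h) \<partial>lborel) \<partial>lborel) \<partial>lborel)"
  proof (rule nn_integral_mono, rule nn_integral_mono_AE)
    fix h :: "real^'n"
    have "AE x in lborel. x \<in> ?B \<and> x + h \<in> ?B \<and> f x \<ge> b \<and> f (x + h) \<le> a \<longrightarrow>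
      ennreal (b - a) \<le> (\<integral>\<^sup>+t. indicator {0..1} t * ennreal (norm h) *
      (ennreal (norm (G (x + t *\<^sub>R h))) * indicator {y \<in> ?B. a < f y \<and> f y < b} (x + t *\<^sub>R h)) \<partial>lborel)"
      by (rule weak_crossing_bound[OF f G _ _ ibp ab]) auto
    then show "AE x in lborel. indicator A x * indicator N (x + h) * ?c \<le>
      (\<integral>\<^sup>+t. indicator A x * indicator C h * (indicator {0..1} t * ennreal (2 * r)) * k (x + t *\<^sub>R h) \<partial>lborel)"
    proof eventually_elim
      case (elim x)
      show ?case
      proof (cases "x \<in> A \<and> x + h \<in> N")
        case True
        then have *: "x \<in> ?B" "x + h \<in> ?B" "f x \<ge> b" "f (x + h) \<le> a" using A N by auto
        have "norm h \<le> 2 * r"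
        proof -
          have "norm h = dist x (x + h)" by (simp add: dist_norm)
          also have "\<dots> \<le> dist x y + dist y (x + h)" by (rule dist_triangle)
          also have "\<dots> \<le> 2 * r" using *(1,2) by (simp add: dist_commute)
          finally show ?thesis .
        qed
        then have h: "h \<in> C" "ennreal (norm h) \<le> ennreal (2 * r)" by (auto simp: C_def intro: ennreal_leI)
        have "?c \<le> (\<integral>\<^sup>+t. indicator {0..1} t * ennreal (norm h) * k (x + t *\<^sub>R h) \<partial>lborel)"
          using elim * by (auto simp: k_def D_def)
        also have "\<dots> \<le> (\<integral>\<^sup>+t. indicator A x * indicator C h * (indicator {0..1} t * ennreal (2 * r)) *
            k (x + t *\<^sub>R h) \<partial>lborel)"
          using True h by (intro nn_integral_mono) (auto split: split_indicator intro!: mult_right_mono)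
        finally show ?thesis using True by simp
      qed (auto split: split_indicator)
    qed
  qed
  also have "\<dots> = (\<integral>\<^sup>+h. (\<integral>\<^sup>+t. (\<integral>\<^sup>+x. indicator A x * indicator C h * (indicator {0..1} t * ennreal (2 * r)) *
      k (x + t *\<^sub>R h) \<partial>lborel) \<partial>lborel) \<partial>lborel)"
    by (rule nn_integral_cong, rule lborel_pair.Fubini') measurable
  also have "\<dots> = (\<integral>\<^sup>+t. (\<integral>\<^sup>+h. (\<integral>\<^sup>+x. indicator A x * indicator C h * (indicator {0..1} t * ennreal (2 * r)) *
      k (x + t *\<^sub>R h) \<partial>lborel) \<partial>lborel) \<partial>lborel)"
    by (rule lborel_pair.Fubini') measurable
  \<comment> \<open>From here on \<open>x\<close> denotes the point of the segment at time
    \<open>t\<close>, no longer its starting point.\<close>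
  also have "\<dots> = (\<integral>\<^sup>+t. (\<integral>\<^sup>+h. (\<integral>\<^sup>+x. indicator A (x - t *\<^sub>R h) * indicator C h *
      (indicator {0..1} t * ennreal (2 * r)) * k x \<partial>lborel) \<partial>lborel) \<partial>lborel)"
  proof (rule nn_integral_cong, rule nn_integral_cong)
    fix t :: real and h :: "real^'n"
    show "(\<integral>\<^sup>+x. indicator A x * indicator C h * (indicator {0..1} t * ennreal (2 * r)) * k (x + t *\<^sub>R h) \<partial>lborel)
      = (\<integral>\<^sup>+x. indicator A (x - t *\<^sub>R h) * indicator C h * (indicator {0..1} t * ennreal (2 * r)) * k x \<partial>lborel)"
      using nn_integral_lborel_translate[of "\<lambda>x. indicator A (x - t *\<^sub>R h) * indicator C h *
        (indicator {0..1} t * ennreal (2 * r)) * k x" "t *\<^sub>R h"] by simp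
  qed
  also have "\<dots> = (\<integral>\<^sup>+t. (\<integral>\<^sup>+x. (\<integral>\<^sup>+h. indicator A (x - t *\<^sub>R h) * indicator C h *
      (indicator {0..1} t * ennreal (2 * r)) * k x \<partial>lborel) \<partial>lborel) \<partial>lborel)"
    by (rule nn_integral_cong, rule lborel_pair.Fubini') measurable
  also have "\<dots> \<le> (\<integral>\<^sup>+t. (\<integral>\<^sup>+x. ennreal (2 * r) * (indicator {0..1} t * ennreal (?bd t)) * k x \<partial>lborel) \<partial>lborel)"
  proof (rule nn_integral_mono_AE)
    have "AE t in lborel. t \<noteq> (0::real)" by (rule AE_lborel_singleton)
    then show "AE t in lborel. (\<integral>\<^sup>+x. (\<integral>\<^sup>+h. indicator A (x - t *\<^sub>R h) * indicator C h *
      (indicator {0..1} t * ennreal (2 * r)) * k x \<partial>lborel) \<partial>lborel)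
      \<le> (\<integral>\<^sup>+x. ennreal (2 * r) * (indicator {0..1} t * ennreal (?bd t)) * k x \<partial>lborel)"
    proof eventually_elim
      case (elim t)
      show ?case
      proof (rule nn_integral_mono)
        fix x
        show "(\<integral>\<^sup>+h. indicator A (x - t *\<^sub>R h) * indicator C h *
          (indicator {0..1} t * ennreal (2 * r)) * k x \<partial>lborel)
          \<le> ennreal (2 * r) * (indicator {0..1} t * ennreal (?bd t)) * k x"
        proof (cases "t \<in> {0..1}")
          case True
          then have t: "0 < t" using elim by auto
          have "(\<integral>\<^sup>+h. indicator A (x - t *\<^sub>R h) * indicator C h *
            (indicator {0..1} t * ennreal (2 * r)) * k x \<partial>lborel)
            = (\<integral>\<^sup>+h. indicator C h * indicator A (x - t *\<^sub>R h) \<partial>lborel) * (ennreal (2 * r) * k x)"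
            using True by (subst nn_integral_multc[symmetric]) (auto simp: mult_ac intro!: nn_integral_cong)
          also have "\<dots> \<le> ennreal (?bd t) * (ennreal (2 * r) * k x)"
            using dilated_overlap_bound[OF A(1) finA(1) Cm finC t, of \<alpha> x] \<alpha> \<alpha>1
            by (intro mult_right_mono) auto
          finally show ?thesis using True by (simp add: mult_ac)
        qed simp
      qed
    qed
  qed
  also have "\<dots> = ennreal (2 * r) * ennreal (measure lborel C powr (1 - \<alpha>) * measure lborel A powr \<alpha>) *
      (\<integral>\<^sup>+t. indicator {0..1} t * ennreal (t powr (- (?n * \<alpha>))) \<partial>lborel) * ennreal I"
  proof -
    have "(\<integral>\<^sup>+t. (\<integral>\<^sup>+x. ennreal (2 * r) * (indicator {0..1} t * ennreal (?bd t)) * k x \<partial>lborel) \<partial>lborel)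
      = (\<integral>\<^sup>+t. (ennreal (2 * r) * ennreal (measure lborel C powr (1 - \<alpha>) * measure lborel A powr \<alpha>)) *
         (indicator {0..1} t * ennreal (t powr (- (?n * \<alpha>)))) * ennreal I \<partial>lborel)"
      by (intro nn_integral_cong, subst nn_integral_cmult, measurable) (simp add: kI ennreal_mult mult_ac)
    also have "\<dots> = ennreal (2 * r) * ennreal (measure lborel C powr (1 - \<alpha>) * measure lborel A powr \<alpha>) *
      (\<integral>\<^sup>+t. indicator {0..1} t * ennreal (t powr (- (?n * \<alpha>))) \<partial>lborel) * ennreal I"
      by (subst nn_integral_multc, measurable, subst nn_integral_cmult, measurable)
    finally show ?thesis .
  qed
  also have "\<dots> = ennreal (2 * r * (measure lborel C powr (1 - \<alpha>) * measure lborel A powr \<alpha>) *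
      (1 / (1 - ?n * \<alpha>)) * I)"
    using r \<alpha> I0 by (subst nn_integral_powr_from_0) (auto simp: ennreal_mult[symmetric])
  finally have "ennreal ((b - a) * measure lborel A * measure lborel N)
      \<le> ennreal (2 * r * (measure lborel C powr (1 - \<alpha>) * measure lborel A powr \<alpha>) * (1 / (1 - ?n * \<alpha>)) * I)"
    using ab finA by (simp add: emeasure_eq_ennreal_measure ennreal_mult)
  then have main: "(b - a) * measure lborel A * measure lborel N
      \<le> 2 * r * (measure lborel C powr (1 - \<alpha>) * measure lborel A powr \<alpha>) * (1 / (1 - ?n * \<alpha>)) * I"
    by (rule ennreal_le_iff[THEN iffD1, rotated]) (use r \<alpha> I0 in auto)
  have volC: "measure lborel C = 2 ^ ?n * measure lborel ?B"
    using r by (simp add: C_def content_cball content_ball power_mult_distrib)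
  have "measure lborel C powr (1 - \<alpha>) = (2 ^ ?n) powr (1 - \<alpha>) * measure lborel ?B powr (1 - \<alpha>)"
    unfolding volC by (rule powr_mult)
  also have "\<dots> \<le> 2 ^ ?n * measure lborel ?B powr (1 - \<alpha>)"
    using powr_mono[of "1 - \<alpha>" 1 "2 ^ ?n :: real"] \<alpha> by (intro mult_right_mono) auto
  finally have VC: "measure lborel C powr (1 - \<alpha>) \<le> 2 ^ ?n * measure lborel ?B powr (1 - \<alpha>)" .
  show ?thesis
  proof (cases "measure lborel A = 0")
    case True
    then show ?thesis using r \<alpha> I0 by (auto simp: I_def D_def)
  next
    case False
    then have mA: "measure lborel A > 0" by (simp add: zero_less_measure_iff)
    have "(b - a) * measure lborel A powr (1 - \<alpha>) * measure lborel N
        = (b - a) * measure lborel A * measure lborel N / measure lborel A powr \<alpha>"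
      using mA by (simp add: powr_diff)
    also have "\<dots> \<le> (2 * r * (measure lborel C powr (1 - \<alpha>) * measure lborel A powr \<alpha>) *
        (1 / (1 - ?n * \<alpha>)) * I) / measure lborel A powr \<alpha>"
      by (intro divide_right_mono main) auto
    also have "\<dots> = 2 * r / (1 - ?n * \<alpha>) * I * measure lborel C powr (1 - \<alpha>)"
      using mA by simp
    also have "\<dots> \<le> 2 * r / (1 - ?n * \<alpha>) * I * (2 ^ ?n * measure lborel ?B powr (1 - \<alpha>))"
      using VC r \<alpha> I0 by (intro mult_left_mono) auto
    finally show ?thesis by (simp add: I_def D_def mult_ac)
  qed
qed

section \<open>Hoelder's inequality on a set of finite measure\<close>

text \<open>Young's inequality for the product \<open>x \<cdot> 1\<close>.\<close>

lemma young_powr: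
  fixes x p :: real
  assumes "0 \<le> x" "1 \<le> p"
  shows "x \<le> x powr p / p + (1 - 1 / p)"
proof (cases "x = 0")
  case False
  then have "x powr p > 0" by simp
  then have "(x powr p) powr (1 / p) * 1 powr (1 - 1 / p) \<le> 1 / p * (x powr p) + (1 - 1 / p) * 1"
    by (intro Youngs_inequality_0) (use assms in auto)
  then show ?thesis using assms False by (simp add: powr_powr)
qed (use assms in auto)

text \<open>Hoelder's inequality against the constant \<open>1\<close>, obtained by integrating
  \<open>young_powr\<close> for \<open>g\<close> divided by its \<open>L\<^sup>p\<close> mean. It
  serves for the energy estimate, for the \<open>L\<^sup>s\<close> bound and for the monotonicity
  of power means.\<close>

lemma holder_finite_measure:
  fixes g :: "'a \<Rightarrow> real"
  assumes g[measurable]: "g \<in> borel_measurable M" and g0: "\<And>x. 0 \<le> g x"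
    and D[measurable]: "D \<in> sets M" and Df: "emeasure M D < \<infinity>" and p: "1 \<le> p"
    and int: "integrable M (\<lambda>x. indicator D x * g x powr p)"
  shows "integrable M (\<lambda>x. indicator D x * g x)"
    and "(\<integral>x. indicator D x * g x \<partial>M)
      \<le> (\<integral>x. indicator D x * g x powr p \<partial>M) powr (1 / p) * measure M D powr (1 - 1 / p)"
proof -
  have iD: "integrable M (indicator D :: 'a \<Rightarrow> real)" using Df by simp
  have ib: "integrable M (\<lambda>x. indicator D x * g x powr p / p + indicator D x * (1 - 1 / p))"
    using int iD by simp
  have young: "indicator D x * g x \<le> indicator D x * g x powr p / p + indicator D x * (1 - 1 / p)" for x
    using young_powr[OF g0 p, of x] by (auto split: split_indicator)
  show i: "integrable M (\<lambda>x. indicator D x * g x)"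
    by (rule Bochner_Integration.integrable_bound[OF ib])
      (use young g0 p in \<open>auto split: split_indicator simp: abs_mult\<close>)
  define A where "A = (\<integral>x. indicator D x * g x powr p \<partial>M)"
  define m where "m = measure M D"
  have A0: "A \<ge> 0" unfolding A_def by (intro integral_nonneg_AE) auto
  have m0: "m \<ge> 0" by (simp add: m_def)
  have main: "(\<integral>x. indicator D x * g x \<partial>M) \<le> A powr (1 / p) * m powr (1 - 1 / p)"
  proof (cases "A = 0 \<or> m = 0")
    case True
    have "AE x in M. indicator D x * g x = 0"
    proof (cases "A = 0")
      case True
      then have "AE x in M. indicator D x * g x powr p = 0"
        unfolding A_def by (subst (asm) integral_nonneg_eq_0_iff_AE[OF int]) auto
      then show ?thesis by eventually_elim (auto split: split_indicator_asm)
    next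
      case False
      with True have "emeasure M D = 0" using Df by (auto simp: m_def measure_def enn2real_eq_0_iff)
      then have "AE x in M. x \<notin> D" by (intro AE_not_in) auto
      then show ?thesis by eventually_elim auto
    qed
    then have "(\<integral>x. indicator D x * g x \<partial>M) = 0" by (rule integral_eq_zero_AE)
    then show ?thesis by simp
  next
    case False
    then have pos: "A > 0" "m > 0" using A0 m0 by auto
    \<comment> \<open>The \<open>L\<^sup>p\<close> mean of \<open>g\<close> over \<open>D\<close>.\<close>
    define t where "t = (A / m) powr (1 / p)"
    have t: "t > 0" using pos by (simp add: t_def)
    have tp: "t powr p = A / m" using pos p by (simp add: t_def powr_powr)
    have "(\<integral>x. indicator D x * g x \<partial>M)
        \<le> (\<integral>x. t * ((1 / (p * (A / m))) * (indicator D x * g x powr p) + (1 - 1 / p) * indicator D x) \<partial>M)"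
    proof (rule integral_mono[OF i])
      show "integrable M (\<lambda>x. t * ((1 / (p * (A / m))) * (indicator D x * g x powr p) + (1 - 1 / p) * indicator D x))"
        using int iD by simp
      fix x
      have "g x / t \<le> (g x / t) powr p / p + (1 - 1 / p)"
        using t g0[of x] by (intro young_powr p) auto
      also have "(g x / t) powr p = g x powr p / (A / m)"
        using t g0[of x] tp by (simp add: powr_divide)
      finally have "g x \<le> t * (g x powr p / (A / m) / p + (1 - 1 / p))"
        using t by (simp add: field_simps)
      then show "indicator D x * g x \<le> t * ((1 / (p * (A / m))) * (indicator D x * g x powr p) + (1 - 1 / p) * indicator D x)"
        by (auto split: split_indicator simp: mult_ac)
    qed
    also have "\<dots> = t * ((1 / (p * (A / m))) * A + (1 - 1 / p) * m)"
      using int iD by (simp add: A_def m_def)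
    also have "\<dots> = t * m" using pos p by (simp add: field_simps)
    also have "\<dots> = A powr (1 / p) * m powr (1 - 1 / p)"
      using pos by (simp add: t_def powr_divide powr_diff)
    finally show ?thesis .
  qed
  then show "(\<integral>x. indicator D x * g x \<partial>M)
      \<le> (\<integral>x. indicator D x * g x powr p \<partial>M) powr (1 / p) * measure M D powr (1 - 1 / p)"
    by (simp add: A_def m_def)
qed

section \<open>Borel representatives of Sobolev functions\<close>

lemma borel_representative:
  fixes f :: "real^'n::finite \<Rightarrow> real"
  assumes f: "f \<in> borel_measurable (lebesgue_on \<Omega>)" and \<Omega>: "open \<Omega>"
  obtains f' where "f' \<in> borel_measurable borel" "AE x in lborel. x \<in> \<Omega> \<longrightarrow> f' x = f x"
proof -
  have "(\<lambda>x. if x \<in> \<Omega> then f x else 0) \<in> borel_measurable lebesgue"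
    using f \<Omega> by (subst borel_measurable_if) auto
  then obtain f' where "f' \<in> borel_measurable lborel"
      "AE x in lborel. (if x \<in> \<Omega> then f x else 0) = f' x"
    using completion_ex_borel_measurable_real[of _ lborel] by blast
  then show ?thesis by (intro that[of f']) (auto elim: eventually_mono)
qed

lemma L_loc_set_integrable:
  fixes f :: "real^'n::finite \<Rightarrow> 'b::euclidean_space"
  assumes f: "f \<in> L_loc (ennreal p) \<Omega>" and K: "compact K" "K \<subseteq> \<Omega>" and p: "0 < p"
  shows "set_integrable lebesgue K (\<lambda>x. norm (f x) powr p)"
proof -
  have "Lnorm (ennreal p) K f < \<infinity>" using f K by (auto simp: L_loc_def)
  then show ?thesis using p by (auto simp: Lnorm_def split: if_splits)
qed

lemma set_integrable_lebesgue_borel: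
  fixes f f' :: "real^'n::finite \<Rightarrow> real"
  assumes f: "set_integrable lebesgue K f" and f': "f' \<in> borel_measurable borel"
    and ae: "AE x in lborel. x \<in> \<Omega> \<longrightarrow> f' x = f x" and K: "K \<in> sets borel" "K \<subseteq> \<Omega>"
  shows "integrable lborel (\<lambda>x. indicator K x * f' x)"
    and "(LINT x:K|lebesgue. f x) = (\<integral>x. indicator K x * f' x \<partial>lborel)"
proof -
  have m: "(\<lambda>x. indicator K x * f' x) \<in> borel_measurable lborel" using f' K by simp
  have m1: "(\<lambda>x. indicator K x *\<^sub>R f x) \<in> borel_measurable lebesgue"
    using f by (auto simp: set_integrable_def)
  have m2: "(\<lambda>x. indicator K x * f' x) \<in> borel_measurable lebesgue"
    using m by (rule measurable_completion)
  have ae': "AE x in lebesgue. indicator K x *\<^sub>R f x = indicator K x * f' x"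
    unfolding AE_completion_iff using ae
    by eventually_elim (use K in \<open>auto split: split_indicator\<close>)
  have "integrable lebesgue (\<lambda>x. indicator K x * f' x)"
    using f integrable_cong_AE[OF m1 m2 ae'] by (simp add: set_integrable_def)
  then show "integrable lborel (\<lambda>x. indicator K x * f' x)"
    using integrable_completion[OF m] by simp
  have "(LINT x:K|lebesgue. f x) = (\<integral>x. indicator K x * f' x \<partial>lebesgue)"
    unfolding set_lebesgue_integral_def by (rule integral_cong_AE[OF m1 m2 ae'])
  also have "\<dots> = (\<integral>x. indicator K x * f' x \<partial>lborel)"
    by (rule integral_completion[OF m])
  finally show "(LINT x:K|lebesgue. f x) = (\<integral>x. indicator K x * f' x \<partial>lborel)" .
qed

lemma test_function_mono: "test_function U \<psi> \<Longrightarrow> U \<subseteq> V \<Longrightarrow> test_function V \<psi>"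
  by (auto simp: test_function_def)

text \<open>A weak gradient has a Borel representative that still satisfies integration by parts on each
  closed ball inside \<open>\<Omega>\<close>, with both functions cut off outside the ball.\<close>

lemma weak_gradient_borel:
  fixes f f' :: "real^'n::finite \<Rightarrow> real"
  assumes wg: "has_weak_gradient \<Omega> f G" and \<Omega>: "open \<Omega>"
    and f'[measurable]: "f' \<in> borel_measurable borel" and aef: "AE x in lborel. x \<in> \<Omega> \<longrightarrow> f' x = f x"
  obtains G' where "G' \<in> borel_measurable borel" "AE x in lborel. x \<in> \<Omega> \<longrightarrow> G' x = G x"
    "\<And>y r. cball y r \<subseteq> \<Omega> \<Longrightarrow> integrable lborel (\<lambda>x. indicator (ball y r) x * f' x)"
    "\<And>y r. cball y r \<subseteq> \<Omega> \<Longrightarrow> integrable lborel (\<lambda>x. indicator (ball y r) x *\<^sub>R G' x)"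
    "\<And>y r \<psi> i. cball y r \<subseteq> \<Omega> \<Longrightarrow> test_function (ball y r) \<psi> \<Longrightarrow>
      (\<integral>x. (indicator (ball y r) x * f' x) * partial_deriv i \<psi> x \<partial>lborel) =
      - (\<integral>x. (indicator (ball y r) x *\<^sub>R G' x) $ i * \<psi> x \<partial>lborel)"
proof -
  have fL: "f \<in> L_loc 1 \<Omega>" and GL: "G \<in> L_loc 1 \<Omega>" using wg by (auto simp: has_weak_gradient_def)
  have Gm: "(\<lambda>x. G x $ i) \<in> borel_measurable (lebesgue_on \<Omega>)" for i
  proof -
    have "G \<in> borel_measurable (lebesgue_on \<Omega>)" using GL by (simp add: L_loc_def)
    then show ?thesis
      by (rule measurable_compose) (auto intro!: borel_measurable_continuous_onI continuous_intros)
  qed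
  have "\<exists>g. g \<in> borel_measurable borel \<and> (AE x in lborel. x \<in> \<Omega> \<longrightarrow> g x = G x $ i)" for i
    by (rule borel_representative[OF Gm \<Omega>]) blast
  then have "\<forall>i. \<exists>g. g \<in> borel_measurable borel \<and> (AE x in lborel. x \<in> \<Omega> \<longrightarrow> g x = G x $ i)"
    by (rule allI)
  then have "\<exists>g. \<forall>i. g i \<in> borel_measurable borel \<and> (AE x in lborel. x \<in> \<Omega> \<longrightarrow> g i x = G x $ i)"
    by (rule choice)
  then obtain g where gg: "\<forall>i. g i \<in> borel_measurable borel \<and> (AE x in lborel. x \<in> \<Omega> \<longrightarrow> g i x = G x $ i)"
    by (rule exE)
  then have gm[measurable]: "g i \<in> borel_measurable borel"
    and g: "AE x in lborel. x \<in> \<Omega> \<longrightarrow> g i x = G x $ i" for i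
    by simp_all
  define G' where "G' x = (\<chi> i. g i x)" for x
  have G'm[measurable]: "G' \<in> borel_measurable borel"
    unfolding G'_def by (subst borel_measurable_euclidean_space) (auto simp: Basis_vec_def inner_axis)
  have "AE x in lborel. \<forall>i\<in>UNIV. x \<in> \<Omega> \<longrightarrow> g i x = G x $ i"
    by (rule AE_ball_countable'[OF g]) simp
  then have aeG: "AE x in lborel. x \<in> \<Omega> \<longrightarrow> G' x = G x"
    by eventually_elim (auto simp: G'_def vec_eq_iff)
  have i1: "integrable lborel (\<lambda>x. indicator (ball y r) x * f' x)" if "cball y r \<subseteq> \<Omega>" for y r
  proof -
    have s: "ball y r \<subseteq> \<Omega>" using that ball_subset_cball by blast
    have "set_integrable lebesgue (cball y r) (\<lambda>x. norm (f x) powr 1)"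
      using fL that by (intro L_loc_set_integrable[of f 1 \<Omega>]) auto
    then have "set_integrable lebesgue (ball y r) (\<lambda>x. \<bar>f x\<bar>)"
      by (auto intro: set_integrable_subset)
    moreover have "AE x in lborel. x \<in> \<Omega> \<longrightarrow> \<bar>f' x\<bar> = \<bar>f x\<bar>"
      using aef by eventually_elim auto
    ultimately have "integrable lborel (\<lambda>x. indicator (ball y r) x * \<bar>f' x\<bar>)"
      using s by (intro set_integrable_lebesgue_borel(1)[where \<Omega> = \<Omega>]) auto
    then show ?thesis
      by (rule Bochner_Integration.integrable_bound) (measurable, auto split: split_indicator)
  qed
  have i2: "integrable lborel (\<lambda>x. indicator (ball y r) x *\<^sub>R G' x)" if "cball y r \<subseteq> \<Omega>" for y r
  proof -
    have s: "ball y r \<subseteq> \<Omega>" using that ball_subset_cball by blast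
    have "set_integrable lebesgue (cball y r) (\<lambda>x. norm (G x) powr 1)"
      using GL that by (intro L_loc_set_integrable[of G 1 \<Omega>]) auto
    then have "set_integrable lebesgue (ball y r) (\<lambda>x. norm (G x))"
      by (auto intro: set_integrable_subset)
    moreover have "AE x in lborel. x \<in> \<Omega> \<longrightarrow> norm (G' x) = norm (G x)"
      using aeG by eventually_elim auto
    ultimately have "integrable lborel (\<lambda>x. indicator (ball y r) x * norm (G' x))"
      using s by (intro set_integrable_lebesgue_borel(1)[where \<Omega> = \<Omega>]) auto
    then show ?thesis
      by (rule Bochner_Integration.integrable_bound) (measurable, auto split: split_indicator)
  qed
  have ibp: "(\<integral>x. (indicator (ball y r) x * f' x) * partial_deriv i \<psi> x \<partial>lborel) =
      - (\<integral>x. (indicator (ball y r) x *\<^sub>R G' x) $ i * \<psi> x \<partial>lborel)"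
    if B: "cball y r \<subseteq> \<Omega>" and \<psi>: "test_function (ball y r) \<psi>" for y r \<psi> i
  proof -
    have s: "ball y r \<subseteq> \<Omega>" using B ball_subset_cball by blast
    have cl: "closure {x. \<psi> x \<noteq> 0} \<subseteq> ball y r" using \<psi> by (simp add: test_function_def)
    have [measurable]: "\<psi> \<in> borel_measurable borel" "partial_deriv i \<psi> \<in> borel_measurable borel" for i
      using test_function_continuous[OF \<psi>] test_function_partial(2)[OF \<psi>]
      by (auto intro: borel_measurable_continuous_onI)
    have p0: "partial_deriv i \<psi> x = 0" "\<psi> x = 0" if "x \<notin> ball y r" for x
    proof -
      have "x \<notin> closure {x. \<psi> x \<noteq> 0}" using cl that by blast
      then show "partial_deriv i \<psi> x = 0" "\<psi> x = 0"
        by (rule partial_deriv_outside[OF \<psi>]) (rule test_function_outside[OF \<psi> that])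
    qed
    have eq: "(LINT x:\<Omega>|lebesgue. h x * \<phi> x) = (\<integral>x. indicator (ball y r) x * h' x * \<phi> x \<partial>lborel)"
      if hm: "h \<in> borel_measurable (lebesgue_on \<Omega>)" and h'[measurable]: "h' \<in> borel_measurable borel"
        and ae: "AE x in lborel. x \<in> \<Omega> \<longrightarrow> h' x = h x"
        and \<phi>[measurable]: "\<phi> \<in> borel_measurable borel" and \<phi>0: "\<And>x. x \<notin> ball y r \<Longrightarrow> \<phi> x = 0" for h h' \<phi> :: "real^'n \<Rightarrow> real"
    proof -
      have m0: "(\<lambda>x. indicator (ball y r) x * h' x * \<phi> x) \<in> borel_measurable lborel" 
        by (intro borel_measurable_times borel_measurable_indicator) (use h' \<phi> in auto)
      have hm': "(\<lambda>x. if x \<in> \<Omega> then h x else 0) \<in> borel_measurable lebesgue"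
        using hm \<Omega> by (subst borel_measurable_if) auto
      have \<phi>l: "\<phi> \<in> borel_measurable lebesgue" by (rule measurable_completion) simp
      have "(\<lambda>x. indicator \<Omega> x *\<^sub>R (h x * \<phi> x)) = (\<lambda>x. (if x \<in> \<Omega> then h x else 0) * \<phi> x)"
        by (auto split: split_indicator)
      then have m1: "(\<lambda>x. indicator \<Omega> x *\<^sub>R (h x * \<phi> x)) \<in> borel_measurable lebesgue"
        using hm' \<phi>l by simp
      have m2: "(\<lambda>x. indicator (ball y r) x * h' x * \<phi> x) \<in> borel_measurable lebesgue"
        using m0 by (rule measurable_completion)
      have "(LINT x:\<Omega>|lebesgue. h x * \<phi> x) = (\<integral>x. indicator (ball y r) x * h' x * \<phi> x \<partial>lebesgue)"
        unfolding set_lebesgue_integral_def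
      proof (rule integral_cong_AE[OF m1 m2])
        show "AE x in lebesgue. indicator \<Omega> x *\<^sub>R (h x * \<phi> x) = indicator (ball y r) x * h' x * \<phi> x"
          unfolding AE_completion_iff using ae
          by eventually_elim (use s \<phi>0 in \<open>auto split: split_indicator\<close>)
      qed
      also have "\<dots> = (\<integral>x. indicator (ball y r) x * h' x * \<phi> x \<partial>lborel)"
        by (rule integral_completion[OF m0])
      finally show ?thesis .
    qed
    have "(LINT x:\<Omega>|lebesgue. f x * partial_deriv i \<psi> x) = - (LINT x:\<Omega>|lebesgue. G x $ i * \<psi> x)"
      using wg test_function_mono[OF \<psi> s] by (auto simp: has_weak_gradient_def)
    moreover have "(LINT x:\<Omega>|lebesgue. f x * partial_deriv i \<psi> x)
        = (\<integral>x. indicator (ball y r) x * f' x * partial_deriv i \<psi> x \<partial>lborel)"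
      by (rule eq) (use fL aef p0 in \<open>auto simp: L_loc_def\<close>)
    moreover have "(LINT x:\<Omega>|lebesgue. G x $ i * \<psi> x)
        = (\<integral>x. indicator (ball y r) x * g i x * \<psi> x \<partial>lborel)"
      by (rule eq[OF Gm _ g]) (use p0 in auto)
    ultimately show ?thesis by (simp add: G'_def)
  qed
  show ?thesis by (rule that[OF G'm aeG i1 i2 ibp])
qed

section \<open>The De Giorgi class in terms of relative measures\<close>

text \<open>The fraction of the ball occupied by \<open>S\<close>.\<close>

definition frac :: "real^'n::finite \<Rightarrow> real \<Rightarrow> (real^'n) set \<Rightarrow> real" where
  "frac y r S = measure lborel (ball y r \<inter> S) / measure lborel (ball y r)"

text \<open>Here \<open>g\<close> plays the role of \<open>|\<nabla>(v - k)\<^sub>-|\<close>. The two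
  inequalities are all that the later arguments use about derivatives: the layer estimate from
  \<open>de_giorgi_poincare\<close>, and the energy bound that defines the De Giorgi class.\<close>

definition level_gradient :: "real \<Rightarrow> (real^'n::finite \<Rightarrow> real \<Rightarrow> real \<Rightarrow> real) \<Rightarrow> (real^'n) set \<Rightarrow>
    real \<Rightarrow> real \<Rightarrow> real \<Rightarrow> (real^'n \<Rightarrow> real) \<Rightarrow> real \<Rightarrow> (real^'n \<Rightarrow> real) \<Rightarrow> bool" where
  "level_gradient p \<Lambda> \<Omega> c q \<delta> v k g \<longleftrightarrow>
     g \<in> borel_measurable borel \<and> (\<forall>x. 0 \<le> g x) \<and>
     (\<forall>y r l (\<alpha>::real). 0 < r \<and> cball y r \<subseteq> \<Omega> \<and> l < k \<and> 0 \<le> \<alpha> \<and> CARD('n) * \<alpha> < 1 \<longrightarrow>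
        (k - l) * frac y r {x. v x \<le> l} powr (1 - \<alpha>) * frac y r {x. k \<le> v x} \<le>
        2 ^ (CARD('n) + 1) / (1 - CARD('n) * \<alpha>) * r *
          ((\<integral>x. indicator (ball y r \<inter> {x. l < v x \<and> v x < k}) x * g x \<partial>lborel)
            / measure lborel (ball y r))) \<and>
     (\<forall>y r \<sigma>. 0 < r \<and> ball y (8 * r) \<subseteq> \<Omega> \<and> 0 < \<sigma> \<and> \<sigma> < 1 \<longrightarrow>
        integrable lborel (\<lambda>x. indicator (ball y (r * (1 - \<sigma>))) x * g x powr p) \<and>
        (\<integral>x. indicator (ball y (r * (1 - \<sigma>))) x * g x powr p \<partial>lborel) \<le>
          measure lborel (ball y (r * (1 - \<sigma>))) *
          (c / \<sigma> powr q * \<Lambda> y r k * (k / r) powr p * frac y r {x. v x \<le> k} powr (1 - \<delta>)))"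

definition DG_borel :: "real \<Rightarrow> (real^'n::finite \<Rightarrow> real \<Rightarrow> real \<Rightarrow> real) \<Rightarrow> (real^'n) set \<Rightarrow>
    real \<Rightarrow> real \<Rightarrow> real \<Rightarrow> (real^'n \<Rightarrow> real) \<Rightarrow> bool" where
  "DG_borel p \<Lambda> \<Omega> c q \<delta> v \<longleftrightarrow> v \<in> borel_measurable borel \<and>
     (\<forall>k>0. \<exists>g. level_gradient p \<Lambda> \<Omega> c q \<delta> v k g)"

lemma content_ball_scale:
  fixes y :: "real^'n::finite"
  assumes "0 \<le> r" shows "measure lborel (ball y r) = r ^ CARD('n) * measure lborel (ball (0::real^'n) 1)"
  using content_ball_conv_unit_ball[OF assms, of y] by simp

lemma frac_nonneg: "0 \<le> frac y r S"
  by (simp add: frac_def)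

lemma ball_Int_fmeasurable:
  fixes y :: "real^'n::finite"
  assumes "S \<in> sets borel"
  shows "ball y r \<inter> S \<in> fmeasurable lborel"
proof (rule fmeasurableI2[of "ball y r"])
  show "ball y r \<in> fmeasurable lborel"
    using emeasure_lborel_ball_finite[of y r] by (simp add: fmeasurable_def)
qed (use assms in auto)

lemma measure_ball_Int_le:
  fixes y :: "real^'n::finite"
  assumes "S \<in> sets borel"
  shows "measure lborel (ball y r \<inter> S) \<le> measure lborel (ball y r)"
  using ball_Int_fmeasurable[of UNIV y r] assms by (intro measure_mono_fmeasurable) auto

lemma frac_le_1:
  assumes "S \<in> sets borel"
  shows "frac y r S \<le> 1"
proof (cases "measure lborel (ball y r) = 0")
  case True
  then show ?thesis unfolding frac_def by (metis div_by_0 zero_le_one)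
next
  case False
  then have "0 < measure lborel (ball y r)" using measure_nonneg[of lborel "ball y r"] by linarith
  then show ?thesis
    using measure_ball_Int_le[OF assms, of y r] unfolding frac_def by (metis divide_le_eq_1_pos)
qed

lemma frac_mono:
  assumes "S \<subseteq> T" "S \<in> sets borel" "T \<in> sets borel"
  shows "frac y r S \<le> frac y r T"
proof -
  have "measure lborel (ball y r \<inter> S) \<le> measure lborel (ball y r \<inter> T)"
    by (rule measure_mono_fmeasurable) (use assms ball_Int_fmeasurable[of T y r] in auto)
  then show ?thesis
    unfolding frac_def by (rule divide_right_mono) simp
qed

text \<open>The layer estimate is applied to \<open>f = (v - k)\<^sub>-\<close>: the set \<open>{v \<le>
  l}\<close> is \<open>{f \<ge> k - l}\<close> and \<open>{v \<ge> k}\<close> is \<open>{f \<le>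
  0}\<close>.\<close>

lemma DG_minus_imp_DG_borel:
  fixes u :: "real^'n::finite \<Rightarrow> real"
  assumes \<Omega>: "open \<Omega>" and u: "u \<in> DG_minus p \<Lambda> \<Omega> c q \<delta>" and p: "0 < p"
    and v[measurable]: "v \<in> borel_measurable borel" and aev: "AE x in lborel. x \<in> \<Omega> \<longrightarrow> v x = u x"
  shows "DG_borel p \<Lambda> \<Omega> c q \<delta> v"
  unfolding DG_borel_def
proof (rule conjI[OF v], intro allI impI)
  fix k :: real assume k: "0 < k"
  have "\<forall>k>0. \<exists>G. has_weak_gradient \<Omega> (\<lambda>x. max (k - u x) 0) G \<and> G \<in> L_loc (ennreal p) \<Omega> \<and>
        (\<forall>x0 r \<sigma>. r > 0 \<and> ball x0 (8 * r) \<subseteq> \<Omega> \<and> 0 < \<sigma> \<and> \<sigma> < 1 \<longrightarrow>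
           1 / measure lebesgue (ball x0 (r * (1 - \<sigma>))) *
             (LINT x:ball x0 (r * (1 - \<sigma>))|lebesgue. norm (G x) powr p)
           \<le> c / \<sigma> powr q * \<Lambda> x0 r k * (k / r) powr p *
             (measure lebesgue {x \<in> ball x0 r. u x \<le> k} / measure lebesgue (ball x0 r))
               powr (1 - \<delta>))"
    using u unfolding DG_minus_def mem_Collect_eq by (rule conjunct2)
  from this[THEN spec, THEN mp, OF k]
  obtain G where GG: "has_weak_gradient \<Omega> (\<lambda>x. max (k - u x) 0) G \<and> G \<in> L_loc (ennreal p) \<Omega> \<and>
        (\<forall>x0 r \<sigma>. r > 0 \<and> ball x0 (8 * r) \<subseteq> \<Omega> \<and> 0 < \<sigma> \<and> \<sigma> < 1 \<longrightarrow>
           1 / measure lebesgue (ball x0 (r * (1 - \<sigma>))) *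
             (LINT x:ball x0 (r * (1 - \<sigma>))|lebesgue. norm (G x) powr p)
           \<le> c / \<sigma> powr q * \<Lambda> x0 r k * (k / r) powr p *
             (measure lebesgue {x \<in> ball x0 r. u x \<le> k} / measure lebesgue (ball x0 r))
               powr (1 - \<delta>))" (is "?wg \<and> ?GL \<and> ?E") by (rule exE)
  have wg: ?wg by (rule conjunct1[OF GG])
  have GL: ?GL by (rule conjunct1[OF conjunct2[OF GG]])
  have E: ?E by (rule conjunct2[OF conjunct2[OF GG]])
  define f' where "f' x = max (k - v x) 0" for x
  have f'm: "f' \<in> borel_measurable borel" unfolding f'_def by measurable
  have aef: "AE x in lborel. x \<in> \<Omega> \<longrightarrow> f' x = max (k - u x) 0"
    using aev by eventually_elim (auto simp: f'_def)
  obtain G' where G'[measurable]: "G' \<in> borel_measurable borel" and aeG: "AE x in lborel. x \<in> \<Omega> \<longrightarrow> G' x = G x"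
    and i1: "\<And>y r. cball y r \<subseteq> \<Omega> \<Longrightarrow> integrable lborel (\<lambda>x. indicator (ball y r) x * f' x)"
    and i2: "\<And>y r. cball y r \<subseteq> \<Omega> \<Longrightarrow> integrable lborel (\<lambda>x. indicator (ball y r) x *\<^sub>R G' x)"
    and ibp: "\<And>y r \<psi> i. cball y r \<subseteq> \<Omega> \<Longrightarrow> test_function (ball y r) \<psi> \<Longrightarrow>
      (\<integral>x. (indicator (ball y r) x * f' x) * partial_deriv i \<psi> x \<partial>lborel) =
      - (\<integral>x. (indicator (ball y r) x *\<^sub>R G' x) $ i * \<psi> x \<partial>lborel)"
    by (rule weak_gradient_borel[OF wg \<Omega> f'm aef], rule that; assumption)
  define g where "g x = norm (G' x)" for x
  show "\<exists>g. level_gradient p \<Lambda> \<Omega> c q \<delta> v k g"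
    unfolding level_gradient_def
  proof (intro exI[of _ g] conjI allI impI)
    show gm: "g \<in> borel_measurable borel" unfolding g_def by measurable
    show "0 \<le> g x" for x by (simp add: g_def)
  next
    fix y r l and \<alpha> :: real
    assume *: "0 < r \<and> cball y r \<subseteq> \<Omega> \<and> l < k \<and> 0 \<le> \<alpha> \<and> CARD('n) * \<alpha> < 1"
    let ?B = "ball y r"
    have B0: "measure lborel ?B > 0" using * by simp
    have "(k - l - 0) * measure lborel (?B \<inter> {x. v x \<le> l}) powr (1 - \<alpha>) * measure lborel (?B \<inter> {x. k \<le> v x})
      \<le> 2 ^ (CARD('n) + 1) / (1 - CARD('n) * \<alpha>) * r * measure lborel ?B powr (1 - \<alpha>) *
      (\<integral>x. indicator {x \<in> ?B. 0 < indicator ?B x * f' x \<and> indicator ?B x * f' x < k - l} x *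
        norm (indicator ?B x *\<^sub>R G' x) \<partial>lborel)"
      by (rule de_giorgi_poincare[OF i1 i2 _ ibp]) (use * in \<open>auto simp: f'_def\<close>)
    also have "(\<integral>x. indicator {x \<in> ?B. 0 < indicator ?B x * f' x \<and> indicator ?B x * f' x < k - l} x *
        norm (indicator ?B x *\<^sub>R G' x) \<partial>lborel) =
        (\<integral>x. indicator (?B \<inter> {x. l < v x \<and> v x < k}) x * g x \<partial>lborel)"
      by (intro Bochner_Integration.integral_cong)
        (use * in \<open>auto simp: f'_def g_def split: split_indicator\<close>)
    finally have P: "(k - l) * measure lborel (?B \<inter> {x. v x \<le> l}) powr (1 - \<alpha>) * measure lborel (?B \<inter> {x. k \<le> v x})
      \<le> 2 ^ (CARD('n) + 1) / (1 - CARD('n) * \<alpha>) * r * measure lborel ?B powr (1 - \<alpha>) *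
        (\<integral>x. indicator (?B \<inter> {x. l < v x \<and> v x < k}) x * g x \<partial>lborel)" by simp
    have "(k - l) * frac y r {x. v x \<le> l} powr (1 - \<alpha>) * frac y r {x. k \<le> v x}
      = ((k - l) * measure lborel (?B \<inter> {x. v x \<le> l}) powr (1 - \<alpha>) * measure lborel (?B \<inter> {x. k \<le> v x}))
        / (measure lborel ?B powr (1 - \<alpha>) * measure lborel ?B)"
      by (simp add: frac_def powr_divide)
    also have "\<dots> \<le> (2 ^ (CARD('n) + 1) / (1 - CARD('n) * \<alpha>) * r * measure lborel ?B powr (1 - \<alpha>) *
        (\<integral>x. indicator (?B \<inter> {x. l < v x \<and> v x < k}) x * g x \<partial>lborel))
        / (measure lborel ?B powr (1 - \<alpha>) * measure lborel ?B)"
      by (rule divide_right_mono[OF P]) simp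
    also have "\<dots> = 2 ^ (CARD('n) + 1) / (1 - CARD('n) * \<alpha>) * r *
            ((\<integral>x. indicator (?B \<inter> {x. l < v x \<and> v x < k}) x * g x \<partial>lborel) / measure lborel ?B)"
      using B0 by simp
    finally show "(k - l) * frac y r {x. v x \<le> l} powr (1 - \<alpha>) * frac y r {x. k \<le> v x} \<le>
          2 ^ (CARD('n) + 1) / (1 - CARD('n) * \<alpha>) * r *
            ((\<integral>x. indicator (?B \<inter> {x. l < v x \<and> v x < k}) x * g x \<partial>lborel) / measure lborel ?B)" .
  next
    fix y and r \<sigma> :: real
    assume *: "0 < r \<and> ball y (8 * r) \<subseteq> \<Omega> \<and> 0 < \<sigma> \<and> \<sigma> < 1"
    let ?s = "r * (1 - \<sigma>)"
    let ?B = "ball y ?s"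
    have s: "0 < ?s" "?s < r" using * by (auto simp: algebra_simps)
    have cb: "cball y ?s \<subseteq> \<Omega>" "ball y r \<subseteq> \<Omega>"
      using * s by (auto simp: subset_iff)
    have B\<Omega>: "?B \<subseteq> \<Omega>" using cb(1) ball_subset_cball by blast
    have B0: "measure lborel ?B > 0" using s by simp
    have "set_integrable lebesgue (cball y ?s) (\<lambda>x. norm (G x) powr p)"
      by (rule L_loc_set_integrable[OF GL _ cb(1) p]) simp
    then have si: "set_integrable lebesgue ?B (\<lambda>x. norm (G x) powr p)"
      by (auto intro: set_integrable_subset)
    have ae: "AE x in lborel. x \<in> \<Omega> \<longrightarrow> g x powr p = norm (G x) powr p"
      using aeG by eventually_elim (auto simp: g_def)
    have gp: "(\<lambda>x. g x powr p) \<in> borel_measurable borel" unfolding g_def by measurable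
    show "integrable lborel (\<lambda>x. indicator ?B x * g x powr p)"
      by (rule set_integrable_lebesgue_borel(1)[OF si gp ae _ B\<Omega>]) simp
    have eq: "(LINT x:?B|lebesgue. norm (G x) powr p) = (\<integral>x. indicator ?B x * g x powr p \<partial>lborel)"
      by (rule set_integrable_lebesgue_borel(2)[OF si gp ae _ B\<Omega>]) simp
    have mu: "measure lebesgue {x \<in> ball y r. u x \<le> k} = measure lborel (ball y r \<inter> {x. v x \<le> k})"
    proof -
      have um: "u \<in> borel_measurable (lebesgue_on \<Omega>)"
        using u by (auto simp: DG_minus_def W1_loc_def L_loc_def)
      then have um': "(\<lambda>x. if x \<in> \<Omega> then u x else 0) \<in> borel_measurable lebesgue"
        using \<Omega> by (subst borel_measurable_if) auto
      have S1: "ball y r \<inter> {x. v x \<le> k} \<in> sets lborel" by simp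
      have "{x \<in> space lebesgue. (if x \<in> \<Omega> then u x else 0) \<le> k} \<in> sets lebesgue"
        using um' by measurable
      then have "ball y r \<inter> {x \<in> space lebesgue. (if x \<in> \<Omega> then u x else 0) \<le> k} \<in> sets lebesgue"
        by (intro sets.Int) auto
      also have "ball y r \<inter> {x \<in> space lebesgue. (if x \<in> \<Omega> then u x else 0) \<le> k} = {x \<in> ball y r. u x \<le> k}"
        using cb(2) by auto
      finally have S2: "{x \<in> ball y r. u x \<le> k} \<in> sets lebesgue" .
      have "measure lebesgue {x \<in> ball y r. u x \<le> k} = measure lebesgue (ball y r \<inter> {x. v x \<le> k})"
      proof (rule measure_eq_AE)
        show "AE x in lebesgue. x \<in> {x \<in> ball y r. u x \<le> k} \<longleftrightarrow> x \<in> ball y r \<inter> {x. v x \<le> k}"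
          unfolding AE_completion_iff using aev
          by eventually_elim (use cb(2) in auto)
      qed (use S1 S2 in \<open>auto\<close>)
      then show ?thesis using S1 by simp
    qed
    have "1 / measure lborel ?B * (\<integral>x. indicator ?B x * g x powr p \<partial>lborel)
      \<le> c / \<sigma> powr q * \<Lambda> y r k * (k / r) powr p * frac y r {x. v x \<le> k} powr (1 - \<delta>)"
      using E[rule_format, OF *] unfolding eq mu frac_def by simp
    then show "(\<integral>x. indicator ?B x * g x powr p \<partial>lborel) \<le> measure lborel ?B *
            (c / \<sigma> powr q * \<Lambda> y r k * (k / r) powr p * frac y r {x. v x \<le> k} powr (1 - \<delta>))"
      using B0 by (simp add: field_simps)
  qed
qed

text \<open>The energy bound in \<open>L\<^sup>1\<close> form on a subset \<open>D\<close>. The factor with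
  exponent \<open>1 - 1/p\<close>, which comes from Hoelder's inequality, is small when
  \<open>D\<close> is small.\<close>

lemma energy_bound_L1:
  fixes v g :: "real^'n::finite \<Rightarrow> real"
  assumes v[measurable]: "v \<in> borel_measurable borel" and g[measurable]: "g \<in> borel_measurable borel"
    and g0: "\<And>x. 0 \<le> g x"
    and p: "1 < p" and c: "0 < c" and k: "0 < k" and r: "0 < r" and \<sigma>: "0 < \<sigma>" "\<sigma> < 1"
    and i: "integrable lborel (\<lambda>x. indicator (ball y (r * (1 - \<sigma>))) x * g x powr p)"
    and E: "(\<integral>x. indicator (ball y (r * (1 - \<sigma>))) x * g x powr p \<partial>lborel) \<le>
            measure lborel (ball y (r * (1 - \<sigma>))) *
            (c / \<sigma> powr q * L * (k / r) powr p * frac y r {x. v x \<le> k} powr (1 - \<delta>))"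
    and L: "L \<le> M" "0 \<le> M"
    and D[measurable]: "D \<in> sets borel" and DB: "D \<subseteq> ball y (r * (1 - \<sigma>))"
  shows "integrable lborel (\<lambda>x. indicator D x * g x)"
    and "(\<integral>x. indicator D x * g x \<partial>lborel) / measure lborel (ball y r) \<le>
      c powr (1 / p) * \<sigma> powr (- (q / p)) * M powr (1 / p) * (k / r) *
      frac y r {x. v x \<le> k} powr ((1 - \<delta>) / p) * (measure lborel D / measure lborel (ball y r)) powr (1 - 1 / p)"
proof -
  let ?s = "r * (1 - \<sigma>)"
  let ?B = "ball y ?s"
  let ?F = "frac y r {x. v x \<le> k}"
  let ?m = "measure lborel (ball y r)"
  have s: "0 < ?s" "?s \<le> r" using r \<sigma> by (auto simp: algebra_simps)
  have m0: "?m > 0" using r by simp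
  have Dfin: "emeasure lborel D < \<infinity>"
    using emeasure_mono[OF DB, of lborel] emeasure_lborel_ball_finite[of y ?s] by (auto intro: le_less_trans)
  have iD: "integrable lborel (\<lambda>x. indicator D x * g x powr p)"
    by (rule Bochner_Integration.integrable_bound[OF i])
      (measurable, use DB in \<open>auto split: split_indicator simp del: mem_ball\<close>)
  show "integrable lborel (\<lambda>x. indicator D x * g x)"
    by (rule holder_finite_measure(1)[OF _ g0 _ Dfin _ iD]) (use p in auto)
  have "(\<integral>x. indicator D x * g x powr p \<partial>lborel) \<le> (\<integral>x. indicator ?B x * g x powr p \<partial>lborel)"
    by (rule integral_mono[OF iD i]) (use DB in \<open>auto split: split_indicator simp del: mem_ball\<close>)
  also note E
  also have "measure lborel ?B * (c / \<sigma> powr q * L * (k / r) powr p * ?F powr (1 - \<delta>))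
    \<le> ?m * (c / \<sigma> powr q * M * (k / r) powr p * ?F powr (1 - \<delta>))"
  proof (rule order_trans)
    show "measure lborel ?B * (c / \<sigma> powr q * L * (k / r) powr p * ?F powr (1 - \<delta>)) \<le>
      measure lborel ?B * (c / \<sigma> powr q * M * (k / r) powr p * ?F powr (1 - \<delta>))"
      using L c by (intro mult_left_mono mult_right_mono) auto
    have "measure lborel ?B \<le> ?m"
      using s emeasure_lborel_ball_finite[of y r]
      by (intro measure_mono_fmeasurable) (auto simp: fmeasurable_def)
    then show "measure lborel ?B * (c / \<sigma> powr q * M * (k / r) powr p * ?F powr (1 - \<delta>)) \<le>
      ?m * (c / \<sigma> powr q * M * (k / r) powr p * ?F powr (1 - \<delta>))"
      using L c by (intro mult_right_mono) auto
  qed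
  finally have Ip: "(\<integral>x. indicator D x * g x powr p \<partial>lborel) \<le>
      ?m * (c / \<sigma> powr q * M * (k / r) powr p * ?F powr (1 - \<delta>))" .
  have "(\<integral>x. indicator D x * g x \<partial>lborel)
      \<le> (\<integral>x. indicator D x * g x powr p \<partial>lborel) powr (1 / p) * measure lborel D powr (1 - 1 / p)"
    by (rule holder_finite_measure(2)[OF _ g0 _ Dfin _ iD]) (use p in auto)
  also have "\<dots> \<le> (?m * (c / \<sigma> powr q * M * (k / r) powr p * ?F powr (1 - \<delta>))) powr (1 / p) *
      measure lborel D powr (1 - 1 / p)"
    using p by (intro mult_right_mono powr_mono2 Ip) (auto intro!: integral_nonneg_AE)
  also have "(?m * (c / \<sigma> powr q * M * (k / r) powr p * ?F powr (1 - \<delta>))) powr (1 / p)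
      = ?m powr (1 / p) * (c powr (1 / p) * \<sigma> powr (- (q / p)) * M powr (1 / p) * (k / r) * ?F powr ((1 - \<delta>) / p))"
  proof -
    have 1: "c / \<sigma> powr q = c * \<sigma> powr (- q)" by (simp add: powr_minus divide_inverse)
    show ?thesis
      unfolding 1 using c \<sigma> L k r p by (simp add: powr_mult powr_powr)
  qed
  finally have "(\<integral>x. indicator D x * g x \<partial>lborel) / ?m \<le>
      (?m powr (1 / p) * (c powr (1 / p) * \<sigma> powr (- (q / p)) * M powr (1 / p) * (k / r) * ?F powr ((1 - \<delta>) / p)) *
      measure lborel D powr (1 - 1 / p)) / ?m"
    by (rule divide_right_mono) simp
  also have "\<dots> = (c powr (1 / p) * \<sigma> powr (- (q / p)) * M powr (1 / p) * (k / r) * ?F powr ((1 - \<delta>) / p)) *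
      (measure lborel D powr (1 - 1 / p) / (?m / ?m powr (1 / p)))"
    by simp
  also have "?m / ?m powr (1 / p) = ?m powr (1 - 1 / p)"
    using m0 by (simp add: powr_diff)
  also have "measure lborel D powr (1 - 1 / p) / ?m powr (1 - 1 / p) = (measure lborel D / ?m) powr (1 - 1 / p)"
    by (simp add: powr_divide)
  finally show "(\<integral>x. indicator D x * g x \<partial>lborel) / ?m \<le>
      c powr (1 / p) * \<sigma> powr (- (q / p)) * M powr (1 / p) * (k / r) *
      ?F powr ((1 - \<delta>) / p) * (measure lborel D / ?m) powr (1 - 1 / p)" .
qed

text \<open>Combining the layer estimate with the energy bound eliminates the gradient: what remains is an
  inequality between relative measures of level sets.\<close>

lemma DG_measure_inequality:
  fixes v :: "real^'n::finite \<Rightarrow> real" and \<alpha> :: real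
  assumes DG: "DG_borel p \<Lambda> \<Omega> c q \<delta> v" and p: "1 < p" and c: "0 < c"
    and \<alpha>: "0 \<le> \<alpha>" "CARD('n) * \<alpha> < 1"
    and r: "0 < r" "ball y (8 * r) \<subseteq> \<Omega>" and \<sigma>: "0 < \<sigma>" "\<sigma> \<le> 1 / 2"
    and k: "0 < k" "l < k" and L: "\<Lambda> y r k \<le> M" "0 \<le> M"
  shows "(1 - l / k) * frac y (r * (1 - \<sigma>)) {x. v x \<le> l} powr (1 - \<alpha>) * frac y (r * (1 - \<sigma>)) {x. k \<le> v x}
    \<le> 2 ^ (2 * CARD('n) + 1) / (1 - CARD('n) * \<alpha>) * c powr (1 / p) * \<sigma> powr (- (q / p)) * M powr (1 / p) *
      frac y r {x. v x \<le> k} powr ((1 - \<delta>) / p) *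
      (measure lborel (ball y (r * (1 - \<sigma>)) \<inter> {x. l < v x \<and> v x < k}) / measure lborel (ball y r)) powr (1 - 1 / p)"
proof -
  let ?s = "r * (1 - \<sigma>)"
  let ?D = "ball y ?s \<inter> {x. l < v x \<and> v x < k}"
  let ?m = "measure lborel (ball y r)" and ?m' = "measure lborel (ball y ?s)"
  let ?n = "CARD('n)"
  have v[measurable]: "v \<in> borel_measurable borel" using DG by (simp add: DG_borel_def)
  obtain g where "level_gradient p \<Lambda> \<Omega> c q \<delta> v k g"
    using DG k(1) unfolding DG_borel_def by blast
  note lg = this[unfolded level_gradient_def]
  have g: "g \<in> borel_measurable borel" "\<And>x. 0 \<le> g x"
    using lg by simp_all
  note P = lg[THEN conjunct2, THEN conjunct2, THEN conjunct1, rule_format]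
    and E = lg[THEN conjunct2, THEN conjunct2, THEN conjunct2, rule_format]
  have s: "0 < ?s" "?s \<le> r" using r \<sigma> by (auto simp: algebra_simps)
  have "r * (1 / 2) \<le> ?s" using r \<sigma> by (intro mult_left_mono) auto
  then have s2: "r \<le> 2 * ?s" by simp
  have cb: "cball y ?s \<subseteq> \<Omega>" using r s by (auto simp: subset_iff)
  define I where "I = (\<integral>x. indicator ?D x * g x \<partial>lborel)"
  have I0: "0 \<le> I" unfolding I_def by (intro integral_nonneg_AE) (auto simp: g)
  define R where "R = c powr (1 / p) * \<sigma> powr (- (q / p)) * M powr (1 / p) *
      frac y r {x. v x \<le> k} powr ((1 - \<delta>) / p) * (measure lborel ?D / ?m) powr (1 - 1 / p)"
  have Dm: "?D \<in> sets borel" by simp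
  have "I / ?m \<le> c powr (1 / p) * \<sigma> powr (- (q / p)) * M powr (1 / p) * (k / r) *
      frac y r {x. v x \<le> k} powr ((1 - \<delta>) / p) * (measure lborel ?D / ?m) powr (1 - 1 / p)"
    unfolding I_def
    by (rule energy_bound_L1(2)[OF v g p c k(1) r(1) \<sigma>(1) _ _ _ L Dm])
      (use E[of r y \<sigma>] r \<sigma> in auto)
  then have IR: "I / ?m \<le> (k / r) * R" by (simp add: R_def mult_ac)
  have m: "0 < ?m" "0 < ?m'" using r s by auto
  have mm: "?m \<le> 2 ^ ?n * ?m'"
  proof -
    have "r ^ ?n \<le> (2 * ?s) ^ ?n" using r s2 by (intro power_mono) auto
    then show ?thesis
      using r s by (subst (1 2) content_ball_scale) (auto simp: power_mult_distrib mult_right_mono)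
  qed
  define K where "K = 2 ^ (?n + 1) / (1 - ?n * \<alpha>)"
  have K0: "0 \<le> K" using \<alpha> by (simp add: K_def)
  define X where "X = frac y ?s {x. v x \<le> l} powr (1 - \<alpha>) * frac y ?s {x. k \<le> v x}"
  have I': "I / ?m' \<le> 2 ^ ?n * (I / ?m)"
  proof -
    have "I * ?m \<le> I * (2 ^ ?n * ?m')" by (rule mult_left_mono[OF mm I0])
    then show ?thesis using m by (simp add: pos_divide_le_eq pos_le_divide_eq mult_ac)
  qed
  have "(k - l) * frac y ?s {x. v x \<le> l} powr (1 - \<alpha>) * frac y ?s {x. k \<le> v x}
      \<le> K * ?s * (I / ?m')"
    unfolding I_def K_def by (rule P) (use s cb k \<alpha> in auto)
  then have "(k - l) * X \<le> K * ?s * (I / ?m')" by (simp only: X_def mult.assoc)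
  also have "\<dots> \<le> K * r * (2 ^ ?n * ((k / r) * R))"
  proof (rule mult_mono)
    show "K * ?s \<le> K * r" by (rule mult_left_mono[OF s(2) K0])
    have "I / ?m' \<le> 2 ^ ?n * (I / ?m)" by (rule I')
    also have "\<dots> \<le> 2 ^ ?n * ((k / r) * R)" by (rule mult_left_mono[OF IR]) simp
    finally show "I / ?m' \<le> 2 ^ ?n * ((k / r) * R)" .
    show "0 \<le> K * r" using K0 r by simp
    show "0 \<le> I / ?m'" using I0 m by simp
  qed
  also have "\<dots> = k * (K * 2 ^ ?n * R)" using r by simp
  finally have "(k - l) * X / k \<le> K * 2 ^ ?n * R"
    using k by (simp add: divide_le_eq mult.commute)
  moreover have "(k - l) * X / k = (1 - l / k) * X"
  proof -
    have "(k - l) / k = 1 - l / k" using k by (simp add: diff_divide_distrib)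
    then show ?thesis by (metis times_divide_eq_left)
  qed
  moreover have "K * 2 ^ ?n = 2 ^ (2 * ?n + 1) / (1 - ?n * \<alpha>)"
    unfolding K_def by (simp only: mult_2 power_add) simp
  ultimately show ?thesis unfolding R_def X_def by (simp add: mult.assoc)
qed

lemma measure_ball_mono:
  fixes y :: "real^'n::finite"
  assumes "ball y s \<subseteq> ball z r" "S \<subseteq> T" "S \<in> sets borel" "T \<in> sets borel"
  shows "measure lborel (ball y s \<inter> S) \<le> measure lborel (ball z r \<inter> T)"
  by (rule measure_mono_fmeasurable) (use assms ball_Int_fmeasurable[of T z r] in auto)

lemma frac_ball_mono:
  fixes y z :: "real^'n::finite"
  assumes "0 < s" "0 < r" "ball y s \<subseteq> ball z r" "S \<subseteq> T" "S \<in> sets borel" "T \<in> sets borel"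
  shows "frac y s S \<le> (r / s) ^ CARD('n) * frac z r T"
proof -
  have u: "0 < measure lborel (ball (0::real^'n) 1)" by simp
  have "frac y s S = measure lborel (ball y s \<inter> S) / (s ^ CARD('n) * measure lborel (ball (0::real^'n) 1))"
    unfolding frac_def using content_ball_scale[of s y] assms by simp
  also have "\<dots> \<le> measure lborel (ball z r \<inter> T) / (s ^ CARD('n) * measure lborel (ball (0::real^'n) 1))"
    by (rule divide_right_mono[OF measure_ball_mono]) (use assms u in auto)
  also have "\<dots> = (r / s) ^ CARD('n) *
      (measure lborel (ball z r \<inter> T) / (r ^ CARD('n) * measure lborel (ball (0::real^'n) 1)))"
    using assms u by (simp add: power_divide)
  also have "\<dots> = (r / s) ^ CARD('n) * frac z r T"
    unfolding frac_def using content_ball_scale[of r z] assms by simp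
  finally show ?thesis .
qed

text \<open>Stated for a covering rather than a complement, since it is used with \<open>{v \<le> k}\<close>
  and \<open>{v \<ge> k}\<close>.\<close>

lemma frac_compl:
  fixes y :: "real^'n::finite"
  assumes r: "0 < r" and S: "S \<in> sets borel" and T: "T \<in> sets borel" and "S \<union> T = UNIV"
  shows "1 - frac y r S \<le> frac y r T"
proof -
  have m: "0 < measure lborel (ball y r)" using r by simp
  have "ball y r = (ball y r \<inter> S) \<union> (ball y r \<inter> T)" using assms by blast
  then have "measure lborel (ball y r) \<le> measure lborel (ball y r \<inter> S) + measure lborel (ball y r \<inter> T)"
    using measure_Un_le[of "ball y r \<inter> S" lborel "ball y r \<inter> T"] S T by simp
  then have "measure lborel (ball y r) / measure lborel (ball y r) \<le>
      (measure lborel (ball y r \<inter> S) + measure lborel (ball y r \<inter> T)) / measure lborel (ball y r)"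
    by (rule divide_right_mono) simp
  then show ?thesis using m unfolding frac_def by (simp add: add_divide_distrib)
qed

lemma frac_eq_1_AE:
  fixes y :: "real^'n::finite"
  assumes r: "0 < r" and S: "S \<in> sets borel" and ae: "AE x in lborel. x \<in> ball y r \<longrightarrow> x \<in> S"
  shows "frac y r S = 1"
proof -
  have "measure lborel (ball y r \<inter> S) = measure lborel (ball y r)"
    by (rule measure_eq_AE) (use ae S in auto)
  moreover have "0 < measure lborel (ball y r)" using r by simp
  ultimately show ?thesis unfolding frac_def by simp
qed

section \<open>From measure to pointwise information\<close>

text \<open>\<open>M\<close> bounds \<open>\<Lambda>\<close> on balls of radius \<open>r \<le>
  \<rho>\<close>, but only for levels between \<open>r\<close> and \<open>(r/\<rho>) K\<close>:
  the admissible levels shrink in proportion to the radius.\<close>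

definition admissible :: "real \<Rightarrow> real \<Rightarrow> real \<Rightarrow> real \<Rightarrow> (real^'n::finite) set \<Rightarrow>
    (real^'n \<Rightarrow> real \<Rightarrow> real \<Rightarrow> real) \<Rightarrow> (real^'n \<Rightarrow> real) \<Rightarrow> real \<Rightarrow> real \<Rightarrow> real \<Rightarrow> bool" where
  "admissible p q c \<delta> \<Omega> \<Lambda> v \<rho> K M \<longleftrightarrow>
     DG_borel p \<Lambda> \<Omega> c q \<delta> v \<and> 0 < \<rho> \<and> 1 \<le> M \<and> 0 \<le> K \<and>
     (\<forall>y r k. 0 < r \<and> r \<le> \<rho> \<and> ball y (8 * r) \<subseteq> \<Omega> \<and> r \<le> k \<and> k \<le> r / \<rho> * K \<longrightarrow> \<Lambda> y r k \<le> M)"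

lemma admissibleD:
  assumes "admissible p q c \<delta> \<Omega> \<Lambda> v \<rho> K M"
  shows "DG_borel p \<Lambda> \<Omega> c q \<delta> v" "0 < \<rho>" "1 \<le> M" "0 \<le> K" "v \<in> borel_measurable borel"
    "\<And>y r k. 0 < r \<Longrightarrow> r \<le> \<rho> \<Longrightarrow> ball y (8 * r) \<subseteq> \<Omega> \<Longrightarrow> r \<le> k \<Longrightarrow> k \<le> r / \<rho> * K \<Longrightarrow> \<Lambda> y r k \<le> M"
  using assms unfolding admissible_def DG_borel_def by simp_all

lemma power_powr_commute: "0 < x \<Longrightarrow> (x ^ j) powr e = (x powr e) ^ j" for x e :: real
  by (simp add: powr_realpow[symmetric] powr_powr mult.commute)

lemma inverse_powr_minus: "inverse x powr (- e) = x powr e" for x e :: real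
  by (simp add: powr_minus inverse_powr)

text \<open>Since the exponent on the right exceeds the one on the left by \<open>\<kappa> > 0\<close>, the
  decay rate \<open>\<xi>\<close> with \<open>B \<xi>\<^sup>\<kappa> \<le> 1\<close> reproduces
  itself as soon as the initial value is small.\<close>

lemma fast_geometric_decay:
  fixes Y :: "nat \<Rightarrow> real" and a \<kappa> H B \<xi> \<nu> :: real
  assumes a: "0 < a" and \<kappa>: "0 < \<kappa>" and H: "0 \<le> H" and B: "0 \<le> B" and \<xi>: "0 < \<xi>" "\<xi> \<le> 1"
    and \<nu>: "0 < \<nu>" and B\<xi>: "B * \<xi> powr \<kappa> \<le> 1" and H\<nu>: "H * \<nu> powr \<kappa> \<le> \<xi> powr a"
    and Y0: "Y 0 \<le> \<nu>" and Ynn: "\<And>j. 0 \<le> Y j"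
    and step: "\<And>j. Y j \<le> \<nu> \<Longrightarrow> Y (Suc j) powr a \<le> H * B ^ j * Y j powr (a + \<kappa>)"
  shows "Y j \<le> \<nu> * \<xi> ^ j"
proof (induction j)
  case 0
  then show ?case using Y0 by simp
next
  case (Suc j)
  have \<xi>j: "0 < \<xi> ^ j" "\<xi> ^ j \<le> 1" using \<xi> by (auto intro: power_le_one)
  have "\<nu> * \<xi> ^ j \<le> \<nu> * 1" by (rule mult_left_mono) (use \<xi>j \<nu> in auto)
  then have Yj: "Y j \<le> \<nu>" using Suc by simp
  have "Y (Suc j) powr a \<le> H * B ^ j * Y j powr (a + \<kappa>)" by (rule step[OF Yj])
  also have "\<dots> \<le> H * B ^ j * (\<nu> * \<xi> ^ j) powr (a + \<kappa>)"
    by (intro mult_left_mono powr_mono2 Suc Ynn mult_nonneg_nonneg zero_le_power) (use a \<kappa> H B in auto)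
  also have "(\<nu> * \<xi> ^ j) powr (a + \<kappa>) = \<nu> powr a * \<nu> powr \<kappa> * ((\<xi> ^ j) powr a * (\<xi> ^ j) powr \<kappa>)"
    using \<nu> \<xi>j by (simp add: powr_mult powr_add)
  also have "(\<xi> ^ j) powr \<kappa> = (\<xi> powr \<kappa>) ^ j"
    using \<xi> by (simp add: power_powr_commute)
  also have "H * B ^ j * (\<nu> powr a * \<nu> powr \<kappa> * ((\<xi> ^ j) powr a * (\<xi> powr \<kappa>) ^ j))
      = (H * \<nu> powr \<kappa>) * (B * \<xi> powr \<kappa>) ^ j * (\<nu> powr a * (\<xi> ^ j) powr a)"
    by (simp add: power_mult_distrib mult_ac)
  also have "\<dots> \<le> (\<xi> powr a * 1) * (\<nu> powr a * (\<xi> ^ j) powr a)"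
  proof (rule mult_right_mono)
    have "(B * \<xi> powr \<kappa>) ^ j \<le> 1" by (rule power_le_one) (use B B\<xi> in auto)
    then show "H * \<nu> powr \<kappa> * (B * \<xi> powr \<kappa>) ^ j \<le> \<xi> powr a * 1"
      by (intro mult_mono H\<nu>) (use B in auto)
  qed simp
  also have "\<dots> = (\<nu> * \<xi> ^ Suc j) powr a"
    using \<nu> \<xi> \<xi>j by (simp add: powr_mult)
  finally have le: "Y (Suc j) powr a \<le> (\<nu> * \<xi> ^ Suc j) powr a" .
  show ?case
  proof (rule ccontr)
    assume "\<not> ?case"
    then have "(\<nu> * \<xi> ^ Suc j) powr a < Y (Suc j) powr a"
      by (intro powr_less_mono2[OF a]) (use \<nu> \<xi> in auto)
    with le show False by simp
  qed
qed

text \<open>Radius and level shrink by the same factor \<open>1 - \<sigma>\<close>. If \<open>{v \<le>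
  k}\<close> is small in the larger ball, then \<open>{v \<ge> k}\<close> fills at least half of
  the smaller one, and the layer is contained in \<open>{v \<le> k}\<close>; the exponents
  \<open>(1 - \<delta>)/p\<close> and \<open>1 - 1/p\<close> add up to \<open>1 -
  \<delta>/p\<close>.\<close>

lemma degiorgi_step:
  fixes v :: "real^'n::finite \<Rightarrow> real" and \<alpha> :: real
  assumes adm: "admissible p q c \<delta> \<Omega> \<Lambda> v \<rho> K M"
    and p: "1 < p" and c: "0 < c" and q: "0 \<le> q" and \<alpha>: "0 \<le> \<alpha>" "CARD('n) * \<alpha> < 1"
    and r: "0 < r" "r \<le> \<rho>" "ball y (8 * r) \<subseteq> \<Omega>" and k: "r \<le> k" "k \<le> r / \<rho> * K"
    and \<sigma>: "0 < \<sigma>" "\<sigma> \<le> 1 / 2"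
    and small: "frac y r {x. v x \<le> k} \<le> 1 / 2 ^ (CARD('n) + 1)"
  shows "frac y (r * (1 - \<sigma>)) {x. v x \<le> k * (1 - \<sigma>)} powr (1 - \<alpha>) \<le>
    2 * (2 ^ (2 * CARD('n) + 1) / (1 - CARD('n) * \<alpha>) * c powr (1 / p)) * M powr (1 / p) *
      \<sigma> powr (- (1 + q / p)) * frac y r {x. v x \<le> k} powr (1 - \<delta> / p)"
proof -
  let ?n = "CARD('n)"
  let ?s = "r * (1 - \<sigma>)"
  let ?Y = "frac y r {x. v x \<le> k}"
  note ad = admissibleD[OF adm]
  note [measurable] = ad(5)
  have k0: "0 < k" using r k by simp
  have lk: "k * (1 - \<sigma>) < k" using k0 \<sigma> by simp
  have s: "0 < ?s" "?s \<le> r" using r \<sigma> by (auto simp: algebra_simps)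
  have "r * (1 / 2) \<le> ?s" using r \<sigma> by (intro mult_left_mono) auto
  then have rs: "r / ?s \<le> 2" using s by (simp add: divide_le_eq)
  define A where "A = 2 ^ (2 * ?n + 1) / (1 - ?n * \<alpha>) * c powr (1 / p)"
  have A0: "0 \<le> A" using \<alpha> by (simp add: A_def)
  define U where "U = frac y ?s {x. v x \<le> k * (1 - \<sigma>)} powr (1 - \<alpha>)"
  have U0: "0 \<le> U" by (simp add: U_def)
  define X where "X = measure lborel (ball y ?s \<inter> {x. k * (1 - \<sigma>) < v x \<and> v x < k}) / measure lborel (ball y r)"
  have "(1 - k * (1 - \<sigma>) / k) * frac y ?s {x. v x \<le> k * (1 - \<sigma>)} powr (1 - \<alpha>) * frac y ?s {x. k \<le> v x}
    \<le> 2 ^ (2 * ?n + 1) / (1 - ?n * \<alpha>) * c powr (1 / p) * \<sigma> powr (- (q / p)) * M powr (1 / p) *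
      frac y r {x. v x \<le> k} powr ((1 - \<delta>) / p) * X powr (1 - 1 / p)"
    unfolding X_def
    by (rule DG_measure_inequality[OF ad(1) p c \<alpha> r(1) r(3) \<sigma> k0 lk ad(6)[OF r k]]) (use ad(3) in simp)
  moreover have "1 - k * (1 - \<sigma>) / k = \<sigma>" using k0 by simp
  ultimately have main: "\<sigma> * U * frac y ?s {x. k \<le> v x} \<le>
      A * \<sigma> powr (- (q / p)) * M powr (1 / p) * ?Y powr ((1 - \<delta>) / p) * X powr (1 - 1 / p)"
    by (simp only: U_def A_def)
  have half: "1 / 2 \<le> frac y ?s {x. k \<le> v x}"
  proof -
    have "frac y ?s {x. v x \<le> k} \<le> (r / ?s) ^ ?n * ?Y"
      by (rule frac_ball_mono) (use s r subset_ball[OF s(2), of y] in auto)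
    also have "\<dots> \<le> 2 ^ ?n * (1 / 2 ^ (?n + 1))"
    proof (rule mult_mono[OF power_mono[OF rs] small])
      show "0 \<le> r / ?s" using r s by (simp only: divide_nonneg_pos less_imp_le)
    qed (auto simp: frac_nonneg)
    also have "\<dots> = 1 / 2" by simp
    finally have "frac y ?s {x. v x \<le> k} \<le> 1 / 2" .
    moreover have "1 - frac y ?s {x. v x \<le> k} \<le> frac y ?s {x. k \<le> v x}"
      by (rule frac_compl[OF s(1)]) auto
    ultimately show ?thesis by simp
  qed
  have X: "0 \<le> X" "X \<le> ?Y"
  proof -
    show "0 \<le> X" by (simp add: X_def)
    show "X \<le> ?Y" unfolding X_def frac_def
      by (intro divide_right_mono measure_ball_mono) (use s subset_ball[OF s(2), of y] in auto)
  qed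
  have "\<sigma> * U * (1 / 2) \<le> \<sigma> * U * frac y ?s {x. k \<le> v x}"
    by (rule mult_left_mono[OF half]) (use \<sigma> U0 in simp)
  also note main
  also have "A * \<sigma> powr (- (q / p)) * M powr (1 / p) * ?Y powr ((1 - \<delta>) / p) * X powr (1 - 1 / p)
    \<le> A * \<sigma> powr (- (q / p)) * M powr (1 / p) * ?Y powr ((1 - \<delta>) / p) * ?Y powr (1 - 1 / p)"
    by (intro mult_left_mono powr_mono2 X mult_nonneg_nonneg A0) (use p in auto)
  also have "\<dots> = A * \<sigma> powr (- (q / p)) * M powr (1 / p) * ?Y powr (1 - \<delta> / p)"
  proof -
    have "(1 - \<delta>) / p + (1 - 1 / p) = 1 - \<delta> / p" by (simp add: diff_divide_distrib)
    then have "?Y powr ((1 - \<delta>) / p) * ?Y powr (1 - 1 / p) = ?Y powr (1 - \<delta> / p)"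
      by (metis powr_add)
    then show ?thesis by (simp add: mult.assoc)
  qed
  finally have "U \<le> 2 * (A * \<sigma> powr (- (q / p)) * M powr (1 / p) * ?Y powr (1 - \<delta> / p)) / \<sigma>"
    using \<sigma> by (simp add: pos_le_divide_eq mult_ac)
  also have "\<dots> = 2 * A * M powr (1 / p) * (\<sigma> powr (- (q / p)) / \<sigma>) * ?Y powr (1 - \<delta> / p)"
    by simp
  also have "\<sigma> powr (- (q / p)) / \<sigma> = \<sigma> powr (- (1 + q / p))"
  proof -
    have "- (1 + q / p) = - (q / p) - 1" by simp
    then have "\<sigma> powr (- (1 + q / p)) = \<sigma> powr (- (q / p)) / \<sigma> powr 1"
      by (simp only: powr_diff)
    then show ?thesis using \<sigma> by simp
  qed
  finally show ?thesis unfolding U_def A_def .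
qed

lemma exponent_bounds:
  fixes p \<delta> \<alpha> :: real
  assumes p: "1 < p" and \<delta>: "0 \<le> \<delta>" and \<alpha>: "\<delta> / p < \<alpha>" "CARD('n::finite) * \<alpha> < 1"
  shows "0 \<le> \<alpha>" "\<alpha> < 1"
proof -
  have "0 \<le> \<delta> / p" using \<delta> p by simp
  then show \<alpha>0: "0 \<le> \<alpha>" using \<alpha>(1) by linarith
  have "1 * \<alpha> \<le> CARD('n) * \<alpha>" using \<alpha>0 by (intro mult_right_mono) (auto simp: Suc_leI)
  then show "\<alpha> < 1" using \<alpha>(2) by simp
qed

text \<open>De Giorgi iteration of \<open>degiorgi_step\<close> over radii \<open>r \<theta>\<^sub>j\<close>
  and levels \<open>k \<theta>\<^sub>j\<close> with \<open>\<theta>\<^sub>j\<close> decreasing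
  from \<open>1\<close> to \<open>1/2\<close>. Using the same factors for radii and levels keeps
  every step within the admissible range of levels. Since \<open>1 - \<delta>/p = (1 - \<alpha>) +
  \<kappa>\<close> with \<open>\<kappa> = \<alpha> - \<delta>/p > 0\<close>, the decay is
  geometric.\<close>

lemma measure_to_pointwise:
  fixes p q c \<delta> \<alpha> :: real
  assumes p: "1 < p" and c: "0 < c" and q: "0 \<le> q" and \<delta>: "0 \<le> \<delta>"
    and \<alpha>: "\<delta> / p < \<alpha>" "CARD('n::finite) * \<alpha> < 1"
  shows "\<exists>\<nu>0 b. 0 < \<nu>0 \<and> \<nu>0 \<le> 1 \<and> 0 \<le> b \<and>
    (\<forall>\<Omega> \<Lambda> (v :: real^'n \<Rightarrow> real) \<rho> K M y r k.
      admissible p q c \<delta> \<Omega> \<Lambda> v \<rho> K M \<longrightarrow> 0 < r \<longrightarrow> r \<le> \<rho> \<longrightarrow> ball y (8 * r) \<subseteq> \<Omega> \<longrightarrow>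
      r \<le> k \<longrightarrow> k \<le> r / \<rho> * K \<longrightarrow> frac y r {x. v x \<le> k} \<le> \<nu>0 * M powr (- b) \<longrightarrow>
      (AE x in lborel. x \<in> ball y (r / 2) \<longrightarrow> k / 2 \<le> v x))"
proof -
  let ?n = "CARD('n)"
  define \<kappa> where "\<kappa> = \<alpha> - \<delta> / p"
  have \<kappa>: "0 < \<kappa>" using \<alpha> by (simp add: \<kappa>_def)
  have \<alpha>0: "0 \<le> \<alpha>" and \<alpha>1: "\<alpha> < 1"
    using exponent_bounds[OF p \<delta> \<alpha>] by simp_all
  define e where "e = 1 + q / p"
  have e: "0 < e" using p q by (simp add: e_def add_pos_nonneg)
  define A where "A = 2 * (2 ^ (2 * ?n + 1) / (1 - ?n * \<alpha>) * c powr (1 / p))"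
  have A: "0 < A" using \<alpha> c by (simp add: A_def)
  define B where "B = (2::real) powr e"
  have B: "0 < B" "1 \<le> B" using e by (auto simp: B_def ge_one_powr_ge_zero)
  \<comment> \<open>The rate that turns \<open>B \<xi>\<^sup>\<kappa>\<close> into \<open>1\<close>.\<close>
  define \<xi> where "\<xi> = B powr (- (1 / \<kappa>))"
  have \<xi>: "0 < \<xi>" "\<xi> < 1"
  proof -
    show "0 < \<xi>" using B by (simp add: \<xi>_def)
    have "1 < B" using e by (simp add: B_def)
    then show "\<xi> < 1" using \<kappa> by (simp add: \<xi>_def powr_less_one)
  qed
  have B\<xi>: "B * \<xi> powr \<kappa> = 1"
  proof -
    have "\<xi> powr \<kappa> = B powr (- 1)" using \<kappa> by (simp add: \<xi>_def powr_powr)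
    then show ?thesis using B by (simp add: powr_minus)
  qed
  define H0 where "H0 = A * 4 powr e"
  have H0: "0 < H0" using A by (simp add: H0_def)
  \<comment> \<open>The first entry makes \<open>degiorgi_step\<close> applicable, the second is
    the smallness for \<open>fast_geometric_decay\<close> when \<open>M = 1\<close>; the power
    \<open>M\<^bsup>-b\<^esup>\<close> compensates \<open>M\<^bsup>1/p\<^esup>\<close> in
    \<open>H\<close>.\<close>
  define \<nu>0 where "\<nu>0 = min (1 / 2 ^ (?n + 1)) ((\<xi> powr (1 - \<alpha>) / H0) powr (1 / \<kappa>))"
  define b where "b = 1 / (p * \<kappa>)"
  have b: "0 \<le> b" using p \<kappa> by (simp add: b_def)
  have \<nu>0: "0 < \<nu>0" "\<nu>0 \<le> 1 / 2 ^ (?n + 1)" "\<nu>0 \<le> 1"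
  proof -
    show "0 < \<nu>0" using \<xi> H0 by (simp add: \<nu>0_def)
    show *: "\<nu>0 \<le> 1 / 2 ^ (?n + 1)" by (simp add: \<nu>0_def)
    have "1 / 2 ^ (?n + 1) \<le> (1::real)"
      using one_le_power[of "2::real" "?n + 1"] by (simp add: divide_le_eq)
    with * show "\<nu>0 \<le> 1" by linarith
  qed
  have H\<nu>0: "H0 * \<nu>0 powr \<kappa> \<le> \<xi> powr (1 - \<alpha>)"
  proof -
    have "\<nu>0 powr \<kappa> \<le> ((\<xi> powr (1 - \<alpha>) / H0) powr (1 / \<kappa>)) powr \<kappa>"
      by (rule powr_mono2) (use \<kappa> \<nu>0 in \<open>auto simp: \<nu>0_def\<close>)
    also have "\<dots> = \<xi> powr (1 - \<alpha>) / H0" using \<kappa> \<xi> H0 by (simp add: powr_powr)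
    finally show ?thesis using H0 by (simp add: pos_le_divide_eq mult.commute)
  qed
  have concl: "AE x in lborel. x \<in> ball y (r / 2) \<longrightarrow> k / 2 \<le> v x"
    if adm: "admissible p q c \<delta> \<Omega> \<Lambda> v \<rho> K M" and r: "0 < r" "r \<le> \<rho>" "ball y (8 * r) \<subseteq> \<Omega>"
      and k: "r \<le> k" "k \<le> r / \<rho> * K" and small: "frac y r {x. v x \<le> k} \<le> \<nu>0 * M powr (- b)"
    for \<Omega> \<Lambda> and v :: "real^'n \<Rightarrow> real" and \<rho> K M y r k
  proof -
    note ad = admissibleD[OF adm]
    note [measurable] = ad(5)
    have M: "1 \<le> M" by (rule ad(3))
    define \<nu> where "\<nu> = \<nu>0 * M powr (- b)"
    have Mb: "M powr (- b) \<le> 1" "0 < M powr (- b)"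
      using M b by (auto simp: powr_minus inverse_le_1_iff ge_one_powr_ge_zero)
    have \<nu>: "0 < \<nu>" "\<nu> \<le> 1 / 2 ^ (?n + 1)"
    proof -
      show "0 < \<nu>" using \<nu>0 Mb by (simp add: \<nu>_def)
      have "\<nu> \<le> \<nu>0 * 1" unfolding \<nu>_def by (rule mult_left_mono) (use Mb \<nu>0 in auto)
      then show "\<nu> \<le> 1 / 2 ^ (?n + 1)" using \<nu>0 by simp
    qed
    define H where "H = H0 * M powr (1 / p)"
    have H: "0 \<le> H" using H0 by (simp add: H_def)
    have H\<nu>: "H * \<nu> powr \<kappa> \<le> \<xi> powr (1 - \<alpha>)"
    proof -
      have "\<nu> powr \<kappa> = \<nu>0 powr \<kappa> * M powr (- b * \<kappa>)"
        unfolding \<nu>_def using \<nu>0 M by (simp add: powr_mult powr_powr)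
      also have "- b * \<kappa> = - (1 / p)" using \<kappa> by (simp add: b_def)
      finally have "H * \<nu> powr \<kappa> = H0 * \<nu>0 powr \<kappa> * (M powr (1 / p) * M powr (- (1 / p)))"
        by (simp add: H_def mult_ac)
      also have "M powr (1 / p) * M powr (- (1 / p)) = 1"
        using M by (simp flip: powr_add)
      finally show ?thesis using H\<nu>0 by simp
    qed
    define th where "th j = (1 + (1/2) ^ j) / (2::real)" for j :: nat
    have th: "1 / 2 < th j" "th j \<le> 1" "th j - th (Suc j) = (1/2) ^ j / 4" for j
    proof -
      show "1 / 2 < th j" by (simp add: th_def)
      have "(1/2::real) ^ j \<le> 1" by (simp add: power_le_one)
      then show "th j \<le> 1" by (simp add: th_def)
      show "th j - th (Suc j) = (1/2) ^ j / 4" by (simp add: th_def add_divide_distrib)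
    qed
    define Y where "Y j = frac y (r * th j) {x. v x \<le> k * th j}" for j
    have step: "Y (Suc j) powr (1 - \<alpha>) \<le> H * B ^ j * Y j powr ((1 - \<alpha>) + \<kappa>)" if Yj: "Y j \<le> \<nu>" for j
    proof -
      define \<sigma> where "\<sigma> = 1 - th (Suc j) / th j"
      have tj: "0 < th j" using th(1)[of j] by linarith
      have \<sigma>eq: "\<sigma> = ((1/2) ^ j / 4) / th j"
      proof -
        have "\<sigma> = (th j - th (Suc j)) / th j" using tj by (simp add: \<sigma>_def diff_divide_distrib)
        then show ?thesis by (simp only: th(3))
      qed
      have \<sigma>1: "(1/2) ^ j / 4 \<le> \<sigma>"
      proof -
        have "(1/2::real) ^ j / 4 = (1/2) ^ j / 4 / 1" by simp
        also have "\<dots> \<le> (1/2) ^ j / 4 / th j" by (rule divide_left_mono) (use th(2)[of j] tj in auto)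
        finally show ?thesis by (simp add: \<sigma>eq)
      qed
      have \<sigma>0: "0 < \<sigma>" by (rule less_le_trans[OF _ \<sigma>1]) simp
      have \<sigma>2: "\<sigma> \<le> 1 / 2"
      proof -
        have "(1/2::real) ^ j / 4 \<le> 1 / 4" by (simp add: power_le_one)
        also have "\<dots> \<le> 1 / 2 * th j" using th(1)[of j] by simp
        finally show ?thesis unfolding \<sigma>eq using tj by (simp add: pos_divide_le_eq)
      qed
      have eqr: "r * th j * (1 - \<sigma>) = r * th (Suc j)" "k * th j * (1 - \<sigma>) = k * th (Suc j)"
        using tj by (auto simp: \<sigma>_def)
      have *: "frac y (r * th j * (1 - \<sigma>)) {x. v x \<le> k * th j * (1 - \<sigma>)} powr (1 - \<alpha>) \<le>
        2 * (2 ^ (2 * ?n + 1) / (1 - ?n * \<alpha>) * c powr (1 / p)) * M powr (1 / p) *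
        \<sigma> powr (- (1 + q / p)) * frac y (r * th j) {x. v x \<le> k * th j} powr (1 - \<delta> / p)"
      proof (rule degiorgi_step[OF adm p c q \<alpha>0 \<alpha>(2) _ _ _ _ _ \<sigma>0 \<sigma>2])
        show "0 < r * th j" using r tj by simp
        have le: "r * th j \<le> r" using r th(2)[of j] by (simp add: mult_left_le)
        from le r(2) show "r * th j \<le> \<rho>" by (rule order_trans)
        have "8 * (r * th j) \<le> 8 * r" by (rule mult_left_mono[OF le]) simp
        then show "ball y (8 * (r * th j)) \<subseteq> \<Omega>" by (rule subset_trans[OF subset_ball r(3)])
        show "r * th j \<le> k * th j" using k tj by (intro mult_right_mono) auto
        have "k * th j \<le> r / \<rho> * K * th j" using k tj by (intro mult_right_mono) auto
        also have "\<dots> = r * th j / \<rho> * K" by simp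
        finally show "k * th j \<le> r * th j / \<rho> * K" .
        show "frac y (r * th j) {x. v x \<le> k * th j} \<le> 1 / 2 ^ (?n + 1)"
          using Yj \<nu>(2) unfolding Y_def by linarith
      qed
      have "Y (Suc j) powr (1 - \<alpha>) \<le> A * M powr (1 / p) * \<sigma> powr (- e) * Y j powr ((1 - \<alpha>) + \<kappa>)"
      proof -
        have "1 - \<delta> / p = (1 - \<alpha>) + \<kappa>" by (simp add: \<kappa>_def)
        with * show ?thesis by (simp only: eqr Y_def A_def e_def)
      qed
      also have "\<dots> \<le> A * M powr (1 / p) * (4 powr e * B ^ j) * Y j powr ((1 - \<alpha>) + \<kappa>)"
      proof (rule mult_right_mono[OF mult_left_mono])
        have "\<sigma> powr (- e) \<le> ((1/2) ^ j / 4) powr (- e)"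
          by (rule powr_mono2'[OF _ _ \<sigma>1]) (use e in simp_all)
        also have "\<dots> = (4 * 2 ^ j) powr e"
        proof -
          have "((1/2::real) ^ j / 4) = inverse (4 * 2 ^ j)" by (simp add: power_divide inverse_eq_divide)
          then show ?thesis by (simp only: inverse_powr_minus)
        qed
        also have "\<dots> = 4 powr e * B ^ j"
          by (simp add: B_def powr_mult power_powr_commute)
        finally show "\<sigma> powr (- e) \<le> 4 powr e * B ^ j" .
        show "0 \<le> A * M powr (1 / p)" by (intro mult_nonneg_nonneg less_imp_le[OF A] powr_ge_zero)
      qed (rule powr_ge_zero)
      also have "\<dots> = H * B ^ j * Y j powr ((1 - \<alpha>) + \<kappa>)"
        unfolding H_def H0_def by (simp only: mult_ac)
      finally show ?thesis .
    qed
    have decay: "Y j \<le> \<nu> * \<xi> ^ j" for j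
    proof (rule fast_geometric_decay[of "1 - \<alpha>" \<kappa> H B \<xi> \<nu> Y])
      show "Y 0 \<le> \<nu>" using small by (simp add: Y_def th_def \<nu>_def)
      show "0 \<le> Y j" for j by (simp add: Y_def frac_nonneg)
    qed (use \<alpha>1 \<kappa> H B \<xi> \<nu> B\<xi> H\<nu> step in auto)
    let ?S = "ball y (r / 2) \<inter> {x. v x \<le> k / 2}"
    have bound: "measure lborel ?S \<le> measure lborel (ball y r) * (\<nu> * \<xi> ^ j)" for j
    proof -
      have tj: "0 < th j" "1 / 2 \<le> th j" using th(1)[of j] by auto
      have rr: "r / 2 \<le> r * th j" "k / 2 \<le> k * th j"
        using mult_left_mono[OF tj(2), of r] mult_left_mono[OF tj(2), of k] r k by auto
      have "measure lborel ?S \<le> measure lborel (ball y (r * th j) \<inter> {x. v x \<le> k * th j})"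
        by (rule measure_ball_mono) (use rr in auto)
      also have "\<dots> = measure lborel (ball y (r * th j)) * Y j"
      proof -
        have "0 < measure lborel (ball y (r * th j))" using r tj by simp
        then show ?thesis unfolding Y_def frac_def by simp
      qed
      also have "\<dots> \<le> measure lborel (ball y r) * (\<nu> * \<xi> ^ j)"
      proof (rule mult_mono)
        have "r * th j \<le> r" using r th(2)[of j] by (simp add: mult_left_le)
        then show "measure lborel (ball y (r * th j)) \<le> measure lborel (ball y r)"
          using measure_ball_mono[OF subset_ball, of "r * th j" r UNIV UNIV y] by simp
        show "0 \<le> Y j" by (simp add: Y_def frac_nonneg)
      qed (rule decay, simp)
      finally show ?thesis .
    qed
    have "(\<lambda>j. measure lborel (ball y r) * (\<nu> * \<xi> ^ j)) \<longlonglongrightarrow> measure lborel (ball y r) * (\<nu> * 0)"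
      by (intro tendsto_intros LIMSEQ_realpow_zero) (use \<xi> in auto)
    then have "measure lborel ?S \<le> measure lborel (ball y r) * (\<nu> * 0)"
      by (rule LIMSEQ_le_const) (use bound in auto)
    then have m0: "measure lborel ?S = 0" by (simp add: measure_le_0_iff)
    have fm: "?S \<in> fmeasurable lborel" by (rule ball_Int_fmeasurable) simp
    have "emeasure lborel ?S = 0" using emeasure_eq_measure2[OF fm] unfolding m0 by simp
    then have "AE x in lborel. x \<notin> ?S" by (intro AE_not_in) auto
    then show ?thesis by eventually_elim auto
  qed
  show ?thesis
    by (rule exI[of _ \<nu>0], rule exI[of _ b], intro conjI allI impI,
        rule \<nu>0(1), rule \<nu>0(3), rule b, rule concl)
qed

section \<open>Expansion of positivity\<close>

text \<open>If \<open>{v \<ge> k}\<close> fills half of \<open>B\<^sub>r\<close> while \<open>{v \<le>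
  k/2}\<close> keeps a fraction \<open>\<nu>\<close> of \<open>B\<^bsub>4r\<^esub>\<close>, then
  the layer between the two levels cannot be thin. The power of \<open>\<nu>\<close> on the right
  also covers \<open>\<delta> > 1\<close>, when the energy bound deteriorates for small \<open>{v
  \<le> k}\<close>.\<close>

lemma level_sets_energy_lower_bound:
  fixes v :: "real^'n::finite \<Rightarrow> real" and \<alpha> \<nu> :: real
  assumes adm: "admissible p q c \<delta> \<Omega> \<Lambda> v \<rho> K M"
    and p: "1 < p" and c: "0 < c" and \<delta>: "0 \<le> \<delta>" and \<alpha>: "0 \<le> \<alpha>" "\<alpha> < 1" "CARD('n) * \<alpha> < 1"
    and r: "0 < r" "8 * r \<le> \<rho>" "ball y (64 * r) \<subseteq> \<Omega>" and k: "8 * r \<le> k" "k \<le> r / \<rho> * K"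
    and half: "1 / 2 \<le> frac y r {x. k \<le> v x}"
    and \<nu>: "0 < \<nu>" "\<nu> \<le> frac y (4 * r) {x. v x \<le> k / 2}"
  shows "\<nu> powr (1 - \<alpha>) / (4 * 4 ^ CARD('n)) \<le>
    2 ^ (2 * CARD('n) + 1) / (1 - CARD('n) * \<alpha>) * c powr (1 / p) * 2 powr (q / p) * M powr (1 / p) *
    (\<nu> / 2 ^ CARD('n)) powr (- (\<delta> / p)) *
    (measure lborel (ball y (4 * r) \<inter> {x. k / 2 < v x \<and> v x < k}) / measure lborel (ball y (8 * r))) powr (1 - 1 / p)"
proof -
  let ?n = "CARD('n)"
  note ad = admissibleD[OF adm]
  note [measurable] = ad(5)
  have k0: "0 < k" using r k by simp
  define A where "A = 2 ^ (2 * ?n + 1) / (1 - ?n * \<alpha>) * c powr (1 / p)"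
  have A: "0 \<le> A" using \<alpha> by (simp add: A_def)
  define X where "X = measure lborel (ball y (4 * r) \<inter> {x. k / 2 < v x \<and> v x < k}) / measure lborel (ball y (8 * r))"
  have X0: "0 \<le> X" by (simp add: X_def)
  define F where "F = frac y (8 * r) {x. v x \<le> k}"
  have r8: "0 < 8 * r" using r by simp
  have s: "8 * r * (1 - 1 / 2) = 4 * r" by simp
  have L: "\<Lambda> y (8 * r) k \<le> M"
  proof (rule ad(6)[OF r8 r(2) _ k(1)])
    show "ball y (8 * (8 * r)) \<subseteq> \<Omega>" using r(3) by simp
    have "r / \<rho> * K \<le> 8 * r / \<rho> * K"
      using r ad(2,4) by (intro mult_right_mono divide_right_mono) auto
    then show "k \<le> 8 * r / \<rho> * K" using k(2) by linarith
  qed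
  have b8: "ball y (8 * (8 * r)) \<subseteq> \<Omega>" using r(3) by simp
  have "(1 - (k / 2) / k) * frac y (8 * r * (1 - 1 / 2)) {x. v x \<le> k / 2} powr (1 - \<alpha>) *
      frac y (8 * r * (1 - 1 / 2)) {x. k \<le> v x}
    \<le> 2 ^ (2 * ?n + 1) / (1 - ?n * \<alpha>) * c powr (1 / p) * (1 / 2) powr (- (q / p)) * M powr (1 / p) *
      frac y (8 * r) {x. v x \<le> k} powr ((1 - \<delta>) / p) *
      (measure lborel (ball y (8 * r * (1 - 1 / 2)) \<inter> {x. k / 2 < v x \<and> v x < k}) / measure lborel (ball y (8 * r))) powr (1 - 1 / p)"
    by (rule DG_measure_inequality[OF ad(1) p c \<alpha>(1,3) r8 b8 _ _ k0 _ L]) (use k0 ad(3) in simp_all)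
  then have main: "(1 - (k / 2) / k) * frac y (4 * r) {x. v x \<le> k / 2} powr (1 - \<alpha>) * frac y (4 * r) {x. k \<le> v x}
    \<le> A * (1 / 2) powr (- (q / p)) * M powr (1 / p) * F powr ((1 - \<delta>) / p) * X powr (1 - 1 / p)"
    unfolding s A_def X_def F_def .
  have kk: "1 - (k / 2) / k = 1 / 2" using k0 by simp
  have q2: "(1 / 2) powr (- (q / p)) = 2 powr (q / p)"
    using inverse_powr_minus[of 2 "q / p"] by (simp add: inverse_eq_divide)
  have Z: "1 / (2 * 4 ^ ?n) \<le> frac y (4 * r) {x. k \<le> v x}"
  proof -
    have "1 / 2 \<le> (4 * r / r) ^ ?n * frac y (4 * r) {x. k \<le> v x}"
      by (rule order_trans[OF half frac_ball_mono]) (use r in auto)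
    then have "1 / 2 \<le> 4 ^ ?n * frac y (4 * r) {x. k \<le> v x}" using r by simp
    then show ?thesis by (simp add: divide_le_eq mult.assoc mult.commute)
  qed
  have F1: "\<nu> / 2 ^ ?n \<le> F"
  proof -
    have "\<nu> \<le> (8 * r / (4 * r)) ^ ?n * frac y (8 * r) {x. v x \<le> k}"
      by (rule order_trans[OF \<nu>(2) frac_ball_mono]) (use r k0 in auto)
    then have "\<nu> \<le> 2 ^ ?n * F" using r by (simp add: F_def)
    then show ?thesis by (simp add: divide_le_eq mult.commute)
  qed
  have F2: "F \<le> 1" unfolding F_def by (rule frac_le_1) simp
  have F0: "0 < F" using F1 \<nu> by (meson divide_pos_pos less_le_trans zero_less_numeral zero_less_power)
  have FF: "F powr ((1 - \<delta>) / p) \<le> (\<nu> / 2 ^ ?n) powr (- (\<delta> / p))"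
  proof -
    have "F powr ((1 - \<delta>) / p) = F powr (1 / p) * F powr (- (\<delta> / p))"
      by (simp add: diff_divide_distrib flip: powr_add)
    also have "\<dots> \<le> 1 * (\<nu> / 2 ^ ?n) powr (- (\<delta> / p))"
    proof (rule mult_mono)
      show "F powr (1 / p) \<le> 1" using F0 F2 p by (intro powr_le1) auto
      show "F powr (- (\<delta> / p)) \<le> (\<nu> / 2 ^ ?n) powr (- (\<delta> / p))"
        by (rule powr_mono2'[OF _ _ F1]) (use \<delta> p \<nu> in auto)
    qed auto
    finally show ?thesis by simp
  qed
  have "\<nu> powr (1 - \<alpha>) / (4 * 4 ^ ?n) = 1 / 2 * \<nu> powr (1 - \<alpha>) * (1 / (2 * 4 ^ ?n))" by simp
  also have "\<dots> \<le> 1 / 2 * frac y (4 * r) {x. v x \<le> k / 2} powr (1 - \<alpha>) * frac y (4 * r) {x. k \<le> v x}"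
    by (intro mult_mono powr_mono2 Z \<nu>(2)) (use \<nu> \<alpha> in auto)
  also have "\<dots> \<le> A * 2 powr (q / p) * M powr (1 / p) * F powr ((1 - \<delta>) / p) * X powr (1 - 1 / p)"
    using main unfolding kk q2 .
  also have "\<dots> \<le> A * 2 powr (q / p) * M powr (1 / p) * (\<nu> / 2 ^ ?n) powr (- (\<delta> / p)) * X powr (1 - 1 / p)"
    by (rule mult_right_mono[OF mult_left_mono[OF FF]]) (auto intro!: mult_nonneg_nonneg A)
  finally show ?thesis unfolding A_def X_def .
qed

text \<open>The layers are pairwise disjoint subsets of one ball.\<close>

lemma dyadic_layers_sum_le_1:
  fixes v :: "real^'n::finite \<Rightarrow> real"
  assumes [measurable]: "v \<in> borel_measurable borel" and k: "0 < k" and s: "0 < s" "s \<le> t"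
  shows "(\<Sum>j<J. measure lborel (ball y s \<inter> {x. k / 2 ^ j / 2 < v x \<and> v x < k / 2 ^ j}) / measure lborel (ball y t)) \<le> 1"
proof -
  define E where "E j = ball y s \<inter> {x. k / 2 ^ j / 2 < v x \<and> v x < k / 2 ^ j}" for j :: nat
  have fm: "E j \<in> fmeasurable lborel" for j unfolding E_def by (rule ball_Int_fmeasurable) simp
  have Em: "E j \<in> sets lborel" for j by (rule fmeasurableD[OF fm])
  have disj: "disjoint_family_on E {..<J}"
  proof -
    have "E i \<inter> E j = {}" if ij: "i < j" for i j
    proof -
      have "k / 2 ^ j \<le> k / 2 ^ Suc i"
        using k ij by (intro divide_left_mono power_increasing) auto
      then have "k / 2 ^ j \<le> k / 2 ^ i / 2" by simp
      then show ?thesis unfolding E_def by force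
    qed
    then show ?thesis unfolding disjoint_family_on_def by (metis Int_commute linorder_neqE_nat)
  qed
  have "(\<Sum>j<J. measure lborel (E j)) = measure lborel (\<Union>j<J. E j)"
    by (rule measure_finite_Union[symmetric]) (use disj Em fmeasurableD2[OF fm] in auto)
  also have "\<dots> = measure lborel (ball y s \<inter> (\<Union>j<J. E j))"
    by (rule arg_cong[where f = "measure lborel"]) (auto simp: E_def)
  also have "\<dots> \<le> measure lborel (ball y t \<inter> UNIV)"
    by (rule measure_ball_mono[OF subset_ball[OF s(2)]]) (use Em in auto)
  finally have le: "(\<Sum>j<J. measure lborel (E j)) \<le> measure lborel (ball y t)" by simp
  have m: "0 < measure lborel (ball y t)" using s by simp
  have "(\<Sum>j<J. measure lborel (E j) / measure lborel (ball y t)) = (\<Sum>j<J. measure lborel (E j)) / measure lborel (ball y t)"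
    by (simp only: sum_divide_distrib)
  also have "\<dots> \<le> 1" using le m by (simp only: divide_le_eq_1_pos)
  finally show ?thesis unfolding E_def .
qed

text \<open>If \<open>{v \<le> k/2\<^sup>J}\<close> were not small in \<open>B\<^bsub>4r\<^esub>\<close>,
  each of the \<open>J\<close> dyadic layers above it would occupy at least a fraction of order
  \<open>M\<^bsup>-b\<^esup>\<close>, which is impossible for \<open>J\<close> larger than a
  multiple of \<open>M\<^sup>b\<close>. Smallness is then converted by
  \<open>measure_to_pointwise\<close>. The hypothesis \<open>\<rho> \<le> k /
  2\<^bsup>J+1\<^esup>\<close> keeps all levels above the radii.\<close>

lemma expansion_of_positivity:
  fixes p q c \<delta> \<alpha> :: real
  assumes p: "1 < p" and c: "0 < c" and q: "0 \<le> q" and \<delta>: "0 \<le> \<delta>"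
    and \<alpha>: "\<delta> / p < \<alpha>" "CARD('n::finite) * \<alpha> < 1"
  shows "\<exists>C b. 1 \<le> C \<and> 0 \<le> b \<and>
    (\<forall>\<Omega> \<Lambda> (v :: real^'n \<Rightarrow> real) \<rho> K M y r k J.
      admissible p q c \<delta> \<Omega> \<Lambda> v \<rho> K M \<longrightarrow> 0 < r \<longrightarrow> 8 * r \<le> \<rho> \<longrightarrow> ball y (64 * r) \<subseteq> \<Omega> \<longrightarrow>
      k \<le> r / \<rho> * K \<longrightarrow> 1 / 2 \<le> frac y r {x. k \<le> v x} \<longrightarrow> C * M powr b \<le> real J \<longrightarrow>
      \<rho> \<le> k / 2 ^ (J + 1) \<longrightarrow> (AE x in lborel. x \<in> ball y (2 * r) \<longrightarrow> k / 2 ^ (J + 1) \<le> v x))"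
proof -
  let ?n = "CARD('n)"
  obtain \<nu>0 b0 where \<nu>0: "0 < \<nu>0" "\<nu>0 \<le> 1" and b0: "0 \<le> b0"
    and L1: "\<forall>\<Omega> \<Lambda> (v :: real^'n \<Rightarrow> real) \<rho> K M y r k.
      admissible p q c \<delta> \<Omega> \<Lambda> v \<rho> K M \<longrightarrow> 0 < r \<longrightarrow> r \<le> \<rho> \<longrightarrow> ball y (8 * r) \<subseteq> \<Omega> \<longrightarrow>
      r \<le> k \<longrightarrow> k \<le> r / \<rho> * K \<longrightarrow> frac y r {x. v x \<le> k} \<le> \<nu>0 * M powr (- b0) \<longrightarrow>
      (AE x in lborel. x \<in> ball y (r / 2) \<longrightarrow> k / 2 \<le> v x)"
    using measure_to_pointwise[OF p c q \<delta> \<alpha>] by (elim exE conjE) (rule that)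
  have \<alpha>0: "0 \<le> \<alpha>" and \<alpha>1: "\<alpha> < 1"
    using exponent_bounds[OF p \<delta> \<alpha>] by simp_all
  define A where "A = 2 ^ (2 * ?n + 1) / (1 - ?n * \<alpha>) * c powr (1 / p)"
  have A: "0 < A" using \<alpha> c by (simp add: A_def)
  define p' where "p' = p / (p - 1)"
  have p': "0 < p'" "(1 - 1 / p) * p' = 1"
  proof -
    show "0 < p'" using p by (simp add: p'_def)
    have "1 - 1 / p = (p - 1) / p" using p by (simp add: diff_divide_distrib)
    then show "(1 - 1 / p) * p' = 1" using p by (simp add: p'_def)
  qed
  define e1 where "e1 = 1 / p + b0 * (1 - \<alpha>) + b0 * (\<delta> / p)"
  have e1: "0 \<le> e1" unfolding e1_def using p b0 \<alpha>1 \<delta> by simp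
  define D where "D = A * 2 powr (q / p) * (\<nu>0 / 2 ^ ?n) powr (- (\<delta> / p))"
  have D: "0 < D" unfolding D_def using A \<nu>0 by simp
  \<comment> \<open>\<open>t0 M\<^bsup>-e1\<^esup>\<close> is the lower bound for
    \<open>X\<^bsup>1-1/p\<^esup>\<close> given by \<open>level_sets_energy_lower_bound\<close>,
    hence \<open>t1 M\<^bsup>-b\<^esup>\<close> the one for the layer \<open>X\<close>
    itself.\<close>
  define t0 where "t0 = \<nu>0 powr (1 - \<alpha>) / (4 * 4 ^ ?n) / D"
  have t0: "0 < t0" unfolding t0_def using \<nu>0 D by simp
  define t1 where "t1 = t0 powr p'"
  have t1: "0 < t1" using t0 by (simp add: t1_def)
  define b where "b = e1 * p'"
  have b: "0 \<le> b" unfolding b_def using e1 p' by simp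
  define C where "C = 1 / t1 + 1"
  have C: "1 \<le> C" unfolding C_def using t1 by simp
  have concl: "AE x in lborel. x \<in> ball y (2 * r) \<longrightarrow> k / 2 ^ (J + 1) \<le> v x"
    if adm: "admissible p q c \<delta> \<Omega> \<Lambda> v \<rho> K M" and r: "0 < r" "8 * r \<le> \<rho>" "ball y (64 * r) \<subseteq> \<Omega>"
      and k: "k \<le> r / \<rho> * K" and half: "1 / 2 \<le> frac y r {x. k \<le> v x}"
      and J: "C * M powr b \<le> real J" and big: "\<rho> \<le> k / 2 ^ (J + 1)"
    for \<Omega> \<Lambda> and v :: "real^'n \<Rightarrow> real" and \<rho> K M y r k J
  proof -
    note ad = admissibleD[OF adm]
    note [measurable] = ad(5)
    have M: "1 \<le> M" by (rule ad(3))
    have k0: "0 < k"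
    proof -
      have "0 < k / 2 ^ (J + 1)" using big ad(2) by linarith
      then show ?thesis by (simp add: zero_less_divide_iff)
    qed
    define \<nu> where "\<nu> = \<nu>0 * M powr (- b0)"
    have \<nu>: "0 < \<nu>" using \<nu>0 M by (simp add: \<nu>_def)
    have kj: "k / 2 ^ J \<le> k / 2 ^ j" "k / 2 ^ j \<le> k" if "j \<le> J" for j
    proof -
      show "k / 2 ^ J \<le> k / 2 ^ j"
        using k0 that by (intro divide_left_mono power_increasing) auto
      have "k / 2 ^ j \<le> k / 1" using k0 by (intro divide_left_mono) auto
      then show "k / 2 ^ j \<le> k" by simp
    qed
    have kJ: "8 * r \<le> k / 2 ^ J"
    proof -
      have "k / 2 ^ (J + 1) \<le> k / 2 ^ J" using k0 by (intro divide_left_mono) auto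
      then show ?thesis using big r by linarith
    qed
    have small: "frac y (4 * r) {x. v x \<le> k / 2 ^ J} \<le> \<nu>"
    proof (rule ccontr)
      assume "\<not> ?thesis"
      then have large: "\<nu> < frac y (4 * r) {x. v x \<le> k / 2 ^ J}" by simp
      define X where "X j = measure lborel (ball y (4 * r) \<inter> {x. k / 2 ^ j / 2 < v x \<and> v x < k / 2 ^ j}) /
          measure lborel (ball y (8 * r))" for j :: nat
      have X0: "0 \<le> X j" for j by (simp add: X_def)
      have Xlow: "t1 * M powr (- b) \<le> X j" if j: "j < J" for j
      proof -
        have "\<nu> powr (1 - \<alpha>) / (4 * 4 ^ ?n) \<le>
          2 ^ (2 * ?n + 1) / (1 - ?n * \<alpha>) * c powr (1 / p) * 2 powr (q / p) * M powr (1 / p) *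
          (\<nu> / 2 ^ ?n) powr (- (\<delta> / p)) * X j powr (1 - 1 / p)"
          unfolding X_def
        proof (rule level_sets_energy_lower_bound[OF adm p c \<delta> \<alpha>0 \<alpha>1 \<alpha>(2) r _ _ _ \<nu>])
          show "8 * r \<le> k / 2 ^ j" using kJ kj(1)[of j] j by linarith
          show "k / 2 ^ j \<le> r / \<rho> * K" using k kj(2)[of j] j by linarith
          show "1 / 2 \<le> frac y r {x. k / 2 ^ j \<le> v x}"
          proof (rule order_trans[OF half frac_mono])
            show "{x. k \<le> v x} \<subseteq> {x. k / 2 ^ j \<le> v x}" using kj(2)[of j] j by auto
          qed auto
          have "k / 2 ^ J \<le> k / 2 ^ Suc j" using kj(1)[of "Suc j"] j by simp
          then have "k / 2 ^ J \<le> k / 2 ^ j / 2" by simp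
          then have "frac y (4 * r) {x. v x \<le> k / 2 ^ J} \<le> frac y (4 * r) {x. v x \<le> k / 2 ^ j / 2}"
            by (intro frac_mono) auto
          then show "\<nu> \<le> frac y (4 * r) {x. v x \<le> k / 2 ^ j / 2}" using large by linarith
        qed
        moreover have "\<nu> powr (1 - \<alpha>) = \<nu>0 powr (1 - \<alpha>) * M powr (- (b0 * (1 - \<alpha>)))"
          unfolding \<nu>_def using \<nu>0 M by (simp add: powr_mult powr_powr)
        moreover have "(\<nu> / 2 ^ ?n) powr (- (\<delta> / p)) = (\<nu>0 / 2 ^ ?n) powr (- (\<delta> / p)) * M powr (b0 * (\<delta> / p))"
        proof -
          have eq: "\<nu> / 2 ^ ?n = (\<nu>0 / 2 ^ ?n) * M powr (- b0)" by (simp add: \<nu>_def)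
          show ?thesis unfolding eq powr_mult[of "\<nu>0 / 2 ^ ?n"] powr_powr by simp
        qed
        ultimately have ineq: "\<nu>0 powr (1 - \<alpha>) * M powr (- (b0 * (1 - \<alpha>))) / (4 * 4 ^ ?n) \<le>
            A * 2 powr (q / p) * M powr (1 / p) *
            ((\<nu>0 / 2 ^ ?n) powr (- (\<delta> / p)) * M powr (b0 * (\<delta> / p))) * X j powr (1 - 1 / p)"
          by (simp only: A_def)
        have "D * t0 * M powr (- (b0 * (1 - \<alpha>))) \<le> D * (M powr (1 / p) * M powr (b0 * (\<delta> / p))) * X j powr (1 - 1 / p)"
        proof -
          have "D * t0 = \<nu>0 powr (1 - \<alpha>) / (4 * 4 ^ ?n)" using D by (simp add: t0_def)
          then have "D * t0 * M powr (- (b0 * (1 - \<alpha>))) = \<nu>0 powr (1 - \<alpha>) * M powr (- (b0 * (1 - \<alpha>))) / (4 * 4 ^ ?n)"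
            by simp
          also note ineq
          also have "A * 2 powr (q / p) * M powr (1 / p) *
            ((\<nu>0 / 2 ^ ?n) powr (- (\<delta> / p)) * M powr (b0 * (\<delta> / p))) * X j powr (1 - 1 / p)
            = D * (M powr (1 / p) * M powr (b0 * (\<delta> / p))) * X j powr (1 - 1 / p)"
            unfolding D_def by (simp only: mult_ac)
          finally show ?thesis .
        qed
        then have "D * (t0 * M powr (- (b0 * (1 - \<alpha>)))) \<le> D * ((M powr (1 / p) * M powr (b0 * (\<delta> / p))) * X j powr (1 - 1 / p))"
          by (simp only: mult.assoc)
        then have "t0 * M powr (- (b0 * (1 - \<alpha>))) \<le> (M powr (1 / p) * M powr (b0 * (\<delta> / p))) * X j powr (1 - 1 / p)"
          by (rule mult_left_le_imp_le[OF _ D])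
        also have "M powr (1 / p) * M powr (b0 * (\<delta> / p)) = M powr (1 / p + b0 * (\<delta> / p))"
          by (simp only: powr_add)
        finally have "t0 * M powr (- (b0 * (1 - \<alpha>))) * M powr (- (1 / p + b0 * (\<delta> / p))) \<le>
            M powr (1 / p + b0 * (\<delta> / p)) * X j powr (1 - 1 / p) * M powr (- (1 / p + b0 * (\<delta> / p)))"
          by (rule mult_right_mono) simp
        also have "\<dots> = (M powr (1 / p + b0 * (\<delta> / p)) * M powr (- (1 / p + b0 * (\<delta> / p)))) * X j powr (1 - 1 / p)"
          by (simp only: mult_ac)
        also have "M powr (1 / p + b0 * (\<delta> / p)) * M powr (- (1 / p + b0 * (\<delta> / p))) = 1"
          using M by (simp flip: powr_add)
        also have "t0 * M powr (- (b0 * (1 - \<alpha>))) * M powr (- (1 / p + b0 * (\<delta> / p))) = t0 * M powr (- e1)"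
          unfolding mult.assoc powr_add[symmetric] e1_def by (simp add: algebra_simps)
        finally have low: "t0 * M powr (- e1) \<le> X j powr (1 - 1 / p)" by simp
        have "t1 * M powr (- b) = (t0 * M powr (- e1)) powr p'"
          unfolding t1_def b_def using t0 M by (simp add: powr_mult powr_powr)
        also have "\<dots> \<le> (X j powr (1 - 1 / p)) powr p'"
          by (rule powr_mono2[OF _ _ low]) (use p' t0 in auto)
        also have "\<dots> = X j"
          using X0[of j] by (simp add: powr_powr p'(2))
        finally show ?thesis .
      qed
      have "real J * (t1 * M powr (- b)) = (\<Sum>j<J. t1 * M powr (- b))" by simp
      also have "\<dots> \<le> (\<Sum>j<J. X j)" by (rule sum_mono) (use Xlow in auto)
      also have "\<dots> \<le> 1"
        unfolding X_def by (rule dyadic_layers_sum_le_1) (use k0 r in auto)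
      finally have "real J * (t1 * M powr (- b)) \<le> 1" .
      moreover have "C * M powr b * (t1 * M powr (- b)) \<le> real J * (t1 * M powr (- b))"
        by (rule mult_right_mono[OF J]) (use t1 in simp)
      moreover have "C * M powr b * (t1 * M powr (- b)) = C * t1 * (M powr b * M powr (- b))"
        by (simp only: mult_ac)
      moreover have "C * t1 * (M powr b * M powr (- b)) = 1 + t1"
      proof -
        have "M powr b * M powr (- b) = 1" using M by (simp flip: powr_add)
        moreover have "C * t1 = 1 + t1" unfolding C_def using t1 by (simp add: distrib_right)
        ultimately show ?thesis by simp
      qed
      ultimately show False using t1 by linarith
    qed
    have "AE x in lborel. x \<in> ball y (4 * r / 2) \<longrightarrow> (k / 2 ^ J) / 2 \<le> v x"
    proof (rule L1[rule_format, OF adm])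
      show "0 < 4 * r" "4 * r \<le> \<rho>" using r by auto
      have "ball y (8 * (4 * r)) \<subseteq> ball y (64 * r)" using r by (intro subset_ball) simp
      then show "ball y (8 * (4 * r)) \<subseteq> \<Omega>" using r(3) by blast
      show "4 * r \<le> k / 2 ^ J" using kJ r by linarith
      have "r / \<rho> * K \<le> 4 * r / \<rho> * K"
        using r ad(2,4) by (intro mult_right_mono divide_right_mono) auto
      then show "k / 2 ^ J \<le> 4 * r / \<rho> * K" using k kj(2)[of J] by linarith
      show "frac y (4 * r) {x. v x \<le> k / 2 ^ J} \<le> \<nu>0 * M powr - b0" using small by (simp add: \<nu>_def)
    qed
    then show ?thesis by (simp add: mult.commute)
  qed
  show ?thesis
    by (rule exI[of _ C], rule exI[of _ b], intro conjI allI impI, rule C, rule b, rule concl)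
qed

section \<open>Local clustering\<close>

text \<open>Averaging over the centres of balls of a fixed radius replaces covering arguments below.\<close>

lemma nn_integral_ball_average:
  fixes k :: "real^'n::finite \<Rightarrow> ennreal"
  assumes [measurable]: "k \<in> borel_measurable borel"
  shows "(\<integral>\<^sup>+y. \<integral>\<^sup>+x. indicator (ball y s) x * k x \<partial>lborel \<partial>lborel)
    = emeasure lborel (ball (0::real^'n) s) * (\<integral>\<^sup>+x. k x \<partial>lborel)"
proof -
  have ind: "indicator (ball y s) x * k x = (if dist y x < s then k x else 0)" for x y
    by (simp add: indicator_def)
  have m: "(\<lambda>(y, x). if dist y x < s then k x else 0) \<in> borel_measurable (lborel \<Otimes>\<^sub>M lborel)"
    by measurable
  have e: "emeasure lborel (ball x s) = emeasure lborel (ball (0::real^'n) s)" for x :: "real^'n"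
  proof (cases "0 \<le> s")
    case True
    then show ?thesis by (simp only: emeasure_ball)
  next
    case False
    then have "ball x s = {}" "ball (0::real^'n) s = {}" by (simp_all add: ball_empty)
    then show ?thesis by (simp only:)
  qed
  have "(\<integral>\<^sup>+y. \<integral>\<^sup>+x. (if dist y x < s then k x else 0) \<partial>lborel \<partial>lborel)
      = (\<integral>\<^sup>+x. \<integral>\<^sup>+y. (if dist y x < s then k x else 0) \<partial>lborel \<partial>lborel)"
    by (rule lborel_pair.Fubini'[OF m, symmetric])
  also have "\<dots> = (\<integral>\<^sup>+x. emeasure lborel (ball (0::real^'n) s) * k x \<partial>lborel)"
  proof (rule nn_integral_cong)
    fix x :: "real^'n"
    have "(\<integral>\<^sup>+y. (if dist y x < s then k x else 0) \<partial>lborel) = (\<integral>\<^sup>+y. k x * indicator (ball x s) y \<partial>lborel)"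
      by (rule nn_integral_cong) (simp add: indicator_def dist_commute)
    also have "\<dots> = k x * emeasure lborel (ball x s)" by (rule nn_integral_cmult_indicator) simp
    also have "\<dots> = emeasure lborel (ball (0::real^'n) s) * k x"
      unfolding e[of x] by (rule mult.commute)
    finally show "(\<integral>\<^sup>+y. (if dist y x < s then k x else 0) \<partial>lborel) = emeasure lborel (ball (0::real^'n) s) * k x" .
  qed
  also have "\<dots> = emeasure lborel (ball (0::real^'n) s) * (\<integral>\<^sup>+x. k x \<partial>lborel)"
    by (rule nn_integral_cmult) simp
  finally show ?thesis unfolding ind .
qed

lemma measure_le_by_ball_average:
  fixes k :: "real^'n::finite \<Rightarrow> real" and S :: "(real^'n) set"
  assumes S: "S \<in> sets borel" "emeasure lborel S < \<infinity>" and s: "0 < s"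
    and k: "integrable lborel k" "\<And>x. 0 \<le> k x"
    and le: "\<And>y. measure lborel (ball y s \<inter> S) \<le> (\<integral>x. indicator (ball y s) x * k x \<partial>lborel)"
  shows "measure lborel S \<le> (\<integral>x. k x \<partial>lborel)"
proof -
  note [measurable] = S(1)
  have [measurable]: "k \<in> borel_measurable borel" using k by auto
  define V where "V = emeasure lborel (ball (0::real^'n) s)"
  have V: "V = ennreal (measure lborel (ball (0::real^'n) s))"
    unfolding V_def by (rule emeasure_eq_ennreal_measure) (use emeasure_lborel_ball_finite[of "0::real^'n" s] in auto)
  have V0: "0 < measure lborel (ball (0::real^'n) s)" using s by simp
  have "V * emeasure lborel S = V * (\<integral>\<^sup>+x. indicator S x \<partial>lborel)" by simp
  also have "\<dots> = (\<integral>\<^sup>+y. \<integral>\<^sup>+x. indicator (ball y s) x * indicator S x \<partial>lborel \<partial>lborel)"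
    unfolding V_def by (rule nn_integral_ball_average[symmetric]) simp
  also have "\<dots> \<le> (\<integral>\<^sup>+y. \<integral>\<^sup>+x. indicator (ball y s) x * ennreal (k x) \<partial>lborel \<partial>lborel)"
  proof (rule nn_integral_mono)
    fix y :: "real^'n"
    have i: "integrable lborel (\<lambda>x. indicator (ball y s) x * k x)"
      by (rule Bochner_Integration.integrable_bound[OF k(1)]) (use k in \<open>auto split: split_indicator simp del: mem_ball\<close>)
    have "(\<integral>\<^sup>+x. indicator (ball y s) x * indicator S x \<partial>lborel) = (\<integral>\<^sup>+x. indicator (ball y s \<inter> S) x \<partial>lborel)"
      by (rule nn_integral_cong) (simp add: indicator_inter_arith)
    also have "\<dots> = emeasure lborel (ball y s \<inter> S)" by simp
    also have "\<dots> = ennreal (measure lborel (ball y s \<inter> S))"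
      using fmeasurableD2[OF ball_Int_fmeasurable[OF S(1)]] by (rule emeasure_eq_ennreal_measure)
    also have "\<dots> \<le> ennreal (\<integral>x. indicator (ball y s) x * k x \<partial>lborel)"
      by (rule ennreal_leI[OF le])
    also have "\<dots> = (\<integral>\<^sup>+x. ennreal (indicator (ball y s) x * k x) \<partial>lborel)"
      by (rule nn_integral_eq_integral[OF i, symmetric]) (use k in auto)
    also have "\<dots> = (\<integral>\<^sup>+x. indicator (ball y s) x * ennreal (k x) \<partial>lborel)"
      by (rule nn_integral_cong) (auto split: split_indicator simp del: mem_ball)
    finally show "(\<integral>\<^sup>+x. indicator (ball y s) x * indicator S x \<partial>lborel) \<le>
        (\<integral>\<^sup>+x. indicator (ball y s) x * ennreal (k x) \<partial>lborel)" .
  qed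
  also have "\<dots> = V * (\<integral>\<^sup>+x. ennreal (k x) \<partial>lborel)"
    unfolding V_def by (rule nn_integral_ball_average) simp
  also have "(\<integral>\<^sup>+x. ennreal (k x) \<partial>lborel) = ennreal (\<integral>x. k x \<partial>lborel)"
    by (rule nn_integral_eq_integral[OF k(1)]) (use k in auto)
  also have "emeasure lborel S = ennreal (measure lborel S)"
    by (rule emeasure_eq_ennreal_measure) (use S in auto)
  finally have "ennreal (measure lborel (ball (0::real^'n) s) * measure lborel S)
      \<le> ennreal (measure lborel (ball (0::real^'n) s) * (\<integral>x. k x \<partial>lborel))"
    unfolding V using integral_nonneg_AE[of k lborel] k V0 by (simp add: ennreal_mult)
  then have "measure lborel (ball (0::real^'n) s) * measure lborel S
      \<le> measure lborel (ball (0::real^'n) s) * (\<integral>x. k x \<partial>lborel)"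
    by (rule ennreal_le_iff[THEN iffD1, rotated])
      (intro mult_nonneg_nonneg measure_nonneg integral_nonneg_AE AE_I2 k)
  then show ?thesis by (rule mult_left_le_imp_le[OF _ V0])
qed

text \<open>By averaging over the centres: if all balls of radius \<open>s\<close> contained too little of
  \<open>S\<close>, integrating over their centres would give less than half of
  \<open>|S|\<close>.\<close>

lemma ex_ball_with_large_frac:
  fixes x0 :: "real^'n::finite" and S :: "(real^'n) set"
  assumes S: "S \<in> sets borel" "S \<subseteq> ball x0 \<rho>" and s: "0 < s" "s \<le> \<rho>"
  shows "\<exists>z\<in>ball x0 (2 * \<rho>). measure lborel S / (2 * measure lborel (ball x0 (2 * \<rho>))) \<le> frac z s S"
proof (rule ccontr)
  assume "\<not> ?thesis"
  then have neg: "frac z s S < measure lborel S / (2 * measure lborel (ball x0 (2 * \<rho>)))"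
    if "z \<in> ball x0 (2 * \<rho>)" for z using that by force
  define V where "V = measure lborel (ball x0 (2 * \<rho>))"
  define t where "t = measure lborel S / (2 * V)"
  have \<rho>: "0 < \<rho>" using s by simp
  have V: "0 < V" using \<rho> by (simp add: V_def)
  have t0: "0 \<le> t" using V by (simp add: t_def)
  have x0: "x0 \<in> ball x0 (2 * \<rho>)" using \<rho> by simp
  have t: "0 < t" using neg[OF x0] frac_nonneg[of x0 s S] by (simp add: t_def V_def)
  have Sfin: "emeasure lborel S < \<infinity>"
    using emeasure_mono[OF S(2), of lborel] emeasure_lborel_ball_finite[of x0 \<rho>] by (auto intro: le_less_trans)
  let ?B = "ball x0 (2 * \<rho>)"
  define W where "W = measure lborel (ball (0::real^'n) s)"
  have W: "0 < W" using s by (simp add: W_def)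
  have Wy: "measure lborel (ball y s) = W" for y :: "real^'n"
    using content_ball_scale[of s y] content_ball_scale[of s "0::real^'n"] s by (simp add: W_def)
  have pt: "emeasure lborel (ball y s \<inter> S) \<le> ennreal (t * W) * indicator ?B y" for y
  proof (cases "y \<in> ?B")
    case True
    have "measure lborel (ball y s \<inter> S) = frac y s S * W"
      unfolding frac_def Wy using W by simp
    also have "\<dots> \<le> t * W"
      using neg[OF True] W by (intro mult_right_mono) (auto simp: t_def V_def)
    finally have "ennreal (measure lborel (ball y s \<inter> S)) \<le> ennreal (t * W)" by (rule ennreal_leI)
    moreover have "emeasure lborel (ball y s \<inter> S) = ennreal (measure lborel (ball y s \<inter> S))"
      using fmeasurableD2[OF ball_Int_fmeasurable[OF S(1)]] by (rule emeasure_eq_ennreal_measure)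
    ultimately show ?thesis using True by simp
  next
    case False
    have "ball y s \<inter> S = {}"
    proof (rule ccontr)
      assume "ball y s \<inter> S \<noteq> {}"
      then obtain x where "x \<in> ball y s" "x \<in> ball x0 \<rho>" using S(2) by blast
      then have "dist x0 y < 2 * \<rho>"
        using dist_triangle[of x0 y x] s by (simp add: dist_commute)
      then show False using False by simp
    qed
    then show ?thesis by simp
  qed
  have "ennreal W * emeasure lborel S = emeasure lborel (ball (0::real^'n) s) * (\<integral>\<^sup>+x. indicator S x \<partial>lborel)"
    using S emeasure_lborel_ball_finite[of "0::real^'n" s] by (simp add: W_def emeasure_eq_ennreal_measure)
  also have "\<dots> = (\<integral>\<^sup>+y. \<integral>\<^sup>+x. indicator (ball y s) x * indicator S x \<partial>lborel \<partial>lborel)"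
    by (rule nn_integral_ball_average[symmetric]) (use S in simp)
  also have "\<dots> = (\<integral>\<^sup>+y. emeasure lborel (ball y s \<inter> S) \<partial>lborel)"
  proof (rule nn_integral_cong)
    fix y :: "real^'n"
    have "(\<integral>\<^sup>+x. indicator (ball y s) x * indicator S x \<partial>lborel) = (\<integral>\<^sup>+x. indicator (ball y s \<inter> S) x \<partial>lborel)"
      by (rule nn_integral_cong) (simp add: indicator_inter_arith)
    then show "(\<integral>\<^sup>+x. indicator (ball y s) x * indicator S x \<partial>lborel) = emeasure lborel (ball y s \<inter> S)"
      using S by simp
  qed
  also have "\<dots> \<le> (\<integral>\<^sup>+y. ennreal (t * W) * indicator ?B y \<partial>lborel)"
    by (rule nn_integral_mono) (rule pt)
  also have "\<dots> = ennreal (t * W) * emeasure lborel ?B"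
    by (rule nn_integral_cmult_indicator) simp
  finally have "ennreal (W * measure lborel S) \<le> ennreal (t * W * V)"
    using W t0 V Sfin emeasure_lborel_ball_finite[of x0 "2 * \<rho>"]
    by (simp add: V_def emeasure_eq_ennreal_measure ennreal_mult)
  then have "W * measure lborel S \<le> t * W * V"
    by (rule ennreal_le_iff[THEN iffD1, rotated]) (use W t0 V in simp)
  also have "t * W * V = W * (measure lborel S / 2)" using V by (simp add: t_def)
  finally have "measure lborel S \<le> measure lborel S / 2" by (rule mult_left_le_imp_le[OF _ W])
  moreover have "0 < measure lborel S" using t V by (simp add: t_def zero_less_divide_iff)
  ultimately show False by linarith
qed

text \<open>If \<open>{v \<ge> k/2}\<close> fills less than half of each ball of radius \<open>r\<close>,
  the layer estimate bounds the measure of \<open>{v \<ge> k}\<close> in such a ball by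
  \<open>r/k\<close> times the integral of the gradient over it. Averaging over the centres gives
  the same bound in the large ball, where the energy bound makes it proportional to
  \<open>r/R\<close>.\<close>

lemma no_cluster_imp_small_frac:
  fixes v :: "real^'n::finite \<Rightarrow> real" and \<alpha> :: real
  assumes adm: "admissible p q c \<delta> \<Omega> \<Lambda> v \<rho> K M"
    and p: "1 < p" and c: "0 < c" and \<delta>: "0 \<le> \<delta>" "\<delta> / p < 1" and \<alpha>: "0 \<le> \<alpha>" "\<alpha> < 1" "CARD('n) * \<alpha> < 1"
    and R: "0 < R" "R \<le> \<rho>" "ball z (8 * R) \<subseteq> \<Omega>" and k: "R \<le> k" "k \<le> R / \<rho> * K"
    and r: "0 < r" "r \<le> R / 8"
    and no: "\<And>y. y \<in> ball z (R / 4) \<Longrightarrow> frac y r {x. k / 2 \<le> v x} < 1 / 2"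
  shows "frac z (R / 8) {x. k \<le> v x} \<le>
    4 * (2 ^ (CARD('n) + 1) / (1 - CARD('n) * \<alpha>)) * c powr (1 / p) * 2 powr (q / p) * 8 ^ CARD('n) *
    M powr (1 / p) * (r / R)"
proof -
  let ?n = "CARD('n)"
  note ad = admissibleD[OF adm]
  note [measurable] = ad(5)
  have k0: "0 < k" using R k by simp
  obtain g where "level_gradient p \<Lambda> \<Omega> c q \<delta> v k g"
    using ad(1) k0 unfolding DG_borel_def by blast
  note lg = this[unfolded level_gradient_def]
  have gm[measurable]: "g \<in> borel_measurable borel" using lg by (rule conjunct1)
  have g0: "0 \<le> g x" for x using lg[THEN conjunct2, THEN conjunct1] by simp
  note P = lg[THEN conjunct2, THEN conjunct2, THEN conjunct1, rule_format]
    and E = lg[THEN conjunct2, THEN conjunct2, THEN conjunct2, rule_format]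
  define CP where "CP = 2 ^ (?n + 1) / (1 - ?n * \<alpha>)"
  have CP: "0 < CP" using \<alpha> by (simp add: CP_def)
  define D where "D = ball z (R * (1 - 1 / 2)) \<inter> {x. k / 2 < v x \<and> v x < k}"
  have Dm[measurable]: "D \<in> sets borel" unfolding D_def by simp
  have Db: "D \<subseteq> ball z (R * (1 - 1 / 2))" unfolding D_def by simp
  define I where "I = (\<integral>x. indicator D x * g x \<partial>lborel)"
  define m where "m = measure lborel (ball z R)"
  have m0: "0 < m" using R by (simp add: m_def)
  have L: "\<Lambda> z R k \<le> M" by (rule ad(6)[OF R k])
  have h: "(0::real) < 1 / 2" "(1 / 2 :: real) < 1" by simp_all
  have EE: "integrable lborel (\<lambda>x. indicator (ball z (R * (1 - 1 / 2))) x * g x powr p) \<and>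
        (\<integral>x. indicator (ball z (R * (1 - 1 / 2))) x * g x powr p \<partial>lborel) \<le>
          measure lborel (ball z (R * (1 - 1 / 2))) *
          (c / (1 / 2) powr q * \<Lambda> z R k * (k / R) powr p * frac z R {x. v x \<le> k} powr (1 - \<delta>))"
    by (rule E) (use R in simp)
  have M0: "0 \<le> M" using ad(3) by simp
  note eb = energy_bound_L1[OF ad(5) gm g0 p c k0 R(1) h conjunct1[OF EE] conjunct2[OF EE] L M0 Dm Db]
  define F where "F = frac z R {x. v x \<le> k}"
  have F: "0 \<le> F" "F \<le> 1" unfolding F_def by (rule frac_nonneg, rule frac_le_1) simp
  have DF: "measure lborel D / m \<le> F"
  proof -
    have "measure lborel (ball z (R * (1 - 1 / 2)) \<inter> {x. k / 2 < v x \<and> v x < k}) \<le> measure lborel (ball z R \<inter> {x. v x \<le> k})"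
      by (rule measure_ball_mono[OF subset_ball]) (use R in auto)
    then show ?thesis unfolding F_def frac_def D_def m_def by (rule divide_right_mono) simp
  qed
  have q2: "(1 / 2) powr (- (q / p)) = 2 powr (q / p)"
    using inverse_powr_minus[of 2 "q / p"] by (simp add: inverse_eq_divide)
  have "I / m \<le> c powr (1 / p) * 2 powr (q / p) * M powr (1 / p) * (k / R) * F powr ((1 - \<delta>) / p) *
      (measure lborel D / m) powr (1 - 1 / p)"
    using eb(2) unfolding q2 I_def m_def F_def .
  also have "\<dots> \<le> c powr (1 / p) * 2 powr (q / p) * M powr (1 / p) * (k / R) * F powr ((1 - \<delta>) / p) * F powr (1 - 1 / p)"
    by (intro mult_left_mono powr_mono2 DF mult_nonneg_nonneg) (use p k0 R m0 in auto)
  also have "\<dots> = c powr (1 / p) * 2 powr (q / p) * M powr (1 / p) * (k / R) * F powr (1 - \<delta> / p)"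
  proof -
    have "(1 - \<delta>) / p + (1 - 1 / p) = 1 - \<delta> / p" by (simp add: diff_divide_distrib)
    then have "F powr ((1 - \<delta>) / p) * F powr (1 - 1 / p) = F powr (1 - \<delta> / p)"
      by (metis powr_add)
    then show ?thesis by (simp only: mult.assoc)
  qed
  also have "\<dots> \<le> c powr (1 / p) * 2 powr (q / p) * M powr (1 / p) * (k / R) * 1"
    by (intro mult_left_mono powr_le1 F mult_nonneg_nonneg) (use \<delta> k0 R F in auto)
  finally have Im: "I \<le> c powr (1 / p) * 2 powr (q / p) * M powr (1 / p) * (k / R) * m"
    using m0 by (simp add: pos_divide_le_eq)
  let ?S = "ball z (R / 8) \<inter> {x. k \<le> v x}"
  have Sm: "?S \<in> sets borel" by simp
  have "measure lborel ?S \<le> (\<integral>x. 4 * CP * r / k * (indicator D x * g x) \<partial>lborel)"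
  proof (rule measure_le_by_ball_average[OF Sm _ r(1)])
    show "emeasure lborel ?S < \<infinity>"
      using fmeasurableD2[OF ball_Int_fmeasurable, of "{x. k \<le> v x}" z "R / 8"] by (simp add: less_top)
    show "integrable lborel (\<lambda>x. 4 * CP * r / k * (indicator D x * g x))" using eb(1) by simp
    show "0 \<le> 4 * CP * r / k * (indicator D x * g x)" for x using CP r k0 g0 by simp
    fix y
    show "measure lborel (ball y r \<inter> ?S) \<le> (\<integral>x. indicator (ball y r) x * (4 * CP * r / k * (indicator D x * g x)) \<partial>lborel)"
    proof (cases "y \<in> ball z (R / 4)")
      case False
      have "ball y r \<inter> ?S = {}"
      proof (rule ccontr)
        assume "ball y r \<inter> ?S \<noteq> {}"
        then obtain x where "x \<in> ball y r" "x \<in> ball z (R / 8)" by blast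
        then have "dist z y < R / 4"
          using dist_triangle[of z y x] r by (simp add: dist_commute)
        then show False using False by simp
      qed
      moreover have "0 \<le> (\<integral>x. indicator (ball y r) x * (4 * CP * r / k * (indicator D x * g x)) \<partial>lborel)"
        using CP r k0 g0 by (intro integral_nonneg_AE AE_I2) simp
      ultimately show ?thesis by simp
    next
      case True
      have my: "0 < measure lborel (ball y r)" using r by simp
      have sub: "ball y r \<subseteq> ball z (R * (1 - 1 / 2))"
      proof
        fix x assume "x \<in> ball y r"
        then show "x \<in> ball z (R * (1 - 1 / 2))"
          using dist_triangle[of z x y] True r by (simp add: dist_commute)
      qed
      have cb: "cball y r \<subseteq> \<Omega>"
      proof
        fix x assume "x \<in> cball y r"
        then have "x \<in> ball z (8 * R)"
          using dist_triangle[of z x y] True r R by (simp add: dist_commute)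
        then show "x \<in> \<Omega>" using R(3) by blast
      qed
      define Iy where "Iy = (\<integral>x. indicator (ball y r \<inter> {x. k / 2 < v x \<and> v x < k}) x * g x \<partial>lborel)"
      define a where "a = frac y r {x. k \<le> v x}"
      have a0: "0 \<le> a" by (simp add: a_def frac_nonneg)
      have "(k - k / 2) * frac y r {x. v x \<le> k / 2} powr (1 - \<alpha>) * a \<le> CP * r * (Iy / measure lborel (ball y r))"
        unfolding CP_def Iy_def a_def by (rule P) (use r cb k0 \<alpha> in simp)
      moreover have "(k - k / 2) * (1 / 2) * a \<le> (k - k / 2) * frac y r {x. v x \<le> k / 2} powr (1 - \<alpha>) * a"
      proof (rule mult_right_mono[OF mult_left_mono])
        have "1 - frac y r {x. k / 2 \<le> v x} \<le> frac y r {x. v x \<le> k / 2}"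
          by (rule frac_compl[OF r(1)]) auto
        then have f2: "1 / 2 \<le> frac y r {x. v x \<le> k / 2}" using no[OF True] by linarith
        have "(1 / 2 :: real) powr 1 \<le> (1 / 2) powr (1 - \<alpha>)"
          by (rule powr_mono') (use \<alpha> in auto)
        also have "\<dots> \<le> frac y r {x. v x \<le> k / 2} powr (1 - \<alpha>)"
          by (rule powr_mono2[OF _ _ f2]) (use \<alpha> in auto)
        finally show "1 / 2 \<le> frac y r {x. v x \<le> k / 2} powr (1 - \<alpha>)" by simp
        show "0 \<le> k - k / 2" using k0 by simp
      qed (rule a0)
      ultimately have "(k - k / 2) * (1 / 2) * a \<le> CP * r * (Iy / measure lborel (ball y r))"
        by (rule order_trans[rotated])
      moreover have "(k - k / 2) * (1 / 2) * a = k * a / 4" by simp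
      ultimately have "k * a / 4 \<le> CP * r * (Iy / measure lborel (ball y r))" by (simp only:)
      then have "(k * a / 4) * (4 / k) \<le> CP * r * (Iy / measure lborel (ball y r)) * (4 / k)"
        by (rule mult_right_mono) (use k0 in simp)
      then have "a \<le> 4 * CP * r / k * Iy / measure lborel (ball y r)" using k0 by (simp add: mult_ac)
      then have "measure lborel (ball y r \<inter> {x. k \<le> v x}) \<le> 4 * CP * r / k * Iy"
        unfolding a_def frac_def using my
        by (metis (no_types, lifting) divide_le_cancel less_asym)
      moreover have "measure lborel (ball y r \<inter> ?S) \<le> measure lborel (ball y r \<inter> {x. k \<le> v x})"
        by (rule measure_ball_mono) auto
      moreover have "4 * CP * r / k * Iy = (\<integral>x. indicator (ball y r) x * (4 * CP * r / k * (indicator D x * g x)) \<partial>lborel)"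
        unfolding Iy_def integral_mult_right_zero[symmetric]
        by (rule Bochner_Integration.integral_cong[OF refl])
          (use sub in \<open>auto simp: D_def split: split_indicator simp del: mem_ball\<close>)
      ultimately show ?thesis by linarith
    qed
  qed
  also have "\<dots> = 4 * CP * r / k * I" by (simp add: I_def)
  also have "\<dots> \<le> 4 * CP * r / k * (c powr (1 / p) * 2 powr (q / p) * M powr (1 / p) * (k / R) * m)"
    by (rule mult_left_mono[OF Im]) (use CP r k0 in simp)
  also have "\<dots> = 4 * CP * c powr (1 / p) * 2 powr (q / p) * M powr (1 / p) * (r / R) * m"
    using k0 by simp
  finally have fin: "measure lborel ?S \<le> 4 * CP * c powr (1 / p) * 2 powr (q / p) * M powr (1 / p) * (r / R) * m" .
  have m8: "m = 8 ^ ?n * measure lborel (ball z (R / 8))"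
    unfolding m_def using R content_ball_scale[of R z] content_ball_scale[of "R / 8" z]
    by (simp add: power_divide)
  have mz: "0 < measure lborel (ball z (R / 8))" using R by simp
  have "frac z (R / 8) {x. k \<le> v x} \<le>
    (4 * CP * c powr (1 / p) * 2 powr (q / p) * M powr (1 / p) * (r / R) * m) / measure lborel (ball z (R / 8))"
    unfolding frac_def by (rule divide_right_mono[OF fin]) simp
  also have "\<dots> = 4 * CP * c powr (1 / p) * 2 powr (q / p) * M powr (1 / p) * (r / R) * 8 ^ ?n"
    unfolding m8 using mz by simp
  finally show ?thesis unfolding CP_def by (simp only: mult_ac)
qed

text \<open>A ball of radius \<open>\<rho>/32\<close> with a comparable fraction of \<open>{v \<ge>
  k}\<close> is selected first, since the class gives no energy bound on all of
  \<open>B\<^sub>\<rho>(x\<^sub>0)\<close>: for this the hypothesis would have to hold on more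
  than \<open>B\<^bsub>8\<rho>\<^esub>(x\<^sub>0)\<close>. In that ball, a cluster of radius
  proportional to \<open>A M\<^bsup>-1/p\<^esup> \<rho>\<close> must exist by
  \<open>no_cluster_imp_small_frac\<close>.\<close>

lemma local_clustering:
  fixes p q c \<delta> \<alpha> :: real
  assumes p: "1 < p" and c: "0 < c" and \<delta>: "0 \<le> \<delta>"
    and \<alpha>: "\<delta> / p < \<alpha>" "CARD('n::finite) * \<alpha> < 1"
  shows "\<exists>c0. 0 < c0 \<and> c0 \<le> 1 / 256 \<and>
    (\<forall>\<Omega> \<Lambda> (v :: real^'n \<Rightarrow> real) \<rho> K M x0 k.
      admissible p q c \<delta> \<Omega> \<Lambda> v \<rho> K M \<longrightarrow> ball x0 (8 * \<rho>) \<subseteq> \<Omega> \<longrightarrow> \<rho> \<le> k \<longrightarrow> k \<le> K / 8 \<longrightarrow>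
      0 < frac x0 \<rho> {x. k \<le> v x} \<longrightarrow>
      (\<exists>y. dist x0 y < 3 * \<rho> \<and>
        1 / 2 \<le> frac y (c0 * frac x0 \<rho> {x. k \<le> v x} * M powr (- (1 / p)) * \<rho>) {x. k / 2 \<le> v x}))"
proof -
  let ?n = "CARD('n)"
  have \<alpha>0: "0 \<le> \<alpha>" and \<alpha>1: "\<alpha> < 1"
    using exponent_bounds[OF p \<delta> \<alpha>] by simp_all
  have \<delta>1: "\<delta> / p < 1" using \<alpha>(1) \<alpha>1 by linarith
  define C where "C = 4 * (2 ^ (?n + 1) / (1 - ?n * \<alpha>)) * c powr (1 / p) * 2 powr (q / p) * 8 ^ ?n"
  have C: "0 < C" unfolding C_def using \<alpha> c by simp
  \<comment> \<open>Small enough to contradict \<open>no_cluster_imp_small_frac\<close>; the bound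
    \<open>1/256\<close> leaves room for at least one doubling below
    \<open>\<rho>/64\<close>.\<close>
  define c0 where "c0 = min (1 / 256) (1 / (2 ^ (?n + 4) * C))"
  have c0: "0 < c0" "c0 \<le> 1 / 256" "c0 \<le> 1 / (2 ^ (?n + 4) * C)"
    unfolding c0_def using C by auto
  have concl: "\<exists>y. dist x0 y < 3 * \<rho> \<and>
        1 / 2 \<le> frac y (c0 * frac x0 \<rho> {x. k \<le> v x} * M powr (- (1 / p)) * \<rho>) {x. k / 2 \<le> v x}"
    if adm: "admissible p q c \<delta> \<Omega> \<Lambda> v \<rho> K M" and b: "ball x0 (8 * \<rho>) \<subseteq> \<Omega>"
      and k: "\<rho> \<le> k" "k \<le> K / 8" and Apos: "0 < frac x0 \<rho> {x. k \<le> v x}"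
    for \<Omega> \<Lambda> and v :: "real^'n \<Rightarrow> real" and \<rho> K M x0 k
  proof (rule ccontr)
    assume contr: "\<not> ?thesis"
    note ad = admissibleD[OF adm]
    note [measurable] = ad(5)
    have \<rho>: "0 < \<rho>" by (rule ad(2))
    have M: "1 \<le> M" by (rule ad(3))
    define A where "A = frac x0 \<rho> {x. k \<le> v x}"
    have A: "0 < A" "A \<le> 1" unfolding A_def by (rule Apos, rule frac_le_1) simp
    define r where "r = c0 * A * M powr (- (1 / p)) * \<rho>"
    have r0: "0 < r" unfolding r_def using c0 A M \<rho> by simp
    have r1: "r \<le> \<rho> / 32"
    proof -
      have "M powr (- (1 / p)) \<le> M powr 0" by (rule powr_mono) (use M p in auto)
      then have M1: "M powr (- (1 / p)) \<le> 1" using M by simp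
      have "c0 * A * M powr (- (1 / p)) \<le> 1 / 256 * 1 * 1"
        by (intro mult_mono c0 A M1) (use c0 A in auto)
      then have "r \<le> 1 / 256 * 1 * 1 * \<rho>" unfolding r_def by (rule mult_right_mono) (use \<rho> in simp)
      then show ?thesis using \<rho> by simp
    qed
    let ?S = "ball x0 \<rho> \<inter> {x. k \<le> v x}"
    have "\<exists>z\<in>ball x0 (2 * \<rho>). measure lborel ?S / (2 * measure lborel (ball x0 (2 * \<rho>))) \<le> frac z (\<rho> / 32) ?S"
      by (rule ex_ball_with_large_frac[of ?S x0 \<rho> "\<rho> / 32"]) (use \<rho> in auto)
    then obtain z where z: "z \<in> ball x0 (2 * \<rho>)"
      and zf: "measure lborel ?S / (2 * measure lborel (ball x0 (2 * \<rho>))) \<le> frac z (\<rho> / 32) ?S" by blast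
    have "A / 2 ^ (?n + 1) \<le> frac z (\<rho> / 32) {x. k \<le> v x}"
    proof -
      have m: "0 < measure lborel (ball x0 \<rho>)" using \<rho> by simp
      have "measure lborel (ball x0 (2 * \<rho>)) = 2 ^ ?n * measure lborel (ball x0 \<rho>)"
        using \<rho> content_ball_scale[of "2 * \<rho>" x0] content_ball_scale[of \<rho> x0] by (simp add: power_mult_distrib)
      then have "A / 2 ^ (?n + 1) = measure lborel ?S / (2 * measure lborel (ball x0 (2 * \<rho>)))"
        unfolding A_def frac_def using m by simp
      also note zf
      also have "frac z (\<rho> / 32) ?S \<le> frac z (\<rho> / 32) {x. k \<le> v x}" by (rule frac_mono) auto
      finally show ?thesis .
    qed
    moreover have "frac z ((\<rho> / 4) / 8) {x. k \<le> v x} \<le>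
      4 * (2 ^ (?n + 1) / (1 - ?n * \<alpha>)) * c powr (1 / p) * 2 powr (q / p) * 8 ^ ?n *
      M powr (1 / p) * (r / (\<rho> / 4))"
    proof (rule no_cluster_imp_small_frac[OF adm p c \<delta> \<delta>1 \<alpha>0 \<alpha>1 \<alpha>(2)])
      show "0 < \<rho> / 4" "\<rho> / 4 \<le> \<rho>" "\<rho> / 4 \<le> k" using \<rho> k by auto
      show "ball z (8 * (\<rho> / 4)) \<subseteq> \<Omega>"
      proof
        fix x assume "x \<in> ball z (8 * (\<rho> / 4))"
        then have "x \<in> ball x0 (8 * \<rho>)"
          using dist_triangle[of x0 x z] z \<rho> by (simp add: dist_commute)
        then show "x \<in> \<Omega>" using b by blast
      qed
      show "k \<le> \<rho> / 4 / \<rho> * K" using k ad(4) \<rho> by simp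
      show "0 < r" by (rule r0)
      show "r \<le> \<rho> / 4 / 8" using r1 by simp
      fix y assume y: "y \<in> ball z (\<rho> / 4 / 4)"
      have "dist x0 y < 3 * \<rho>"
        using dist_triangle[of x0 y z] z y \<rho> by (simp add: dist_commute)
      then show "frac y r {x. k / 2 \<le> v x} < 1 / 2"
        using contr unfolding r_def A_def by (meson not_le)
    qed
    ultimately have "A / 2 ^ (?n + 1) \<le> C * M powr (1 / p) * (r / (\<rho> / 4))"
      unfolding C_def by simp
    also have "\<dots> = 4 * C * c0 * A * (M powr (1 / p) * M powr (- (1 / p)))"
      unfolding r_def using \<rho> by simp
    also have "M powr (1 / p) * M powr (- (1 / p)) = 1"
      using M by (simp flip: powr_add)
    finally have "A * (1 / 2 ^ (?n + 1)) \<le> A * (4 * C * c0)" by (simp add: mult_ac)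
    then have "1 / 2 ^ (?n + 1) \<le> 4 * C * c0" by (rule mult_left_le_imp_le[OF _ A(1)])
    also have "\<dots> \<le> 4 * C * (1 / (2 ^ (?n + 4) * C))"
      by (rule mult_left_mono[OF c0(3)]) (use C in simp)
    also have "\<dots> = 4 / 2 ^ (?n + 4)" using C by simp
    also have "\<dots> = 1 / 2 ^ (?n + 1) / 2" by (simp add: power_add)
    also have "\<dots> < 1 / 2 ^ (?n + 1)"
    proof -
      have half: "x / 2 < x" if "0 < x" for x :: real using that by simp
      show ?thesis by (rule half) simp
    qed
    finally show False by simp
  qed
  show ?thesis
    by (rule exI[of _ c0], intro conjI allI impI, rule c0(1), rule c0(2), rule concl)
qed

section \<open>Propagation along chains of balls\<close>

text \<open>Lower bounds are inherited by the doubled ball at the cost of a factor \<open>B\<close> per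
  step. Levels decrease and radii increase, so the cap \<open>(r/\<rho>) K\<close> continues to
  hold.\<close>

lemma doubling_chain:
  fixes v :: "real^'n::finite \<Rightarrow> real" and B :: real
  assumes EX: "\<And>y r k. 0 < r \<Longrightarrow> 8 * r \<le> \<rho> \<Longrightarrow> ball y (64 * r) \<subseteq> \<Omega> \<Longrightarrow> k \<le> r / \<rho> * K \<Longrightarrow>
      1 / 2 \<le> frac y r {x. k \<le> v x} \<Longrightarrow> \<rho> \<le> k / B \<Longrightarrow>
      AE x in lborel. x \<in> ball y (2 * r) \<longrightarrow> k / B \<le> v x"
    and v[measurable]: "v \<in> borel_measurable borel" and B: "1 \<le> B" and \<rho>: "0 < \<rho>" and K: "0 \<le> K"
    and r: "0 < r" and b: "ball y \<rho> \<subseteq> \<Omega>" and k: "k \<le> r / \<rho> * K" and half: "1 / 2 \<le> frac y r {x. k \<le> v x}"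
  shows "2 ^ m * r \<le> \<rho> / 64 \<Longrightarrow> \<rho> \<le> k / B ^ m \<Longrightarrow> 1 / 2 \<le> frac y (2 ^ m * r) {x. k / B ^ m \<le> v x}"
proof (induction m)
  case 0
  then show ?case using half by simp
next
  case (Suc m)
  have r2: "0 < 2 ^ m * r" using r by simp
  have le: "2 * (2 ^ m * r) \<le> \<rho> / 64" using Suc.prems(1) by (simp add: mult_ac)
  have k0: "0 < k"
  proof -
    have "0 < k / B ^ Suc m" using Suc.prems(2) \<rho> by linarith
    moreover have "0 < B ^ Suc m" using B by (intro zero_less_power) simp
    ultimately have "0 < k / B ^ Suc m * B ^ Suc m" by (rule mult_pos_pos)
    then show ?thesis using B by simp
  qed
  have Bm: "1 \<le> B ^ m" using B by (rule one_le_power)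
  have km: "k / B ^ Suc m = k / B ^ m / B" by simp
  have km1: "k / B ^ m / B \<le> k / B ^ m / 1"
    using B k0 Bm by (intro divide_left_mono) auto
  have IH: "1 / 2 \<le> frac y (2 ^ m * r) {x. k / B ^ m \<le> v x}"
  proof (rule Suc.IH)
    show "2 ^ m * r \<le> \<rho> / 64" using le r2 by linarith
    show "\<rho> \<le> k / B ^ m" using Suc.prems(2) km km1 by linarith
  qed
  have "AE x in lborel. x \<in> ball y (2 * (2 ^ m * r)) \<longrightarrow> k / B ^ m / B \<le> v x"
  proof (rule EX[OF r2 _ _ _ IH])
    show "8 * (2 ^ m * r) \<le> \<rho>" using le r2 by linarith
    have "64 * (2 ^ m * r) \<le> \<rho>" using le r2 by linarith
    then show "ball y (64 * (2 ^ m * r)) \<subseteq> \<Omega>" by (rule subset_trans[OF subset_ball b])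
    have "k / B ^ m \<le> k / 1" using Bm k0 by (intro divide_left_mono) auto
    also have "\<dots> \<le> r / \<rho> * K" using k by simp
    also have "\<dots> \<le> 2 ^ m * r / \<rho> * K"
    proof (rule mult_right_mono[OF divide_right_mono K])
      show "r \<le> 2 ^ m * r" using r by simp
    qed (use \<rho> in simp)
    finally show "k / B ^ m \<le> 2 ^ m * r / \<rho> * K" .
    show "\<rho> \<le> k / B ^ m / B" using Suc.prems(2) unfolding km .
  qed
  then have "frac y (2 * (2 ^ m * r)) {x. k / B ^ m / B \<le> v x} = 1"
    by (intro frac_eq_1_AE) (use r in \<open>auto simp del: mem_ball\<close>)
  moreover have "2 * (2 ^ m * r) = 2 ^ Suc m * r" by simp
  ultimately have eq: "frac y (2 ^ Suc m * r) {x. k / B ^ Suc m \<le> v x} = 1" by (simp only: km)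
  show ?case unfolding eq by simp
qed

text \<open>At a radius comparable to \<open>\<rho>\<close>, balls cannot be doubled further inside
  \<open>\<Omega>\<close>. Instead the centre is moved: the ball of radius \<open>r\<close> about
  a point at distance at most \<open>r\<close> lies in the doubled ball.\<close>

lemma translation_chain:
  fixes v :: "real^'n::finite \<Rightarrow> real" and B :: real and y z :: "real^'n"
  assumes EX: "\<And>y r k. 0 < r \<Longrightarrow> 8 * r \<le> \<rho> \<Longrightarrow> ball y (64 * r) \<subseteq> \<Omega> \<Longrightarrow> k \<le> r / \<rho> * K \<Longrightarrow>
      1 / 2 \<le> frac y r {x. k \<le> v x} \<Longrightarrow> \<rho> \<le> k / B \<Longrightarrow>
      AE x in lborel. x \<in> ball y (2 * r) \<longrightarrow> k / B \<le> v x"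
    and v[measurable]: "v \<in> borel_measurable borel" and B: "1 \<le> B" and \<rho>: "0 < \<rho>"
    and r: "0 < r" "64 * r \<le> \<rho>" and b: "\<And>t. 0 \<le> t \<Longrightarrow> t \<le> 1 \<Longrightarrow> ball (y + t *\<^sub>R (z - y)) \<rho> \<subseteq> \<Omega>"
    and k: "k \<le> r / \<rho> * K" and half: "1 / 2 \<le> frac y r {x. k \<le> v x}"
    and N: "0 < N" "dist y z \<le> real N * r"
  shows "i \<le> N \<Longrightarrow> \<rho> \<le> k / B ^ i \<Longrightarrow>
    1 / 2 \<le> frac (y + (real i / real N) *\<^sub>R (z - y)) r {x. k / B ^ i \<le> v x}"
proof (induction i)
  case 0
  then show ?case using half by simp
next
  case (Suc i)
  define w where "w j = y + (real j / real N) *\<^sub>R (z - y)" for j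
  have k0: "0 < k"
  proof -
    have "0 < k / B ^ Suc i" using Suc.prems(2) \<rho> by linarith
    moreover have "0 < B ^ Suc i" using B by (intro zero_less_power) simp
    ultimately have "0 < k / B ^ Suc i * B ^ Suc i" by (rule mult_pos_pos)
    then show ?thesis using B by simp
  qed
  have Bi: "1 \<le> B ^ i" using B by (rule one_le_power)
  have ki: "k / B ^ Suc i = k / B ^ i / B" by simp
  have ki1: "k / B ^ i / B \<le> k / B ^ i / 1"
    using B k0 Bi by (intro divide_left_mono) auto
  have IH: "1 / 2 \<le> frac (w i) r {x. k / B ^ i \<le> v x}"
    unfolding w_def
  proof (rule Suc.IH)
    show "i \<le> N" using Suc.prems by simp
    show "\<rho> \<le> k / B ^ i" using Suc.prems(2) ki ki1 by linarith
  qed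
  have ae: "AE x in lborel. x \<in> ball (w i) (2 * r) \<longrightarrow> k / B ^ i / B \<le> v x"
  proof (rule EX[OF r(1) _ _ _ IH])
    show "8 * r \<le> \<rho>" using r by linarith
    have "ball (w i) \<rho> \<subseteq> \<Omega>" unfolding w_def using Suc.prems N by (intro b) (auto simp: divide_le_eq)
    then show "ball (w i) (64 * r) \<subseteq> \<Omega>" by (rule subset_trans[OF subset_ball[OF r(2)]])
    have "k / B ^ i \<le> k / 1" using Bi k0 by (intro divide_left_mono) auto
    then show "k / B ^ i \<le> r / \<rho> * K" using k by simp
    show "\<rho> \<le> k / B ^ i / B" using Suc.prems(2) unfolding ki .
  qed
  have d: "dist (w i) (w (Suc i)) \<le> r"
  proof -
    have "w (Suc i) - w i = (1 / real N) *\<^sub>R (z - y)"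
      unfolding w_def by (simp add: add_divide_distrib scaleR_add_left)
    then have "norm (w (Suc i) - w i) = norm (z - y) / real N" by simp
    then have "dist (w i) (w (Suc i)) = dist y z / real N"
      by (simp only: dist_norm norm_minus_commute[of y z] norm_minus_commute[of "w i"])
    also have "\<dots> \<le> r" using N by (simp add: divide_le_eq mult.commute)
    finally show ?thesis .
  qed
  have "AE x in lborel. x \<in> ball (w (Suc i)) r \<longrightarrow> x \<in> {x. k / B ^ Suc i \<le> v x}"
    using ae
  proof eventually_elim
    case (elim x)
    show ?case
    proof
      assume "x \<in> ball (w (Suc i)) r"
      then have "x \<in> ball (w i) (2 * r)"
        using dist_triangle[of "w i" x "w (Suc i)"] d by simp
      then show "x \<in> {x. k / B ^ Suc i \<le> v x}" unfolding ki using elim by simp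
    qed
  qed
  then have "frac (w (Suc i)) r {x. k / B ^ Suc i \<le> v x} = 1"
    by (intro frac_eq_1_AE r(1)) auto
  then show ?case by (simp add: w_def)
qed

lemma ex_power2_scale:
  fixes r \<rho> :: real
  assumes "0 < r" "r \<le> \<rho> / 256"
  shows "\<exists>m. \<rho> / 128 < 2 ^ m * r \<and> 2 ^ m * r \<le> \<rho> / 64"
proof -
  obtain m0 where "\<rho> / 128 / r < 2 ^ m0" using real_arch_pow[of 2 "\<rho> / 128 / r"] by auto
  then have ex: "\<rho> / 128 < 2 ^ m0 * r" using assms by (simp only: pos_divide_less_eq)
  define m where "m = (LEAST m. \<rho> / 128 < 2 ^ m * r)"
  have m: "\<rho> / 128 < 2 ^ m * r" unfolding m_def by (rule LeastI[where P = "\<lambda>m. \<rho> / 128 < 2 ^ m * r", OF ex])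
  have "2 ^ m * r \<le> \<rho> / 64"
  proof (cases m)
    case 0
    then show ?thesis using m assms by simp
  next
    case (Suc j)
    have "\<not> \<rho> / 128 < 2 ^ j * r"
      by (rule not_less_Least) (use Suc m_def in auto)
    then show ?thesis using Suc by simp
  qed
  with m show ?thesis by blast
qed

text \<open>The ball of radius \<open>t \<rho>\<close> is doubled until its radius \<open>r\<^sub>1\<close>
  lies between \<open>\<rho>/128\<close> and \<open>\<rho>/64\<close>, then moved to any point of
  \<open>B\<^bsub>\<rho>/2\<^esub>(x\<^sub>0)\<close>. Centres are at most
  \<open>7\<rho>/2\<close> apart, so \<open>448\<close> translations suffice, and one more step
  gives the pointwise bound. The \<open>m\<close> doublings cost
  \<open>2\<^bsup>-m(J+1)\<^esup>\<close>, and \<open>2\<^sup>m t \<le> 1\<close> turns this into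
  the factor \<open>t\<^bsup>J+1\<^esup>\<close>; one more factor \<open>t\<close> is spent on
  lowering the initial level to \<open>t k\<close>, as required by the cap on levels.\<close>

lemma propagation_to_half_ball:
  fixes v :: "real^'n::finite \<Rightarrow> real" and J :: nat
  assumes EX: "\<And>y r k. 0 < r \<Longrightarrow> 8 * r \<le> \<rho> \<Longrightarrow> ball y (64 * r) \<subseteq> \<Omega> \<Longrightarrow> k \<le> r / \<rho> * K \<Longrightarrow>
      1 / 2 \<le> frac y r {x. k \<le> v x} \<Longrightarrow> \<rho> \<le> k / 2 ^ (J + 1) \<Longrightarrow>
      AE x in lborel. x \<in> ball y (2 * r) \<longrightarrow> k / 2 ^ (J + 1) \<le> v x"
    and v[measurable]: "v \<in> borel_measurable borel" and \<rho>: "0 < \<rho>" and K: "0 \<le> K"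
    and b: "ball x0 (8 * \<rho>) \<subseteq> \<Omega>" and y: "dist x0 y < 3 * \<rho>"
    and t: "0 < t" "t \<le> 1 / 256" and k: "0 < k" "k \<le> K" and half: "1 / 2 \<le> frac y (t * \<rho>) {x. k \<le> v x}"
    and big: "\<rho> \<le> t ^ (J + 2) * k / 2 ^ ((J + 1) * 449)"
  shows "AE x in lborel. x \<in> ball x0 (\<rho> / 2) \<longrightarrow> t ^ (J + 2) * k / 2 ^ ((J + 1) * 449) \<le> v x"
proof -
  define B where "B = (2::real) ^ (J + 1)"
  have B: "1 \<le> B" unfolding B_def by (rule one_le_power) simp
  have EXB: "AE x in lborel. x \<in> ball y (2 * r) \<longrightarrow> k / B \<le> v x"
    if "0 < r" "8 * r \<le> \<rho>" "ball y (64 * r) \<subseteq> \<Omega>" "k \<le> r / \<rho> * K"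
      "1 / 2 \<le> frac y r {x. k \<le> v x}" "\<rho> \<le> k / B" for y r k
    using EX[OF that[unfolded B_def]] unfolding B_def .
  define r where "r = t * \<rho>"
  have r: "0 < r" "r \<le> \<rho> / 256" using t \<rho> by (auto simp: r_def)
  obtain m where m: "\<rho> / 128 < 2 ^ m * r" "2 ^ m * r \<le> \<rho> / 64"
    using ex_power2_scale[OF r] by blast
  define r1 where "r1 = 2 ^ m * r"
  have r1: "0 < r1" "64 * r1 \<le> \<rho>" "\<rho> / 128 < r1" using m r by (auto simp: r1_def)
  \<comment> \<open>Lowering the level by \<open>t = r/\<rho>\<close> makes it admissible at
    radius \<open>r\<close>.\<close>
  define k0 where "k0 = t * k"
  define l where "l = k0 / B ^ m / B ^ 449"
  define l' where "l' = t ^ (J + 2) * k / 2 ^ ((J + 1) * 449)"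
  have k00: "0 < k0" using t k by (simp add: k0_def)
  have ll: "l' \<le> l"
  proof -
    have "2 ^ m * t \<le> 1"
    proof -
      have "(2 ^ m * t) * \<rho> \<le> 1 * \<rho>" using m(2) \<rho> by (simp add: r_def mult.assoc)
      then show ?thesis by (rule mult_right_le_imp_le[OF _ \<rho>])
    qed
    then have "(2 ^ m * t) ^ (J + 1) \<le> 1" using t by (intro power_le_one) auto
    moreover have "(2 ^ m * t) ^ (J + 1) = B ^ m * t ^ (J + 1)"
      unfolding B_def power_mult_distrib power_mult[symmetric] by (simp only: mult.commute)
    ultimately have Bt: "B ^ m * t ^ (J + 1) \<le> 1" by (simp only:)
    have Bm: "0 < B ^ m" using B by simp
    have "t ^ (J + 1) \<le> 1 / B ^ m" using Bt Bm by (simp add: pos_le_divide_eq mult.commute)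
    then have "t ^ (J + 1) * k0 / B ^ 449 \<le> 1 / B ^ m * k0 / B ^ 449"
      using k00 B by (intro divide_right_mono mult_right_mono) auto
    moreover have "t ^ (J + 1) * k0 / B ^ 449 = l'"
      unfolding l'_def k0_def B_def power_mult[symmetric] by (simp add: mult_ac)
    ultimately show ?thesis unfolding l_def by simp
  qed
  have l\<rho>: "\<rho> \<le> l" using ll big unfolding l'_def by linarith
  have mono: "l \<le> k0 / B ^ m / B ^ i" if "i \<le> 449" for i
    unfolding l_def using k00 B that by (intro divide_left_mono power_increasing) auto
  have k0K: "k0 \<le> r / \<rho> * K"
  proof -
    have "t * k \<le> t * K" using t k by (intro mult_left_mono) auto
    then show ?thesis using \<rho> by (simp add: k0_def r_def)
  qed
  have sub: "ball w \<rho> \<subseteq> \<Omega>" if "dist x0 w < 3 * \<rho>" for w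
  proof
    fix x assume "x \<in> ball w \<rho>"
    then have "x \<in> ball x0 (8 * \<rho>)" using that dist_triangle[of x0 x w] \<rho> by simp
    then show "x \<in> \<Omega>" using b by blast
  qed
  have half0: "1 / 2 \<le> frac y r {x. k0 \<le> v x}"
  proof -
    have "t * k \<le> 1 * k" using t k by (intro mult_right_mono) auto
    then have "frac y r {x. k \<le> v x} \<le> frac y r {x. k0 \<le> v x}"
      by (intro frac_mono) (auto simp: k0_def)
    then show ?thesis using half by (simp add: r_def)
  qed
  have h1: "1 / 2 \<le> frac y r1 {x. k0 / B ^ m \<le> v x}"
    unfolding r1_def
  proof (rule doubling_chain[OF EXB v B \<rho> K r(1) sub[OF y] k0K half0 m(2)])
    show "\<rho> \<le> k0 / B ^ m" using mono[of 0] l\<rho> by simp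
  qed
  have k1K: "k0 / B ^ m \<le> r1 / \<rho> * K"
  proof -
    have "k0 / B ^ m \<le> k0 / 1" using k00 one_le_power[OF B, of m] by (intro divide_left_mono) auto
    also have "\<dots> \<le> r / \<rho> * K" using k0K by simp
    also have "\<dots> \<le> r1 / \<rho> * K"
    proof (rule mult_right_mono[OF divide_right_mono K])
      show "r \<le> r1" using r by (simp add: r1_def)
    qed (use \<rho> in simp)
    finally show ?thesis .
  qed
  have each: "AE x in lborel. x \<in> ball z (2 * r1) \<longrightarrow> l \<le> v x" if z: "z \<in> cball x0 (\<rho> / 2)" for z
  proof -
    have seg: "ball (y + s *\<^sub>R (z - y)) \<rho> \<subseteq> \<Omega>" if s: "0 \<le> s" "s \<le> 1" for s
    proof (rule sub)
      have "(1 - s) *\<^sub>R y + s *\<^sub>R z \<in> ball x0 (3 * \<rho>)"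
        by (rule convexD[OF convex_ball]) (use y z s \<rho> in auto)
      moreover have "(1 - s) *\<^sub>R y + s *\<^sub>R z = y + s *\<^sub>R (z - y)" by (simp add: algebra_simps)
      ultimately show "dist x0 (y + s *\<^sub>R (z - y)) < 3 * \<rho>" by simp
    qed
    have dz: "dist y z \<le> real 448 * r1"
      using dist_triangle[of y z x0] y z r1 by (simp add: dist_commute)
    have h2: "1 / 2 \<le> frac (y + (real 448 / real 448) *\<^sub>R (z - y)) r1 {x. k0 / B ^ m / B ^ 448 \<le> v x}"
      by (rule translation_chain[OF EXB v B \<rho> r1(1,2) seg k1K h1 _ dz])
        (use mono[of 448] l\<rho> in auto)
    have e1: "y + (real 448 / real 448) *\<^sub>R (z - y) = z" by simp
    note h3 = h2[unfolded e1]
    have lB: "l = k0 / B ^ m / B ^ 448 / B"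
    proof -
      have "B ^ 449 = B ^ 448 * B" using power_Suc2[of B 448] by (simp del: power_Suc power_Suc2)
      then show ?thesis unfolding l_def by (simp only: divide_divide_eq_left)
    qed
    show ?thesis
      unfolding lB
    proof (rule EXB[OF r1(1) _ _ _ h3])
      show "8 * r1 \<le> \<rho>" using r1 by linarith
      have "dist x0 z < 3 * \<rho>" using z \<rho> by simp
      then show "ball z (64 * r1) \<subseteq> \<Omega>" by (rule subset_trans[OF subset_ball[OF r1(2)] sub])
      have B448: "1 \<le> B ^ 448" by (rule one_le_power[OF B])
      have Bm: "0 < B ^ m" using B by simp
      have "k0 / B ^ m / B ^ 448 \<le> k0 / B ^ m / 1"
        using B448 k00 Bm by (intro divide_left_mono) auto
      then show "k0 / B ^ m / B ^ 448 \<le> r1 / \<rho> * K" using k1K by simp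
      show "\<rho> \<le> k0 / B ^ m / B ^ 448 / B" using l\<rho> unfolding lB .
    qed
  qed
  obtain T where T: "finite T" "T \<subseteq> cball x0 (\<rho> / 2)" "cball x0 (\<rho> / 2) \<subseteq> (\<Union>z\<in>T. ball z (2 * r1))"
    using seq_compact_imp_totally_bounded[OF compact_imp_seq_compact[OF compact_cball[of x0 "\<rho> / 2"]],
        rule_format, of "2 * r1"] r1 by auto
  have "AE x in lborel. \<forall>z\<in>T. x \<in> ball z (2 * r1) \<longrightarrow> l \<le> v x"
    by (rule AE_ball_countable'[OF each]) (use T in \<open>auto intro: countable_finite\<close>)
  then show ?thesis
  proof eventually_elim
    case (elim x)
    show ?case
    proof
      assume "x \<in> ball x0 (\<rho> / 2)"
      then have "x \<in> cball x0 (\<rho> / 2)" by simp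
      then obtain z where "z \<in> T" "x \<in> ball z (2 * r1)" using T(3) by blast
      then have "l \<le> v x" using elim by blast
      then show "t ^ (J + 2) * k / 2 ^ ((J + 1) * 449) \<le> v x" using ll unfolding l'_def by linarith
    qed
  qed
qed

text \<open>The lower bound is a fixed power \<open>J + 2\<close> of the fraction of \<open>{v \<ge>
  k}\<close>, times \<open>k\<close>.\<close>

lemma power_like_positivity:
  fixes p q c \<delta> \<alpha> :: real
  assumes p: "1 < p" and c: "0 < c" and q: "0 \<le> q" and \<delta>: "0 \<le> \<delta>"
    and \<alpha>: "\<delta> / p < \<alpha>" "CARD('n::finite) * \<alpha> < 1"
  shows "\<exists>C b c0. 1 \<le> C \<and> 0 \<le> b \<and> 0 < c0 \<and> c0 \<le> 1 / 256 \<and>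
    (\<forall>\<Omega> \<Lambda> (v :: real^'n \<Rightarrow> real) \<rho> K M x0 k J.
      admissible p q c \<delta> \<Omega> \<Lambda> v \<rho> K M \<longrightarrow> ball x0 (8 * \<rho>) \<subseteq> \<Omega> \<longrightarrow> \<rho> \<le> k \<longrightarrow> k \<le> K / 8 \<longrightarrow>
      C * M powr b \<le> real J \<longrightarrow>
      \<rho> \<le> (c0 * frac x0 \<rho> {x. k \<le> v x} * M powr (- (1 / p))) ^ (J + 2) * (k / 2) / 2 ^ ((J + 1) * 449) \<longrightarrow>
      (AE x in lborel. x \<in> ball x0 (\<rho> / 2) \<longrightarrow>
        (c0 * frac x0 \<rho> {x. k \<le> v x} * M powr (- (1 / p))) ^ (J + 2) * (k / 2) / 2 ^ ((J + 1) * 449) \<le> v x))"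
proof -
  obtain C b where C: "1 \<le> C" and b: "0 \<le> b"
    and L2: "\<forall>\<Omega> \<Lambda> (v :: real^'n \<Rightarrow> real) \<rho> K M y r k J.
      admissible p q c \<delta> \<Omega> \<Lambda> v \<rho> K M \<longrightarrow> 0 < r \<longrightarrow> 8 * r \<le> \<rho> \<longrightarrow> ball y (64 * r) \<subseteq> \<Omega> \<longrightarrow>
      k \<le> r / \<rho> * K \<longrightarrow> 1 / 2 \<le> frac y r {x. k \<le> v x} \<longrightarrow> C * M powr b \<le> real J \<longrightarrow>
      \<rho> \<le> k / 2 ^ (J + 1) \<longrightarrow> (AE x in lborel. x \<in> ball y (2 * r) \<longrightarrow> k / 2 ^ (J + 1) \<le> v x)"
    using expansion_of_positivity[OF p c q \<delta> \<alpha>] by (elim exE conjE) (rule that)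
  obtain c0 where c0: "0 < c0" "c0 \<le> 1 / 256"
    and L3: "\<forall>\<Omega> \<Lambda> (v :: real^'n \<Rightarrow> real) \<rho> K M x0 k.
      admissible p q c \<delta> \<Omega> \<Lambda> v \<rho> K M \<longrightarrow> ball x0 (8 * \<rho>) \<subseteq> \<Omega> \<longrightarrow> \<rho> \<le> k \<longrightarrow> k \<le> K / 8 \<longrightarrow>
      0 < frac x0 \<rho> {x. k \<le> v x} \<longrightarrow>
      (\<exists>y. dist x0 y < 3 * \<rho> \<and>
        1 / 2 \<le> frac y (c0 * frac x0 \<rho> {x. k \<le> v x} * M powr (- (1 / p)) * \<rho>) {x. k / 2 \<le> v x})"
    using local_clustering[OF p c \<delta> \<alpha>, of q] by (elim exE conjE) (rule that)
  have concl: "AE x in lborel. x \<in> ball x0 (\<rho> / 2) \<longrightarrow>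
        (c0 * frac x0 \<rho> {x. k \<le> v x} * M powr (- (1 / p))) ^ (J + 2) * (k / 2) / 2 ^ ((J + 1) * 449) \<le> v x"
    if adm: "admissible p q c \<delta> \<Omega> \<Lambda> v \<rho> K M" and bl: "ball x0 (8 * \<rho>) \<subseteq> \<Omega>" and k: "\<rho> \<le> k" "k \<le> K / 8"
      and J: "C * M powr b \<le> real J"
      and big: "\<rho> \<le> (c0 * frac x0 \<rho> {x. k \<le> v x} * M powr (- (1 / p))) ^ (J + 2) * (k / 2) / 2 ^ ((J + 1) * 449)"
    for \<Omega> \<Lambda> and v :: "real^'n \<Rightarrow> real" and \<rho> K M x0 k J
  proof -
    note ad = admissibleD[OF adm]
    note [measurable] = ad(5)
    define A where "A = frac x0 \<rho> {x. k \<le> v x}"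
    have A: "0 \<le> A" "A \<le> 1" unfolding A_def by (rule frac_nonneg, rule frac_le_1) simp
    have A0: "0 < A"
    proof (rule ccontr)
      assume "\<not> 0 < A"
      then have "A = 0" using A by simp
      then show False using big ad(2) unfolding A_def[symmetric] by simp
    qed
    define t where "t = c0 * A * M powr (- (1 / p))"
    have M1: "0 < M powr (- (1 / p))" "M powr (- (1 / p)) \<le> 1"
    proof -
      show "0 < M powr (- (1 / p))" using ad(3) by simp
      have "M powr (- (1 / p)) \<le> M powr 0" by (rule powr_mono) (use ad(3) p in auto)
      then show "M powr (- (1 / p)) \<le> 1" using ad(3) by simp
    qed
    have t0: "0 < t" unfolding t_def by (intro mult_pos_pos c0(1) A0 M1(1))
    have t1: "t \<le> 1 / 256"
    proof -
      have "c0 * A * M powr (- (1 / p)) \<le> 1 / 256 * 1 * 1"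
        by (intro mult_mono c0 A M1) (use c0 A in auto)
      then show ?thesis by (simp add: t_def)
    qed
    obtain y where y: "dist x0 y < 3 * \<rho>" and half: "1 / 2 \<le> frac y (t * \<rho>) {x. k / 2 \<le> v x}"
      using L3[rule_format, OF adm bl k A0[unfolded A_def]] unfolding t_def A_def by blast
    have k2: "0 < k / 2" "k / 2 \<le> K" using k ad(2,4) by auto
    show ?thesis
      unfolding A_def[symmetric] t_def[symmetric]
    proof (rule propagation_to_half_ball[OF _ ad(5) ad(2) ad(4) bl y t0 t1 k2 half])
      show "\<rho> \<le> t ^ (J + 2) * (k / 2) / 2 ^ ((J + 1) * 449)"
        using big unfolding A_def[symmetric] t_def[symmetric] .
      fix y r k assume "0 < r" "8 * r \<le> \<rho>" "ball y (64 * r) \<subseteq> \<Omega>" "k \<le> r / \<rho> * K"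
        "1 / 2 \<le> frac y r {x. k \<le> v x}" "\<rho> \<le> k / 2 ^ (J + 1)"
      then show "AE x in lborel. x \<in> ball y (2 * r) \<longrightarrow> k / 2 ^ (J + 1) \<le> v x"
        using L2[rule_format, OF adm] J by blast
    qed
  qed
  show ?thesis
    by (rule exI[of _ C], rule exI[of _ b], rule exI[of _ c0], intro conjI allI impI,
        rule C, rule b, rule c0(1), rule c0(2), rule concl)
qed

section \<open>From decay of level sets to integral means\<close>

text \<open>A discrete layer-cake formula: the term of the layer that contains \<open>x\<close> dominates
  \<open>x\<^sup>\<theta>\<close>.\<close>

lemma decay_layer_pointwise:
  fixes x I K b \<theta> :: real
  assumes x: "0 \<le> x" "x \<le> K" and I: "0 < I" and b: "1 < b" and \<theta>: "0 < \<theta>" and N: "K \<le> b ^ N * I"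
  shows "x powr \<theta> \<le> I powr \<theta> + (\<Sum>i<N. (b ^ Suc i * I) powr \<theta> * (if b ^ i * I \<le> x then 1 else 0))"
proof (cases "x \<le> I")
  case True
  have "x powr \<theta> \<le> I powr \<theta>" by (rule powr_mono2) (use True x \<theta> in auto)
  moreover have "0 \<le> (\<Sum>i<N. (b ^ Suc i * I) powr \<theta> * (if b ^ i * I \<le> x then 1 else 0))"
    by (rule sum_nonneg) auto
  ultimately show ?thesis by linarith
next
  case False
  define j where "j = (LEAST j. x \<le> b ^ j * I)"
  have xN: "x \<le> b ^ N * I" using x N by linarith
  have j: "x \<le> b ^ j * I" unfolding j_def by (rule LeastI[where P = "\<lambda>j. x \<le> b ^ j * I", OF xN])
  have jN: "j \<le> N" unfolding j_def by (rule Least_le[where P = "\<lambda>j. x \<le> b ^ j * I", OF xN])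
  obtain i where i: "j = Suc i" using j False by (cases j) auto
  have "\<not> x \<le> b ^ i * I" by (rule not_less_Least) (use i j_def in auto)
  then have ix: "b ^ i * I \<le> x" by simp
  have iN: "i \<in> {..<N}" using jN i by simp
  have "x powr \<theta> \<le> (b ^ Suc i * I) powr \<theta>"
    by (rule powr_mono2) (use j x \<theta> in \<open>auto simp: i\<close>)
  also have "\<dots> = (b ^ Suc i * I) powr \<theta> * (if b ^ i * I \<le> x then 1 else 0)" using ix by simp
  also have "\<dots> \<le> (\<Sum>i<N. (b ^ Suc i * I) powr \<theta> * (if b ^ i * I \<le> x then 1 else 0))"
    by (rule member_le_sum[OF iN]) auto
  finally show ?thesis using powr_ge_zero[of I \<theta>] by linarith
qed

lemma powr_inverse_power:
  fixes x :: real
  assumes "0 < x" "1 \<le> Q"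
  shows "(x powr (1 / real Q)) ^ Q = x"
  using assms by (simp add: powr_realpow[symmetric] powr_powr)

text \<open>With levels \<open>b\<^sup>i I\<close>, \<open>b = 4\<^sup>Q\<close>, the decay hypothesis gives
  fractions of order \<open>4\<^bsup>-i\<^esup>\<close> while \<open>b\<^sup>\<theta> \<le>
  2\<close>, so the sum is geometric with ratio \<open>1/2\<close> and its bound does not involve
  \<open>Q\<close>.\<close>

lemma low_levels_mean_bound:
  fixes v :: "real^'n::finite \<Rightarrow> real" and E I K \<theta> :: real and Q :: nat
  assumes v[measurable]: "v \<in> borel_measurable borel" and v0: "\<And>x. 0 \<le> v x"
    and \<rho>: "0 < \<rho>" and E: "1 \<le> E" and I: "0 < I" and Q: "1 \<le> Q"
    and \<theta>: "0 < \<theta>" "\<theta> \<le> 1 / (2 * real Q)"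
    and decay: "\<And>k. 0 < k \<Longrightarrow> k \<le> K \<Longrightarrow> frac x0 \<rho> {x. k \<le> v x} ^ Q \<le> E * I / k"
  shows "(\<integral>x. indicator (ball x0 \<rho> \<inter> {x. v x \<le> K}) x * v x powr \<theta> \<partial>lborel)
    \<le> measure lborel (ball x0 \<rho>) * (5 * E powr (1 / real Q) * I powr \<theta>)"
proof -
  let ?B = "ball x0 \<rho>"
  define m where "m = measure lborel ?B"
  have m: "0 < m" using \<rho> by (simp add: m_def)
  have [measurable]: "?B \<in> sets borel" by simp
  define b where "b = (4::real) ^ Q"
  have b: "1 < b" unfolding b_def using Q by (intro one_less_power) auto
  obtain N where "K / I < b ^ N" using real_arch_pow[OF b] by blast
  then have N: "K \<le> b ^ N * I" using I by (simp add: pos_divide_less_eq)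
  \<comment> \<open>Beyond the cap \<open>K\<close> the decay is unknown; the integral only sees levels below it.\<close>
  define S where "S i = (if b ^ i * I \<le> K then {x. b ^ i * I \<le> v x} else {})" for i :: nat
  have Sm[measurable]: "S i \<in> sets borel" for i unfolding S_def by simp
  define w where "w i = (b ^ Suc i * I) powr \<theta>" for i
  have w0: "0 \<le> w i" for i by (simp add: w_def)
  define T where "T x = indicator ?B x * I powr \<theta> + (\<Sum>i<N. w i * indicator (?B \<inter> S i) x)" for x
  have fB: "?B \<in> fmeasurable lborel" using ball_Int_fmeasurable[of UNIV x0 \<rho>] by simp
  have fS: "?B \<inter> S i \<in> fmeasurable lborel" for i by (rule ball_Int_fmeasurable) simp
  have iB: "integrable lborel (indicator ?B :: _ \<Rightarrow> real)"
    using fB by (auto simp: fmeasurable_def)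
  have iS: "integrable lborel (indicator (?B \<inter> S i) :: _ \<Rightarrow> real)" for i
    using fmeasurableD2[OF fS, of i] fmeasurableD[OF fS, of i] by (auto simp: less_top)
  have iT: "integrable lborel T"
    unfolding T_def by (intro Bochner_Integration.integrable_add Bochner_Integration.integrable_sum
        integrable_mult_right integrable_mult_left iB iS)
  have pt: "indicator (?B \<inter> {x. v x \<le> K}) x * v x powr \<theta> \<le> T x" for x
  proof (cases "x \<in> ?B \<and> v x \<le> K")
    case True
    have "v x powr \<theta> \<le> I powr \<theta> + (\<Sum>i<N. (b ^ Suc i * I) powr \<theta> * (if b ^ i * I \<le> v x then 1 else 0))"
      by (rule decay_layer_pointwise[OF v0 _ I b \<theta>(1) N]) (use True in simp)
    also have "(\<Sum>i<N. (b ^ Suc i * I) powr \<theta> * (if b ^ i * I \<le> v x then 1 else 0))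
        \<le> (\<Sum>i<N. w i * indicator (?B \<inter> S i) x)"
    proof (rule sum_mono)
      fix i
      show "(b ^ Suc i * I) powr \<theta> * (if b ^ i * I \<le> v x then 1 else 0) \<le> w i * indicator (?B \<inter> S i) x"
      proof (cases "b ^ i * I \<le> v x")
        case le: True
        then have "b ^ i * I \<le> K" using True by linarith
        then have "x \<in> ?B \<inter> S i" using le True unfolding S_def by simp
        then show ?thesis using le by (simp add: w_def)
      next
        case False
        then show ?thesis using w0[of i] by (simp add: indicator_def)
      qed
    qed
    finally show ?thesis using True unfolding T_def by (simp add: indicator_def)
  next
    case False
    have "0 \<le> T x" unfolding T_def using w0 by (intro add_nonneg_nonneg sum_nonneg mult_nonneg_nonneg) auto
    then show ?thesis using False by (auto simp: indicator_def)
  qed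
  have "(\<integral>x. indicator (?B \<inter> {x. v x \<le> K}) x * v x powr \<theta> \<partial>lborel) \<le> (\<integral>x. T x \<partial>lborel)"
  proof (rule integral_mono[OF _ iT pt])
    show "integrable lborel (\<lambda>x. indicator (?B \<inter> {x. v x \<le> K}) x * v x powr \<theta>)"
      by (rule Bochner_Integration.integrable_bound[OF iT])
        (measurable, use pt in \<open>auto intro!: AE_I2 order_trans[OF _ abs_ge_self] simp del: mem_ball\<close>)
  qed
  also have "(\<integral>x. T x \<partial>lborel) = m * I powr \<theta> + (\<Sum>i<N. w i * measure lborel (?B \<inter> S i))"
  proof -
    have i1: "integrable lborel (\<lambda>x. indicator ?B x * I powr \<theta>)"
      by (intro integrable_mult_left iB)
    have i2: "integrable lborel (\<lambda>x. w i * indicator (?B \<inter> S i) x)" for i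
      by (intro integrable_mult_right iS)
    have i3: "integrable lborel (\<lambda>x. \<Sum>i<N. w i * indicator (?B \<inter> S i) x)"
      by (intro Bochner_Integration.integrable_sum i2)
    have "(\<integral>x. T x \<partial>lborel) = (\<integral>x. indicator ?B x * I powr \<theta> \<partial>lborel)
        + (\<integral>x. (\<Sum>i<N. w i * indicator (?B \<inter> S i) x) \<partial>lborel)"
      unfolding T_def by (rule Bochner_Integration.integral_add[OF i1 i3])
    also have "(\<integral>x. (\<Sum>i<N. w i * indicator (?B \<inter> S i) x) \<partial>lborel)
        = (\<Sum>i<N. \<integral>x. w i * indicator (?B \<inter> S i) x \<partial>lborel)"
      by (rule Bochner_Integration.integral_sum[OF i2])
    finally show ?thesis by (simp add: m_def)
  qed
  also have "(\<Sum>i<N. w i * measure lborel (?B \<inter> S i))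
      \<le> (\<Sum>i<N. m * (2 * E powr (1 / real Q) * I powr \<theta>) * (1 / 2) ^ i)"
  proof (rule sum_mono)
    fix i
    have fr: "frac x0 \<rho> (S i) \<le> E powr (1 / real Q) * (1 / 4) ^ i"
    proof (cases "b ^ i * I \<le> K")
      case True
      have bi: "0 < b ^ i * I" using b I by simp
      have "frac x0 \<rho> (S i) ^ Q \<le> E * I / (b ^ i * I)"
        using decay[OF bi True] True by (simp add: S_def)
      also have "\<dots> = E / b ^ i" using I by simp
      also have "\<dots> = (E powr (1 / real Q) * (1 / 4) ^ i) ^ Q"
      proof -
        have "(E powr (1 / real Q)) ^ Q = E"
          by (rule powr_inverse_power) (use E Q in auto)
        moreover have "((1 / 4) ^ i) ^ Q = 1 / b ^ i"
          unfolding b_def by (simp add: power_divide flip: power_mult)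
        ultimately show ?thesis by (simp add: power_mult_distrib)
      qed
      finally show ?thesis
        by (rule power_mono_iff[THEN iffD1, rotated -1]) (use Q in \<open>auto simp: frac_nonneg\<close>)
    next
      case False
      then have "frac x0 \<rho> (S i) = 0" by (simp add: S_def frac_def)
      then show ?thesis by simp
    qed
    have wi: "w i \<le> 2 * 2 ^ i * I powr \<theta>"
    proof -
      have "b powr \<theta> = 4 powr (real Q * \<theta>)"
        unfolding b_def by (simp add: powr_realpow[symmetric] powr_powr)
      also have "\<dots> \<le> 4 powr (1 / 2)"
      proof (rule powr_mono)
        have "real Q * \<theta> \<le> real Q * (1 / (2 * real Q))" by (rule mult_left_mono[OF \<theta>(2)]) simp
        then show "real Q * \<theta> \<le> 1 / 2" using Q by simp
      qed simp
      also have "4 powr (1 / 2) = (2::real)" by (simp add: powr_half_sqrt)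
      finally have b2: "b powr \<theta> \<le> 2" .
      have "w i = (b powr \<theta>) ^ Suc i * I powr \<theta>"
        unfolding w_def powr_mult using b by (simp only: power_powr_commute)
      also have "\<dots> \<le> 2 ^ Suc i * I powr \<theta>"
        by (intro mult_right_mono power_mono b2) auto
      finally show ?thesis by simp
    qed
    have "w i * measure lborel (?B \<inter> S i) = w i * (frac x0 \<rho> (S i) * m)"
      unfolding frac_def m_def using m[unfolded m_def] by simp
    also have "\<dots> \<le> (2 * 2 ^ i * I powr \<theta>) * ((E powr (1 / real Q) * (1 / 4) ^ i) * m)"
      by (intro mult_mono wi mult_right_mono fr) (use m in \<open>auto simp: frac_nonneg\<close>)
    also have "\<dots> = m * (2 * E powr (1 / real Q) * I powr \<theta>) * (2 ^ i * (1 / 4) ^ i)"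
      by (simp only: mult_ac)
    also have "2 ^ i * (1 / 4) ^ i = (1 / 2 :: real) ^ i"
      unfolding power_mult_distrib[symmetric] by simp
    finally show "w i * measure lborel (?B \<inter> S i) \<le> m * (2 * E powr (1 / real Q) * I powr \<theta>) * (1 / 2) ^ i" .
  qed
  also have "(\<Sum>i<N. m * (2 * E powr (1 / real Q) * I powr \<theta>) * (1 / 2) ^ i)
      = m * (2 * E powr (1 / real Q) * I powr \<theta>) * (\<Sum>i<N. (1 / 2) ^ i)"
    by (simp only: sum_distrib_left)
  also have "\<dots> \<le> m * (2 * E powr (1 / real Q) * I powr \<theta>) * 2"
  proof (rule mult_left_mono)
    have "(\<Sum>i<N. (1 / 2 :: real) ^ i) = 2 - 2 * (1 / 2) ^ N"
      by (induction N) auto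
    then show "(\<Sum>i<N. (1 / 2 :: real) ^ i) \<le> 2" by simp
  qed (use m in simp)
  finally have fin: "(\<integral>x. indicator (?B \<inter> {x. v x \<le> K}) x * v x powr \<theta> \<partial>lborel)
    \<le> m * I powr \<theta> + m * (2 * E powr (1 / real Q) * I powr \<theta>) * 2" by simp
  have "m * I powr \<theta> * 1 \<le> m * I powr \<theta> * E powr (1 / real Q)"
    by (rule mult_left_mono) (use E m in \<open>auto intro: ge_one_powr_ge_zero\<close>)
  then show ?thesis using fin unfolding m_def by (simp add: algebra_simps)
qed

text \<open>Constants that depend on \<open>\<theta>\<close> through a power \<open>1/\<theta>\<close> would
  blow up as \<open>\<theta>\<close> tends to \<open>0\<close>. Monotonicity of power means
  reduces the estimate to one exponent.\<close>

lemma power_mean_mono: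
  fixes v :: "real^'n::finite \<Rightarrow> real" and \<theta> \<theta>0 :: real
  assumes v[measurable]: "v \<in> borel_measurable borel" and v0: "\<And>x. 0 \<le> v x"
    and \<rho>: "0 < \<rho>" and \<theta>: "0 < \<theta>" "\<theta> \<le> \<theta>0"
    and int: "integrable lborel (\<lambda>x. indicator (ball x0 \<rho>) x * v x powr \<theta>0)"
  shows "integrable lborel (\<lambda>x. indicator (ball x0 \<rho>) x * v x powr \<theta>)"
    and "((\<integral>x. indicator (ball x0 \<rho>) x * v x powr \<theta> \<partial>lborel) / measure lborel (ball x0 \<rho>)) powr (1 / \<theta>)
      \<le> ((\<integral>x. indicator (ball x0 \<rho>) x * v x powr \<theta>0 \<partial>lborel) / measure lborel (ball x0 \<rho>)) powr (1 / \<theta>0)"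
proof -
  let ?B = "ball x0 \<rho>"
  define p where "p = \<theta>0 / \<theta>"
  have p: "1 \<le> p" using \<theta> by (simp add: p_def)
  have pp: "(v x powr \<theta>) powr p = v x powr \<theta>0" for x using \<theta> by (simp add: p_def powr_powr)
  have gm: "(\<lambda>x. v x powr \<theta>) \<in> borel_measurable lborel" by measurable
  have Bm: "?B \<in> sets lborel" by simp
  have int': "integrable lborel (\<lambda>x. indicator ?B x * (v x powr \<theta>) powr p)"
    unfolding pp by (rule int)
  note H = holder_finite_measure[OF gm powr_ge_zero Bm emeasure_lborel_ball_finite p int']
  show "integrable lborel (\<lambda>x. indicator ?B x * v x powr \<theta>)" by (rule H(1))
  define m where "m = measure lborel ?B"
  have m: "0 < m" using \<rho> by (simp add: m_def)
  define X where "X = (\<integral>x. indicator ?B x * v x powr \<theta>0 \<partial>lborel)"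
  define Y where "Y = (\<integral>x. indicator ?B x * v x powr \<theta> \<partial>lborel)"
  have X0: "0 \<le> X" unfolding X_def by (intro integral_nonneg_AE) auto
  have Y0: "0 \<le> Y" unfolding Y_def by (intro integral_nonneg_AE) auto
  have "Y \<le> X powr (1 / p) * m powr (1 - 1 / p)"
    using H(2) unfolding pp X_def Y_def m_def .
  then have "Y / m \<le> X powr (1 / p) * m powr (1 - 1 / p) / m"
    by (rule divide_right_mono) (use m in simp)
  also have "\<dots> = (X / m) powr (1 / p)"
    using m by (simp add: powr_divide powr_diff)
  finally have "(Y / m) powr (1 / \<theta>) \<le> ((X / m) powr (1 / p)) powr (1 / \<theta>)"
    by (intro powr_mono2) (use \<theta> Y0 m in auto)
  also have "\<dots> = (X / m) powr (1 / \<theta>0)" using \<theta> by (simp add: powr_powr p_def)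
  finally show "(Y / m) powr (1 / \<theta>) \<le> (X / m) powr (1 / \<theta>0)" .
qed

text \<open>The mean of \<open>v\<close> to the power \<open>\<theta>\<^sub>0 = 1/(2Q + 2\<tau>)\<close> is
  split at the level \<open>K\<close>. Below \<open>K\<close>,
  \<open>low_levels_mean_bound\<close> applies. Above \<open>K\<close>, the moment hypothesis
  gives \<open>T\<^sup>\<theta>\<close> times a power at least \<open>1/2\<close> of the fraction
  of \<open>{v > K}\<close>, and by the decay hypothesis this fraction is at most \<open>(E I /
  K)\<^bsup>1/Q\<^esup>\<close>. Here \<open>\<tau>\<close> stands for \<open>1/s\<close>.\<close>

lemma integral_mean_from_decay:
  fixes v :: "real^'n::finite \<Rightarrow> real" and E I K T \<tau> \<theta> G :: real and Q :: nat
  assumes v[measurable]: "v \<in> borel_measurable borel" and v0: "\<And>x. 0 \<le> v x"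
    and \<rho>: "0 < \<rho>" and E: "1 \<le> E" and I: "0 < I" and Q: "1 \<le> Q" and K: "0 < K" and \<tau>: "0 \<le> \<tau>"
    and T: "0 \<le> T" and G: "1 \<le> G" "T / K \<le> G"
    and \<theta>: "0 < \<theta>" "\<theta> \<le> 1 / (2 * real Q + 2 * \<tau>)"
    and decay: "\<And>k. 0 < k \<Longrightarrow> k \<le> K \<Longrightarrow> frac x0 \<rho> {x. k \<le> v x} ^ Q \<le> E * I / k"
    and Ls: "\<And>D \<theta>. D \<in> sets borel \<Longrightarrow> D \<subseteq> ball x0 \<rho> \<Longrightarrow> 0 < \<theta> \<Longrightarrow> \<theta> * \<tau> \<le> 1 \<Longrightarrow>
      integrable lborel (\<lambda>x. indicator D x * v x powr \<theta>) \<and>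
      (\<integral>x. indicator D x * v x powr \<theta> \<partial>lborel)
        \<le> measure lborel (ball x0 \<rho>) * (T powr \<theta> * (measure lborel D / measure lborel (ball x0 \<rho>)) powr (1 - \<theta> * \<tau>))"
  shows "integrable lborel (\<lambda>x. indicator (ball x0 \<rho>) x * v x powr \<theta>)"
    and "((\<integral>x. indicator (ball x0 \<rho>) x * v x powr \<theta> \<partial>lborel) / measure lborel (ball x0 \<rho>)) powr (1 / \<theta>)
      \<le> I * G * 6 powr (2 * real Q + 2 * \<tau>) * E powr (2 + 2 * \<tau>)"
proof -
  let ?B = "ball x0 \<rho>"
  define m where "m = measure lborel ?B"
  have m: "0 < m" using \<rho> by (simp add: m_def)
  define \<theta>0 where "\<theta>0 = 1 / (2 * real Q + 2 * \<tau>)"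
  have den: "0 < 2 * real Q + 2 * \<tau>" using Q \<tau> by simp
  have \<theta>0: "0 < \<theta>0" using den by (simp add: \<theta>0_def)
  have \<theta>Q: "\<theta>0 \<le> 1 / (2 * real Q)"
    unfolding \<theta>0_def by (rule divide_left_mono) (use Q \<tau> den in auto)
  have \<theta>Q1: "\<theta>0 \<le> 1 / real Q"
  proof -
    have "1 / (2 * real Q) \<le> 1 / real Q" by (rule divide_left_mono) (use Q in auto)
    then show ?thesis using \<theta>Q by linarith
  qed
  have \<theta>\<tau>: "\<theta>0 * \<tau> \<le> 1 / 2"
    unfolding \<theta>0_def using den Q by (simp add: divide_le_eq)
  have iB: "integrable lborel (\<lambda>x. indicator ?B x * v x powr \<theta>0)"
    using Ls[of ?B \<theta>0] \<theta>0 \<theta>\<tau> by simp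
  have \<theta>le: "\<theta> \<le> \<theta>0" using \<theta> by (simp add: \<theta>0_def)
  note PM = power_mean_mono[OF v v0 \<rho> \<theta>(1) \<theta>le iB]
  show "integrable lborel (\<lambda>x. indicator ?B x * v x powr \<theta>)" by (rule PM(1))
  define X where "X = (\<integral>x. indicator ?B x * v x powr \<theta>0 \<partial>lborel)"
  define D1 where "D1 = ?B \<inter> {x. v x \<le> K}"
  define D2 where "D2 = ?B \<inter> {x. K < v x}"
  have Dm: "D1 \<in> sets borel" "D2 \<in> sets borel" unfolding D1_def D2_def by simp_all
  have Ds: "D1 \<subseteq> ?B" "D2 \<subseteq> ?B" unfolding D1_def D2_def by auto
  have L1: "integrable lborel (\<lambda>x. indicator D1 x * v x powr \<theta>0)"
    using Ls[OF Dm(1) Ds(1) \<theta>0] \<theta>\<tau> by simp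
  have L2: "integrable lborel (\<lambda>x. indicator D2 x * v x powr \<theta>0)"
    "(\<integral>x. indicator D2 x * v x powr \<theta>0 \<partial>lborel)
        \<le> m * (T powr \<theta>0 * (measure lborel D2 / m) powr (1 - \<theta>0 * \<tau>))"
    using Ls[OF Dm(2) Ds(2) \<theta>0] \<theta>\<tau> by (simp_all add: m_def)
  have "X = (\<integral>x. indicator D1 x * v x powr \<theta>0 + indicator D2 x * v x powr \<theta>0 \<partial>lborel)"
    unfolding X_def D1_def D2_def
    by (rule Bochner_Integration.integral_cong) (auto split: split_indicator simp del: mem_ball)
  also have "\<dots> = (\<integral>x. indicator D1 x * v x powr \<theta>0 \<partial>lborel) + (\<integral>x. indicator D2 x * v x powr \<theta>0 \<partial>lborel)"
    by (rule Bochner_Integration.integral_add[OF L1 L2(1)])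
  also have "\<dots> \<le> m * (5 * E powr (1 / real Q) * I powr \<theta>0) + m * (T powr \<theta>0 * (E * I / K) powr \<theta>0)"
  proof (rule add_mono)
    show "(\<integral>x. indicator D1 x * v x powr \<theta>0 \<partial>lborel) \<le> m * (5 * E powr (1 / real Q) * I powr \<theta>0)"
      unfolding D1_def m_def by (rule low_levels_mean_bound[OF v v0 \<rho> E I Q \<theta>0 \<theta>Q decay])
    define A where "A = frac x0 \<rho> {x. K \<le> v x}"
    have A: "0 \<le> A" "A \<le> 1" unfolding A_def by (rule frac_nonneg, rule frac_le_1) simp
    have DA: "measure lborel D2 / m \<le> A"
      unfolding D2_def A_def frac_def m_def
      by (rule divide_right_mono[OF measure_ball_mono]) auto
    have "(measure lborel D2 / m) powr (1 - \<theta>0 * \<tau>) \<le> A powr (1 - \<theta>0 * \<tau>)"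
      by (rule powr_mono2[OF _ _ DA]) (use \<theta>\<tau> m in auto)
    also have "\<dots> \<le> A powr (1 / 2)"
      by (rule powr_mono') (use A \<theta>\<tau> in auto)
    also have "\<dots> \<le> (E * I / K) powr \<theta>0"
    proof (cases "1 \<le> E * I / K")
      case True
      have "A powr (1 / 2) \<le> 1" by (rule powr_le1) (use A in auto)
      also have "1 \<le> (E * I / K) powr \<theta>0" by (rule ge_one_powr_ge_zero[OF True]) (use \<theta>0 in simp)
      finally show ?thesis .
    next
      case False
      have x0: "0 < E * I / K" using E I K by simp
      have "A ^ Q \<le> E * I / K" unfolding A_def by (rule decay[OF K order_refl])
      also have "\<dots> = ((E * I / K) powr (1 / real Q)) ^ Q"
        by (rule powr_inverse_power[OF x0 Q, symmetric])
      finally have "A \<le> (E * I / K) powr (1 / real Q)"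
        by (rule power_mono_iff[THEN iffD1, rotated -1]) (use Q A in auto)
      then have "A powr (1 / 2) \<le> ((E * I / K) powr (1 / real Q)) powr (1 / 2)"
        by (intro powr_mono2) (use A in auto)
      also have "\<dots> = (E * I / K) powr (1 / (2 * real Q))" by (simp add: powr_powr mult.commute)
      also have "\<dots> \<le> (E * I / K) powr \<theta>0"
        by (rule powr_mono'[OF \<theta>Q]) (use x0 False in linarith)+
      finally show ?thesis .
    qed
    finally have "m * (T powr \<theta>0 * (measure lborel D2 / m) powr (1 - \<theta>0 * \<tau>)) \<le> m * (T powr \<theta>0 * (E * I / K) powr \<theta>0)"
      by (intro mult_left_mono) (use m in auto)
    with L2(2) show "(\<integral>x. indicator D2 x * v x powr \<theta>0 \<partial>lborel) \<le> m * (T powr \<theta>0 * (E * I / K) powr \<theta>0)"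
      by linarith
  qed
  also have "\<dots> \<le> m * (5 * E powr (1 / real Q) * I powr \<theta>0 * G powr \<theta>0) + m * (E powr (1 / real Q) * I powr \<theta>0 * G powr \<theta>0)"
  proof (rule add_mono; rule mult_left_mono)
    have G1: "1 \<le> G powr \<theta>0" by (rule ge_one_powr_ge_zero[OF G(1)]) (use \<theta>0 in simp)
    show "5 * E powr (1 / real Q) * I powr \<theta>0 \<le> 5 * E powr (1 / real Q) * I powr \<theta>0 * G powr \<theta>0"
    proof -
      have "5 * E powr (1 / real Q) * I powr \<theta>0 * 1 \<le> 5 * E powr (1 / real Q) * I powr \<theta>0 * G powr \<theta>0"
        by (rule mult_left_mono[OF G1]) simp
      then show ?thesis by (simp only: mult_1_right)
    qed
    have "T powr \<theta>0 * (E * I / K) powr \<theta>0 = (E * I * (T / K)) powr \<theta>0"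
      unfolding powr_mult[symmetric] by (simp add: mult_ac)
    also have "\<dots> \<le> (E * I * G) powr \<theta>0"
      by (intro powr_mono2 mult_left_mono G) (use \<theta>0 E I K T in auto)
    also have "\<dots> = E powr \<theta>0 * I powr \<theta>0 * G powr \<theta>0" by (simp add: powr_mult)
    also have "\<dots> \<le> E powr (1 / real Q) * I powr \<theta>0 * G powr \<theta>0"
      by (intro mult_right_mono powr_mono \<theta>Q1 E) auto
    finally show "T powr \<theta>0 * (E * I / K) powr \<theta>0 \<le> E powr (1 / real Q) * I powr \<theta>0 * G powr \<theta>0" .
  qed (use m in auto)
  also have "\<dots> = m * (6 * E powr (1 / real Q) * I powr \<theta>0 * G powr \<theta>0)" by (simp add: algebra_simps)
  finally have Xm: "X / m \<le> 6 * E powr (1 / real Q) * I powr \<theta>0 * G powr \<theta>0"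
    using m by (simp add: pos_divide_le_eq mult.commute)
  have X0: "0 \<le> X" unfolding X_def by (intro integral_nonneg_AE) auto
  have "((\<integral>x. indicator ?B x * v x powr \<theta> \<partial>lborel) / measure lborel ?B) powr (1 / \<theta>) \<le> (X / m) powr (1 / \<theta>0)"
    using PM(2) unfolding X_def m_def .
  also have "\<dots> \<le> (6 * E powr (1 / real Q) * I powr \<theta>0 * G powr \<theta>0) powr (1 / \<theta>0)"
    by (rule powr_mono2[OF _ _ Xm]) (use \<theta>0 X0 m in auto)
  also have "\<dots> = 6 powr (1 / \<theta>0) * E powr (1 / real Q * (1 / \<theta>0)) * I * G"
    using \<theta>0 I G by (simp add: powr_mult powr_powr)
  also have "\<dots> \<le> 6 powr (1 / \<theta>0) * E powr (2 + 2 * \<tau>) * I * G"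
  proof (intro mult_right_mono mult_left_mono powr_mono E)
    have "1 / real Q * (1 / \<theta>0) = 2 + 2 * \<tau> / real Q"
      unfolding \<theta>0_def using Q by (simp add: add_divide_distrib)
    also have "\<dots> \<le> 2 + 2 * \<tau>"
    proof -
      have "2 * \<tau> / real Q \<le> 2 * \<tau> / 1" by (rule divide_left_mono) (use Q \<tau> in auto)
      then show ?thesis by simp
    qed
    finally show "1 / real Q * (1 / \<theta>0) \<le> 2 + 2 * \<tau>" .
  qed (use I G in auto)
  also have "\<dots> = I * G * 6 powr (2 * real Q + 2 * \<tau>) * E powr (2 + 2 * \<tau>)"
    by (simp add: \<theta>0_def mult_ac)
  finally show "((\<integral>x. indicator ?B x * v x powr \<theta> \<partial>lborel) / measure lborel ?B) powr (1 / \<theta>)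
      \<le> I * G * 6 powr (2 * real Q + 2 * \<tau>) * E powr (2 + 2 * \<tau>)" .
qed

section \<open>The structure conditions and the \<open>L\<^sup>s\<close> bound\<close>

text \<open>The two cases \<open>s = \<infinity>\<close> and \<open>s < \<infinity>\<close>, in terms of
  real numbers.\<close>

lemma recip_cases:
  assumes "0 < s"
  obtains "s = \<infinity>" "recip s = 0" | s' where "s = ennreal s'" "0 < s'" "recip s = 1 / s'" "enn2real s = s'"
proof (cases s)
  case top
  then have "s = \<infinity>" "recip s = 0" by (simp_all add: recip_def divide_ennreal_def)
  then show ?thesis by (rule that(1))
next
  case (real r)
  then have r: "0 < r" using assms by simp
  have "recip s = 1 / r"
    unfolding recip_def using real r by (simp add: ennreal_1[symmetric] divide_ennreal del: ennreal_1)
  then show ?thesis using real r that(2)[of r] by simp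
qed

lemma recip_nonneg: "0 \<le> recip s"
  by (simp add: recip_def)

text \<open>The exponent \<open>s\<^sub>\<star>\<close> is the inverse of \<open>1 + n/s\<close>, which is
  the power of \<open>\<rho>\<close> in \<open>\<rho>/K\<close>.\<close>

lemma s_star_recip:
  assumes "0 < s"
  shows "0 \<le> s_star n s" "s_star n s * (1 + real n * recip s) = 1"
proof -
  have "0 \<le> s_star n s \<and> s_star n s * (1 + real n * recip s) = 1"
    using assms
  proof (cases rule: recip_cases)
    case 1
    then show ?thesis by (simp add: s_star_def)
  next
    case (2 s')
    have "s_star n s = s' / (real n + s')" using 2 by (simp add: s_star_def)
    moreover have "1 + real n * recip s = (real n + s') / s'" using 2 by (simp add: add_divide_distrib)
    ultimately show ?thesis using 2 by simp
  qed
  then show "0 \<le> s_star n s" "s_star n s * (1 + real n * recip s) = 1" by simp_all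
qed

text \<open>For \<open>k \<le> (r/\<rho>) K\<close>, condition \<open>(\<lambda>)\<close> yields \<open>k
  \<le> \<lambda>(r) / |B\<^sub>r|\<^bsup>1/s\<^esup>\<close>, so
  \<open>(\<Lambda>\<^sub>s)\<close> applies; moreover \<open>r/k \<ge> \<rho>/K \<ge>
  \<rho>\<^bsup>1 + n/s\<^esup>\<close>, hence \<open>(r/k)\<^bsup>s\<^sub>\<star>\<^esup> \<ge>
  \<rho>\<close> and the bound \<open>\<mu>((r/k)\<^bsup>s\<^sub>\<star>\<^esup>)\<close> is at
  most \<open>\<mu>(\<rho>)\<close> by monotonicity.\<close>

lemma conditions_imp_admissible:
  fixes v :: "real^'n::finite \<Rightarrow> real" and x0 :: "real^'n"
  assumes DG: "DG_borel p \<Lambda> \<Omega> c q \<delta> v" and s: "0 < s"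
    and cL: "cond_Lambda_s s \<Omega> \<Lambda> lam mu" and cl: "cond_lambda lam" and \<rho>: "0 < \<rho>"
    and \<epsilon>: "0 < \<epsilon>" "\<epsilon> \<le> 1" "\<epsilon> \<le> measure lborel (ball (0::real^'n) 1) powr (- recip s)"
  shows "admissible p q c \<delta> \<Omega> \<Lambda> v \<rho> (\<epsilon> * lam \<rho> * \<rho> powr (- (CARD('n) * recip s))) (mu \<rho>)"
proof -
  let ?n = "CARD('n)"
  define \<tau> where "\<tau> = recip s"
  have \<tau>: "0 \<le> \<tau>" by (simp add: \<tau>_def recip_nonneg)
  define \<omega> where "\<omega> = measure lborel (ball (0::real^'n) 1)"
  have \<omega>: "0 < \<omega>" by (simp add: \<omega>_def)
  define K where "K = \<epsilon> * lam \<rho> * \<rho> powr (- (?n * \<tau>))"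
  have mono: "antimono_on {0<..} mu" and lr: "\<And>r. 0 < r \<Longrightarrow> 0 < lam r \<and> lam r \<le> 1"
    and mr: "\<And>r. 0 < r \<Longrightarrow> 1 \<le> mu r"
    using cL unfolding cond_Lambda_s_def by (auto simp: image_subset_iff)
  have bound: "\<forall>x0 r k. r > 0 \<and> ball x0 (8 * r) \<subseteq> \<Omega> \<and>
        r \<le> k \<and> k \<le> lam r / measure lebesgue (ball x0 r) powr recip s \<longrightarrow>
        \<Lambda> x0 r k \<le> mu ((r / k) powr s_star ?n s)"
    using cL unfolding cond_Lambda_s_def by (elim conjE)
  have K0: "0 < K" unfolding K_def using \<epsilon> lr[OF \<rho>] \<rho> by simp
  have main: "\<Lambda> y r k \<le> mu \<rho>"
    if r: "0 < r" "r \<le> \<rho>" "ball y (8 * r) \<subseteq> \<Omega>" and k: "r \<le> k" "k \<le> r / \<rho> * K" for y r k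
  proof -
    have k0: "0 < k" using r k by simp
    have kle: "k \<le> lam r / measure lebesgue (ball y r) powr recip s"
    proof -
      have "lam \<rho> \<le> \<rho> / r * lam r" using cl r unfolding cond_lambda_def by simp
      then have "r / \<rho> * lam \<rho> \<le> r / \<rho> * (\<rho> / r * lam r)" using r \<rho> by (intro mult_left_mono) auto
      then have l1: "r / \<rho> * lam \<rho> \<le> lam r" using r \<rho> by simp
      have l2: "\<rho> powr (- (?n * \<tau>)) \<le> r powr (- (?n * \<tau>))"
        by (rule powr_mono2'[OF _ r(1,2)]) (use \<tau> in auto)
      have "k \<le> \<epsilon> * (r / \<rho> * lam \<rho>) * \<rho> powr (- (?n * \<tau>))" using k(2) unfolding K_def by (simp add: mult_ac)
      also have "\<dots> \<le> \<omega> powr (- \<tau>) * lam r * r powr (- (?n * \<tau>))"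
        by (intro mult_mono l1 l2) (use \<epsilon> lr[OF r(1)] lr[OF \<rho>] r \<rho> in \<open>auto simp: \<omega>_def \<tau>_def\<close>)
      also have "\<dots> = lam r / (\<omega> powr \<tau> * r powr (?n * \<tau>))"
        by (simp add: powr_minus_divide)
      also have "\<omega> powr \<tau> * r powr (?n * \<tau>) = measure lebesgue (ball y r) powr recip s"
      proof -
        have m: "measure lebesgue (ball y r) = r ^ ?n * \<omega>"
          using content_ball_scale[of r y] r by (simp add: \<omega>_def)
        show ?thesis
          unfolding m powr_mult using r by (simp add: \<tau>_def powr_realpow[symmetric] powr_powr)
      qed
      finally show ?thesis .
    qed
    have "\<Lambda> y r k \<le> mu ((r / k) powr s_star ?n s)" using bound r k kle by blast
    also have "\<dots> \<le> mu \<rho>"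
    proof (rule monotone_onD[OF mono])
      have "\<rho> = (\<rho> powr (1 + ?n * \<tau>)) powr s_star ?n s"
        using s_star_recip(2)[OF s, of ?n] \<rho> by (simp add: powr_powr \<tau>_def mult.commute)
      also have "\<dots> \<le> (r / k) powr s_star ?n s"
      proof (rule powr_mono2)
        have "K \<le> 1 * 1 * \<rho> powr (- (?n * \<tau>))"
          unfolding K_def by (intro mult_mono) (use \<epsilon> lr[OF \<rho>] in auto)
        then have "\<rho> powr (?n * \<tau>) * K \<le> \<rho> powr (?n * \<tau>) * \<rho> powr (- (?n * \<tau>))"
          by (intro mult_left_mono) auto
        also have "\<dots> = 1" using \<rho> by (simp flip: powr_add)
        finally have nK: "\<rho> powr (?n * \<tau>) * K \<le> 1" .
        have "\<rho> powr (1 + ?n * \<tau>) * k \<le> \<rho> powr (1 + ?n * \<tau>) * (r / \<rho> * K)"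
          by (rule mult_left_mono[OF k(2)]) simp
        also have "\<dots> = r * (\<rho> powr (?n * \<tau>) * K)" using \<rho> by (simp add: powr_add)
        also have "\<dots> \<le> r * 1" by (rule mult_left_mono[OF nK]) (use r in simp)
        finally show "\<rho> powr (1 + ?n * \<tau>) \<le> r / k" using k0 by (simp add: pos_le_divide_eq)
      qed (use s_star_recip(1)[OF s] in auto)
      finally show "\<rho> \<le> (r / k) powr s_star ?n s" .
      show "\<rho> \<in> {0<..}" "(r / k) powr s_star ?n s \<in> {0<..}" using \<rho> r k0 by auto
    qed
    finally show ?thesis .
  qed
  show ?thesis
    unfolding admissible_def \<tau>_def[symmetric] K_def[symmetric]
    using DG \<rho> mr[OF \<rho>] K0 main by (intro conjI allI impI) (auto simp del: mem_ball)
qed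

text \<open>Hoelder's inequality for \<open>s < \<infinity>\<close>, the pointwise bound \<open>v \<le>
  d\<close> for \<open>s = \<infinity>\<close>.\<close>

lemma Lnorm_moment_bound:
  fixes u v :: "real^'n::finite \<Rightarrow> real" and d \<theta> :: real
  assumes s: "0 < s" and L: "Lnorm s B u \<le> ennreal d" and d: "0 \<le> d"
    and B: "B \<in> sets borel" "B \<subseteq> \<Omega>"
    and v[measurable]: "v \<in> borel_measurable borel" and v0: "\<And>x. 0 \<le> v x"
    and ae: "AE x in lborel. x \<in> \<Omega> \<longrightarrow> v x = u x"
    and D: "D \<in> sets borel" "D \<subseteq> B" "emeasure lborel D < \<infinity>"
    and \<theta>: "0 < \<theta>" "\<theta> * recip s \<le> 1"
  shows "integrable lborel (\<lambda>x. indicator D x * v x powr \<theta>)"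
    and "(\<integral>x. indicator D x * v x powr \<theta> \<partial>lborel) \<le> d powr \<theta> * measure lborel D powr (1 - \<theta> * recip s)"
proof -
  note [measurable] = D(1) B(1)
  have "integrable lborel (\<lambda>x. indicator D x * v x powr \<theta>) \<and>
    (\<integral>x. indicator D x * v x powr \<theta> \<partial>lborel) \<le> d powr \<theta> * measure lborel D powr (1 - \<theta> * recip s)"
    using s
  proof (cases rule: recip_cases)
    case 1
    have le: "esssup (lebesgue_on B) (\<lambda>x. ennreal (norm (u x))) \<le> ennreal d"
      using L 1 by (simp add: Lnorm_def)
    have "AE x in lebesgue_on B. ennreal (norm (u x)) \<le> ennreal d"
      using esssup_AE[of "\<lambda>x. ennreal (norm (u x))" "lebesgue_on B"]
    proof eventually_elim
      case (elim x)
      from this le show ?case by (rule order_trans)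
    qed
    then have "AE x in lebesgue_on B. \<bar>u x\<bar> \<le> d"
      using d by (simp add: ennreal_le_iff)
    then have "AE x in lebesgue. x \<in> B \<longrightarrow> \<bar>u x\<bar> \<le> d"
      by (subst (asm) AE_restrict_space_iff) (use B in auto)
    then have "AE x in lborel. x \<in> B \<longrightarrow> \<bar>u x\<bar> \<le> d" by (simp only: AE_completion_iff)
    with ae have aed: "AE x in lborel. indicator D x * v x powr \<theta> \<le> indicator D x * d powr \<theta>"
    proof eventually_elim
      case (elim x)
      show ?case
      proof (cases "x \<in> D")
        case True
        then have "v x \<le> d" using elim D B by auto
        then have "v x powr \<theta> \<le> d powr \<theta>" by (intro powr_mono2) (use \<theta> v0 in auto)
        then show ?thesis using True by simp
      qed simp
    qed
    have iD: "integrable lborel (\<lambda>x. indicator D x * d powr \<theta>)"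
      using D by (intro integrable_mult_left) (auto simp: less_top)
    have i: "integrable lborel (\<lambda>x. indicator D x * v x powr \<theta>)"
      by (rule Bochner_Integration.integrable_bound[OF iD], measurable) (use aed in eventually_elim, auto)
    have "(\<integral>x. indicator D x * v x powr \<theta> \<partial>lborel) \<le> (\<integral>x. indicator D x * d powr \<theta> \<partial>lborel)"
      by (rule integral_mono_AE[OF i iD aed])
    also have "\<dots> = d powr \<theta> * measure lborel D powr (1 - \<theta> * recip s)"
      using 1 by simp
    finally show ?thesis using i by blast
  next
    case (2 s')
    have si: "set_integrable lebesgue B (\<lambda>x. norm (u x) powr s')"
    proof (rule ccontr)
      assume "\<not> ?thesis"
      then have "Lnorm s B u = \<infinity>" using 2 unfolding Lnorm_def by simp
      then show False using L by (simp add: top_unique)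
    qed
    then have "Lnorm s B u = ennreal ((LINT x:B|lebesgue. norm (u x) powr s') powr (1 / s'))"
      using 2 unfolding Lnorm_def by simp
    then have le: "(LINT x:B|lebesgue. norm (u x) powr s') powr (1 / s') \<le> d"
      using L d by (simp add: ennreal_le_iff)
    have vm: "(\<lambda>x. v x powr s') \<in> borel_measurable borel" by measurable
    have aev: "AE x in lborel. x \<in> \<Omega> \<longrightarrow> v x powr s' = norm (u x) powr s'"
      using ae
    proof eventually_elim
      case (elim x)
      then show ?case using v0[of x] by auto
    qed
    note SB = set_integrable_lebesgue_borel[OF si vm aev B]
    define X where "X = (\<integral>x. indicator B x * v x powr s' \<partial>lborel)"
    have X0: "0 \<le> X" unfolding X_def by (intro integral_nonneg_AE) auto
    have "X powr (1 / s') \<le> d" using le unfolding SB(2) X_def .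
    then have "(X powr (1 / s')) powr s' \<le> d powr s'" by (intro powr_mono2) (use 2 in auto)
    then have Xd: "X \<le> d powr s'" using X0 2 by (simp add: powr_powr)
    define p where "p = s' / \<theta>"
    have p: "1 \<le> p" using \<theta> 2 by (simp add: p_def divide_le_eq le_divide_eq)
    have pp: "(v x powr \<theta>) powr p = v x powr s'" for x using \<theta> by (simp add: p_def powr_powr)
    have iDs: "integrable lborel (\<lambda>x. indicator D x * v x powr s')"
      by (rule Bochner_Integration.integrable_bound[OF SB(1)], measurable)
        (use D in \<open>auto intro!: AE_I2 split: split_indicator\<close>)
    have DX: "(\<integral>x. indicator D x * v x powr s' \<partial>lborel) \<le> X"
      unfolding X_def by (rule integral_mono[OF iDs SB(1)]) (use D in \<open>auto split: split_indicator\<close>)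
    have gm: "(\<lambda>x. v x powr \<theta>) \<in> borel_measurable lborel" by measurable
    have Dm: "D \<in> sets lborel" using D by simp
    have iDp: "integrable lborel (\<lambda>x. indicator D x * (v x powr \<theta>) powr p)" unfolding pp by (rule iDs)
    note H = holder_finite_measure[OF gm powr_ge_zero Dm D(3) p iDp]
    have "(\<integral>x. indicator D x * v x powr \<theta> \<partial>lborel)
        \<le> (\<integral>x. indicator D x * v x powr s' \<partial>lborel) powr (1 / p) * measure lborel D powr (1 - 1 / p)"
      using H(2) unfolding pp .
    also have "\<dots> \<le> (d powr s') powr (1 / p) * measure lborel D powr (1 - 1 / p)"
      by (intro mult_right_mono powr_mono2 order_trans[OF DX Xd]) (use p in \<open>auto intro!: integral_nonneg_AE\<close>)
    also have "(d powr s') powr (1 / p) = d powr \<theta>" using 2 \<theta> by (simp add: powr_powr p_def)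
    also have "1 - 1 / p = 1 - \<theta> * recip s" using 2 by (simp add: p_def)
    finally show ?thesis using H(1) by blast
  qed
  then show "integrable lborel (\<lambda>x. indicator D x * v x powr \<theta>)"
    "(\<integral>x. indicator D x * v x powr \<theta> \<partial>lborel) \<le> d powr \<theta> * measure lborel D powr (1 - \<theta> * recip s)"
    by simp_all
qed

section \<open>Essential infima\<close>

lemma ess_inf_on_ge:
  fixes u v :: "real^'n::finite \<Rightarrow> real"
  assumes u: "u \<in> borel_measurable (lebesgue_on \<Omega>)" and \<Omega>: "open \<Omega>" and B: "open B" "B \<subseteq> \<Omega>"
    and ae: "AE x in lborel. x \<in> \<Omega> \<longrightarrow> v x = u x" and l: "AE x in lborel. x \<in> B \<longrightarrow> l \<le> v x"
  shows "ereal l \<le> ess_inf_on B u"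
proof -
  have uB: "u \<in> borel_measurable (lebesgue_on B)"
    using measurable_restrict_mono[OF u B(2)] by simp
  have um: "(\<lambda>x. - ereal (u x)) \<in> borel_measurable (lebesgue_on B)"
    using uB by measurable
  have "AE x in lborel. x \<in> B \<longrightarrow> - ereal (u x) \<le> ereal (- l)"
    using ae l by eventually_elim (use B in auto)
  then have "AE x in lebesgue. x \<in> B \<longrightarrow> - ereal (u x) \<le> ereal (- l)" by (simp only: AE_completion_iff)
  then have "AE x in lebesgue_on B. - ereal (u x) \<le> ereal (- l)"
    by (subst AE_restrict_space_iff) (use B in auto)
  then have "esssup (lebesgue_on B) (\<lambda>x. - ereal (u x)) \<le> ereal (- l)"
    by (rule esssup_I[OF um])
  then show ?thesis
    unfolding ess_inf_on_def by (metis ereal_minus_le_minus ereal_uminus_uminus uminus_ereal.simps(1))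
qed

lemma ess_inf_on_real:
  fixes u v :: "real^'n::finite \<Rightarrow> real"
  assumes u: "u \<in> borel_measurable (lebesgue_on \<Omega>)" and \<Omega>: "open \<Omega>" and B: "open B" "B \<subseteq> \<Omega>" "B \<noteq> {}"
    and ae: "AE x in lborel. x \<in> \<Omega> \<longrightarrow> v x = u x" and v0: "\<And>x. 0 \<le> v x"
  obtains i where "ess_inf_on B u = ereal i" "0 \<le> i"
proof -
  have ge: "ereal 0 \<le> ess_inf_on B u"
    by (rule ess_inf_on_ge[OF u \<Omega> B(1,2) ae]) (use v0 in auto)
  have "ess_inf_on B u \<noteq> \<infinity>"
  proof
    assume "ess_inf_on B u = \<infinity>"
    then have e: "esssup (lebesgue_on B) (\<lambda>x. - ereal (u x)) = - \<infinity>"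
      unfolding ess_inf_on_def by (simp add: ereal_uminus_eq_reorder)
    have "AE x in lebesgue_on B. - ereal (u x) \<le> - \<infinity>"
      using esssup_AE[of "\<lambda>x. - ereal (u x)" "lebesgue_on B"] unfolding e .
    then have "AE x in lebesgue_on B. False" by eventually_elim simp
    then have "AE x in lebesgue. x \<in> B \<longrightarrow> False"
      by (subst (asm) AE_restrict_space_iff) (use B in auto)
    then have "AE x in lborel. x \<notin> B" by (simp add: AE_completion_iff)
    then have "emeasure lborel B = 0" using B by (subst (asm) AE_iff_measurable[of B]) auto
    moreover have "0 < emeasure lborel B" using open_not_negligible[OF B(1,3)] B(1)
      by (auto simp: negligible_iff_null_sets null_sets_def zero_less_iff_neq_zero)
    ultimately show False by simp
  qed
  then obtain i where "ess_inf_on B u = ereal i" using ge by (cases "ess_inf_on B u") auto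
  then show ?thesis using ge that[of i] by simp
qed

text \<open>Collects the constants of \<open>integral_mean_from_decay\<close> in one exponential; \<open>ln
  M \<le> M\<close> absorbs the factor \<open>M\<^bsup>Q/p\<^esup>\<close> contained in
  \<open>E\<close>.\<close>

lemma exponential_constant_bound:
  fixes M c0 p \<tau> :: real and J :: nat
  assumes M: "1 \<le> M" and c0: "0 < c0" "c0 \<le> 1" and p: "1 < p" and \<tau>: "0 \<le> \<tau>"
  defines "E \<equiv> 2 * 2 ^ ((J + 1) * 449) * (M powr (1 / p) / c0) ^ (J + 2)"
  shows "1 \<le> E"
    and "6 powr (2 * real (J + 2) + 2 * \<tau>) * E powr (2 + 2 * \<tau>)
      \<le> exp ((2 + 2 * \<tau>) * (ln 6 + 450 + 1 / p + ln (1 / c0)) * (real (J + 2) * M))"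
proof -
  define Q where "Q = real (J + 2)"
  have Q: "1 \<le> Q" by (simp add: Q_def)
  have Mp: "1 \<le> M powr (1 / p)" by (rule ge_one_powr_ge_zero[OF M]) (use p in simp)
  have base: "1 \<le> M powr (1 / p) / c0" using Mp c0 by (simp add: le_divide_eq)
  have E2: "1 \<le> (2::real) ^ ((J + 1) * 449)" by (rule one_le_power) simp
  have E3: "1 \<le> (M powr (1 / p) / c0) ^ (J + 2)" by (rule one_le_power[OF base])
  have "1 * 1 * 1 \<le> 2 * 2 ^ ((J + 1) * 449) * (M powr (1 / p) / c0) ^ (J + 2)"
    by (intro mult_mono) (use E2 E3 in auto)
  then show E1: "1 \<le> E" unfolding E_def by simp
  have lnc: "0 \<le> ln (1 / c0)" using c0 by (intro ln_ge_zero) (simp add: le_divide_eq)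
  have lnM: "ln M \<le> M" using ln_le_minus_one[of M] M by simp
  have lnE: "ln E \<le> Q * M * (450 + 1 / p + ln (1 / c0))"
  proof -
    have "ln E = ln 2 + real ((J + 1) * 449) * ln 2 + Q * ln (M powr (1 / p) / c0)"
    proof -
      have ln3: "ln (2 * a * w) = ln 2 + ln a + ln w" if "0 < a" "0 < w" for a w :: real
        using that by (simp add: ln_mult)
      have "ln E = ln 2 + ln (2 ^ ((J + 1) * 449)) + ln ((M powr (1 / p) / c0) ^ (J + 2))"
        unfolding E_def by (rule ln3) (use E2 E3 in linarith)+
      also have "ln ((2::real) ^ ((J + 1) * 449)) = real ((J + 1) * 449) * ln 2"
        by (rule ln_realpow)
      also have "ln ((M powr (1 / p) / c0) ^ (J + 2)) = real (J + 2) * ln (M powr (1 / p) / c0)"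
        by (rule ln_realpow)
      finally show ?thesis unfolding Q_def .
    qed
    also have "ln (M powr (1 / p) / c0) = ln M / p + ln (1 / c0)"
      using M c0 by (simp add: ln_div ln_powr)
    also have "ln 2 + real ((J + 1) * 449) * ln 2 \<le> Q * 450"
    proof -
      have "ln (2::real) \<le> 1" using ln_le_minus_one[of "2::real"] by simp
      then have "ln 2 + real ((J + 1) * 449) * ln 2 \<le> 1 + real ((J + 1) * 449) * 1"
        by (intro add_mono mult_left_mono) auto
      also have "\<dots> \<le> Q * 450" by (simp add: Q_def)
      finally show ?thesis .
    qed
    finally have "ln E \<le> Q * 450 + Q * (ln M / p + ln (1 / c0))" by simp
    also have "\<dots> \<le> Q * (M * 450) + Q * (M * (1 / p) + M * ln (1 / c0))"
    proof (intro add_mono mult_left_mono)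
      show "450 \<le> M * 450" using M by simp
      have "ln M / p \<le> M / p" by (rule divide_right_mono[OF lnM]) (use p in simp)
      then show "ln M / p \<le> M * (1 / p)" by simp
      have "1 * ln (1 / c0) \<le> M * ln (1 / c0)" by (rule mult_right_mono[OF M lnc])
      then show "ln (1 / c0) \<le> M * ln (1 / c0)" by simp
    qed (use Q in auto)
    also have "\<dots> = Q * M * (450 + 1 / p + ln (1 / c0))" by (simp add: distrib_left mult.assoc)
    finally show ?thesis .
  qed
  have X: "(2 * Q + 2 * \<tau>) * ln 6 \<le> (2 + 2 * \<tau>) * (Q * M) * ln 6"
  proof (rule mult_right_mono)
    have "\<tau> * 1 \<le> \<tau> * Q" by (rule mult_left_mono[OF Q \<tau>])
    then have "2 * Q + 2 * \<tau> \<le> (2 + 2 * \<tau>) * (Q * 1)" by (simp add: distrib_right)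
    also have "\<dots> \<le> (2 + 2 * \<tau>) * (Q * M)" by (intro mult_left_mono M) (use Q \<tau> in auto)
    finally show "2 * Q + 2 * \<tau> \<le> (2 + 2 * \<tau>) * (Q * M)" .
  qed simp
  have "6 powr (2 * Q + 2 * \<tau>) * E powr (2 + 2 * \<tau>) = exp ((2 * Q + 2 * \<tau>) * ln 6 + (2 + 2 * \<tau>) * ln E)"
    using E1 by (simp add: powr_def exp_add)
  also have "\<dots> \<le> exp ((2 + 2 * \<tau>) * (Q * M) * ln 6 + (2 + 2 * \<tau>) * (Q * M * (450 + 1 / p + ln (1 / c0))))"
    unfolding exp_le_cancel_iff by (intro add_mono X mult_left_mono lnE) (use \<tau> in auto)
  also have "(2 + 2 * \<tau>) * (Q * M) * ln 6 + (2 + 2 * \<tau>) * (Q * M * (450 + 1 / p + ln (1 / c0)))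
      = (2 + 2 * \<tau>) * (ln 6 + 450 + 1 / p + ln (1 / c0)) * (Q * M)"
    by (simp only: distrib_left distrib_right mult_ac add_ac)
  finally show "6 powr (2 * real (J + 2) + 2 * \<tau>) * E powr (2 + 2 * \<tau>)
      \<le> exp ((2 + 2 * \<tau>) * (ln 6 + 450 + 1 / p + ln (1 / c0)) * (real (J + 2) * M))"
    unfolding Q_def .
qed

section \<open>The weak Harnack inequality\<close>

lemma set_integrable_from_borel:
  fixes f f' :: "real^'n::finite \<Rightarrow> real"
  assumes f: "f \<in> borel_measurable (lebesgue_on \<Omega>)" and \<Omega>: "open \<Omega>"
    and f': "f' \<in> borel_measurable borel" "integrable lborel (\<lambda>x. indicator S x * f' x)"
    and ae: "AE x in lborel. x \<in> \<Omega> \<longrightarrow> f' x = f x" and S: "S \<in> sets borel" "S \<subseteq> \<Omega>"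
  shows "set_integrable lebesgue S f"
proof -
  have m: "(\<lambda>x. indicator S x * f' x) \<in> borel_measurable lborel" using f'(2) by auto
  have m2: "(\<lambda>x. indicator S x * f' x) \<in> borel_measurable lebesgue" using m by (rule measurable_completion)
  have fm: "(\<lambda>x. if x \<in> \<Omega> then f x else 0) \<in> borel_measurable lebesgue"
    using f \<Omega> by (subst borel_measurable_if) auto
  have Sl: "S \<in> sets lebesgue" using S(1) by simp
  have "(\<lambda>x. indicator S x *\<^sub>R (if x \<in> \<Omega> then f x else 0)) \<in> borel_measurable lebesgue"
    by (intro borel_measurable_scaleR borel_measurable_indicator Sl fm)
  moreover have "(\<lambda>x. indicator S x *\<^sub>R (if x \<in> \<Omega> then f x else 0)) = (\<lambda>x. indicator S x *\<^sub>R f x)"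
    using S(2) by (intro ext) (auto split: split_indicator)
  ultimately have m1: "(\<lambda>x. indicator S x *\<^sub>R f x) \<in> borel_measurable lebesgue" by simp
  have ae': "AE x in lebesgue. indicator S x *\<^sub>R f x = indicator S x * f' x"
    unfolding AE_completion_iff using ae
    by eventually_elim (use S in \<open>auto split: split_indicator\<close>)
  have "integrable lebesgue (\<lambda>x. indicator S x * f' x)"
    using f'(2) integrable_completion[OF m] by simp
  then show ?thesis
    unfolding set_integrable_def using integrable_cong_AE[OF m1 m2 ae'] by simp
qed

text \<open>Solves the lower bound of \<open>power_like_positivity\<close> for the fraction \<open>A\<close>
  of the superlevel set.\<close>

lemma level_decay:
  fixes p M c0 \<rho> I A k :: real and J :: nat
  assumes M: "1 \<le> M" and c0: "0 < c0" and k: "0 < k"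
    and le: "(c0 * A * M powr (- (1 / p))) ^ (J + 2) * (k / 2) / 2 ^ ((J + 1) * 449) \<le> I"
  shows "A ^ (J + 2) \<le> 2 * 2 ^ ((J + 1) * 449) * (M powr (1 / p) / c0) ^ (J + 2) * I / k"
proof -
  define E where "E = 2 * 2 ^ ((J + 1) * 449) * (M powr (1 / p) / c0) ^ (J + 2)"
  have E0: "0 \<le> E" unfolding E_def using c0 by (intro mult_nonneg_nonneg zero_le_power) auto
  have one: "c0 * A * M powr (- (1 / p)) * (M powr (1 / p) / c0) = A"
  proof -
    have "M powr (- (1 / p)) * M powr (1 / p) = 1" using M by (simp flip: powr_add)
    then have "c0 * A * (M powr (- (1 / p)) * M powr (1 / p)) / c0 = A" using c0 by simp
    then show ?thesis by (simp only: mult_ac times_divide_eq_right)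
  qed
  have "A ^ (J + 2) = (c0 * A * M powr (- (1 / p))) ^ (J + 2) * (M powr (1 / p) / c0) ^ (J + 2)"
    unfolding power_mult_distrib[symmetric] one ..
  then have "A ^ (J + 2) * k = (c0 * A * M powr (- (1 / p))) ^ (J + 2) * (k / 2) / 2 ^ ((J + 1) * 449) * E"
    unfolding E_def by simp
  also have "\<dots> \<le> I * E" by (rule mult_right_mono[OF le E0])
  finally have "A ^ (J + 2) * k \<le> E * I" by (simp only: mult.commute)
  then show ?thesis unfolding E_def[symmetric] using k by (simp only: pos_le_divide_eq)
qed

theorem theorem1p1:
  fixes p q c \<delta> d :: real and s :: ennreal
  assumes "1 < p" and "p \<le> q" and "0 < c"
    and "0 \<le> \<delta>" and "\<delta> < p / real CARD('n::finite)"
    and "0 < s" and "0 \<le> d"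
  shows "\<exists>C1 > 0. \<exists>C2 > 0. \<exists>\<beta> > 0.
    \<forall>(\<Omega> :: (real^'n) set) \<Lambda> lam mu u.
      open \<Omega> \<and> connected \<Omega> \<and> bounded \<Omega> \<and>
      (\<forall>x\<in>\<Omega>. \<forall>r>0. \<forall>k>0. \<Lambda> x r k > 0) \<and>
      cond_Lambda_s s \<Omega> \<Lambda> lam mu \<and> cond_lambda lam \<and>
      u \<in> DG_minus p \<Lambda> \<Omega> c q \<delta> \<and> u \<in> L_loc s \<Omega> \<and>
      (AE x in lebesgue_on \<Omega>. 0 \<le> u x) \<longrightarrow>
      (\<forall>x0 \<rho> \<theta>.
        0 < \<rho> \<and> ball x0 (8 * \<rho>) \<subseteq> \<Omega> \<and>
        Lnorm s (ball x0 (2 * \<rho>)) u \<le> ennreal d \<and>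
        0 < \<theta> \<and> \<theta> < 1 / (C1 * mu \<rho> powr \<beta> + 2 * recip s) \<longrightarrow>
        set_integrable lebesgue (ball x0 \<rho>) (\<lambda>x. u x powr \<theta>) \<and>
        ereal ((1 / measure lebesgue (ball x0 \<rho>) *
                 (LINT x:ball x0 \<rho>|lebesgue. u x powr \<theta>)) powr (1 / \<theta>))
        \<le> ereal (C2 / lam \<rho> * exp (C1 * mu \<rho> powr \<beta>)) *
            (ess_inf_on (ball x0 (\<rho> / 2)) u + ereal \<rho>))"
proof -
  let ?n = "CARD('n)"
  have p: "1 < p" and q: "0 \<le> q" and c: "0 < c" and \<delta>: "0 \<le> \<delta>" and s: "0 < s" and d: "0 \<le> d"
    using assms by auto
  have n: "0 < real ?n" by simp
  \<comment> \<open>The midpoint of the admissible range \<open>(\<delta>/p, 1/n)\<close>.\<close>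
  define \<alpha> where "\<alpha> = (\<delta> / p + 1 / real ?n) / 2"
  have \<alpha>: "\<delta> / p < \<alpha>" "real ?n * \<alpha> < 1"
  proof -
    have mid: "x < (x + y) / 2" "(x + y) / 2 < y" if "x < y" for x y :: real
      using that by simp_all
    have lt: "\<delta> / p < 1 / real ?n" using assms(5) p n by (simp add: field_simps)
    show "\<delta> / p < \<alpha>" unfolding \<alpha>_def by (rule mid(1)[OF lt])
    have "\<alpha> < 1 / real ?n" unfolding \<alpha>_def by (rule mid(2)[OF lt])
    then show "real ?n * \<alpha> < 1" using n by (simp add: pos_less_divide_eq mult.commute)
  qed
  obtain C b c0 where C: "1 \<le> C" and b: "0 \<le> b" and c0: "0 < c0" "c0 \<le> 1 / 256"
    and pos: "\<forall>\<Omega> \<Lambda> (v :: real^'n \<Rightarrow> real) \<rho> K M x0 k J.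
      admissible p q c \<delta> \<Omega> \<Lambda> v \<rho> K M \<longrightarrow> ball x0 (8 * \<rho>) \<subseteq> \<Omega> \<longrightarrow> \<rho> \<le> k \<longrightarrow> k \<le> K / 8 \<longrightarrow>
      C * M powr b \<le> real J \<longrightarrow>
      \<rho> \<le> (c0 * frac x0 \<rho> {x. k \<le> v x} * M powr (- (1 / p))) ^ (J + 2) * (k / 2) / 2 ^ ((J + 1) * 449) \<longrightarrow>
      (AE x in lborel. x \<in> ball x0 (\<rho> / 2) \<longrightarrow>
        (c0 * frac x0 \<rho> {x. k \<le> v x} * M powr (- (1 / p))) ^ (J + 2) * (k / 2) / 2 ^ ((J + 1) * 449) \<le> v x)"
    using power_like_positivity[OF p c q \<delta> \<alpha>] by (elim exE conjE) (rule that)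
  define \<tau> where "\<tau> = recip s"
  have \<tau>: "0 \<le> \<tau>" by (simp add: \<tau>_def recip_nonneg)
  define \<omega> where "\<omega> = measure lborel (ball (0::real^'n) 1)"
  have \<omega>: "0 < \<omega>" by (simp add: \<omega>_def)
  define \<epsilon> where "\<epsilon> = min 1 (\<omega> powr (- \<tau>))"
  have \<epsilon>: "0 < \<epsilon>" "\<epsilon> \<le> 1" "\<epsilon> \<le> \<omega> powr (- \<tau>)" using \<omega> by (auto simp: \<epsilon>_def)
  define L where "L = ln 6 + 450 + 1 / p + ln (1 / c0)"
  have L: "1 \<le> L"
  proof -
    have "0 \<le> ln (6::real)" "0 \<le> 1 / p" "0 \<le> ln (1 / c0)"
      using p c0 by (auto intro!: ln_ge_zero simp: le_divide_eq)
    then show ?thesis unfolding L_def by linarith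
  qed
  define C1 where "C1 = (2 + 2 * \<tau>) * L * (C + 3)"
  define C2 where "C2 = 1 + 8 * d * \<omega> powr (- \<tau>) / \<epsilon>"
  define \<beta> where "\<beta> = b + 1"
  have C1: "0 < C1" unfolding C1_def using \<tau> L C by (intro mult_pos_pos) auto
  have C2: "1 \<le> C2" unfolding C2_def using d \<epsilon> by simp
  have \<beta>: "0 < \<beta>" using b by (simp add: \<beta>_def)
  have concl: "set_integrable lebesgue (ball x0 \<rho>) (\<lambda>x. u x powr \<theta>) \<and>
        ereal ((1 / measure lebesgue (ball x0 \<rho>) *
                 (LINT x:ball x0 \<rho>|lebesgue. u x powr \<theta>)) powr (1 / \<theta>))
        \<le> ereal (C2 / lam \<rho> * exp (C1 * mu \<rho> powr \<beta>)) *
            (ess_inf_on (ball x0 (\<rho> / 2)) u + ereal \<rho>)"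
    if \<Omega>: "open \<Omega>" and cL: "cond_Lambda_s s \<Omega> \<Lambda> lam mu" and cl: "cond_lambda lam"
      and uDG: "u \<in> DG_minus p \<Lambda> \<Omega> c q \<delta>" and u0: "AE x in lebesgue_on \<Omega>. 0 \<le> u x"
      and \<rho>: "0 < \<rho>" and bl: "ball x0 (8 * \<rho>) \<subseteq> \<Omega>" and Ln: "Lnorm s (ball x0 (2 * \<rho>)) u \<le> ennreal d"
      and \<theta>: "0 < \<theta>" "\<theta> < 1 / (C1 * mu \<rho> powr \<beta> + 2 * recip s)"
    for \<Omega> :: "(real^'n) set" and \<Lambda> lam mu u x0 \<rho> \<theta>
  proof -
    have um: "u \<in> borel_measurable (lebesgue_on \<Omega>)"
      using uDG by (auto simp: DG_minus_def W1_loc_def L_loc_def)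
    obtain f where f: "f \<in> borel_measurable borel" and aef: "AE x in lborel. x \<in> \<Omega> \<longrightarrow> f x = u x"
      using um \<Omega> by (rule borel_representative)
    define v where "v x = max (f x) 0" for x
    have v: "v \<in> borel_measurable borel" unfolding v_def using f by measurable
    have v0: "0 \<le> v x" for x by (simp add: v_def)
    have "AE x in lebesgue. x \<in> \<Omega> \<longrightarrow> 0 \<le> u x"
      using u0 by (subst (asm) AE_restrict_space_iff) (use \<Omega> in auto)
    then have "AE x in lborel. x \<in> \<Omega> \<longrightarrow> 0 \<le> u x" by (simp only: AE_completion_iff)
    with aef have aev: "AE x in lborel. x \<in> \<Omega> \<longrightarrow> v x = u x"
      by eventually_elim (auto simp: v_def)
    have p0: "0 < p" using p by simp
    note DG = DG_minus_imp_DG_borel[OF \<Omega> uDG p0 v aev]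
    define M where "M = mu \<rho>"
    define l where "l = lam \<rho>"
    define K0 where "K0 = \<epsilon> * l * \<rho> powr (- (?n * \<tau>))"
    have M: "1 \<le> M" and l: "0 < l" "l \<le> 1"
      using cL \<rho> unfolding cond_Lambda_s_def M_def l_def by (auto simp: image_subset_iff)
    have adm: "admissible p q c \<delta> \<Omega> \<Lambda> v \<rho> K0 M"
      unfolding K0_def M_def l_def \<tau>_def
      by (rule conditions_imp_admissible[OF DG s cL cl \<rho> \<epsilon>(1,2) \<epsilon>(3)[unfolded \<omega>_def \<tau>_def]])
    \<comment> \<open>\<open>local_clustering\<close> works at radius \<open>\<rho>/4\<close>, where
      the cap on levels is lower.\<close>
    define K where "K = K0 / 8"
    have K: "0 < K" using \<epsilon> l \<rho> by (simp add: K_def K0_def)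
    define J where "J = nat \<lceil>C * M powr b\<rceil>"
    have Mb: "1 \<le> M powr b" by (rule ge_one_powr_ge_zero[OF M b])
    have J: "C * M powr b \<le> real J" unfolding J_def by (rule real_nat_ceiling_ge)
    have J2: "real (J + 2) \<le> (C + 3) * M powr b"
    proof -
      have "0 \<le> C * M powr b" using C by simp
      then have "real J \<le> C * M powr b + 1" unfolding J_def by linarith
      then have "real (J + 2) \<le> C * M powr b + 3" by simp
      also have "\<dots> \<le> C * M powr b + 3 * M powr b" using Mb by simp
      finally show ?thesis by (simp only: distrib_right)
    qed
    define I0 where "I0 = (C + 3) * M powr \<beta>"
    have QM: "real (J + 2) * M \<le> I0"
    proof -
      have "real (J + 2) * M \<le> (C + 3) * M powr b * M" by (rule mult_right_mono[OF J2]) (use M in simp)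
      also have "\<dots> = I0" unfolding I0_def \<beta>_def using M by (simp add: powr_add)
      finally show ?thesis .
    qed
    have C1I: "C1 * M powr \<beta> = (2 + 2 * \<tau>) * L * I0" unfolding C1_def I0_def by (simp only: mult.assoc)
    have twoQ: "2 * real (J + 2) \<le> C1 * M powr \<beta>"
    proof -
      have Q0: "0 \<le> real (J + 2)" by simp
      have "real (J + 2) * 1 \<le> real (J + 2) * M" by (rule mult_left_mono[OF M Q0])
      also note QM
      finally have "real (J + 2) \<le> I0" by (simp only: mult_1_right)
      then have "2 * real (J + 2) \<le> 2 * I0" by simp
      also have "\<dots> \<le> (2 + 2 * \<tau>) * L * I0"
      proof (rule mult_right_mono)
        have "2 * 1 \<le> (2 + 2 * \<tau>) * L" by (rule mult_mono) (use \<tau> L in auto)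
        then show "2 \<le> (2 + 2 * \<tau>) * L" by simp
        show "0 \<le> I0" unfolding I0_def using C by simp
      qed
      finally show ?thesis unfolding C1I .
    qed
    have \<theta>Q: "\<theta> \<le> 1 / (2 * real (J + 2) + 2 * \<tau>)"
    proof -
      have "1 / (C1 * M powr \<beta> + 2 * \<tau>) \<le> 1 / (2 * real (J + 2) + 2 * \<tau>)"
        by (rule divide_left_mono) (use twoQ \<tau> in \<open>auto intro!: mult_pos_pos add_pos_nonneg\<close>)
      then show ?thesis using \<theta>(2) unfolding M_def \<tau>_def by linarith
    qed
    have subs: "ball x0 (\<rho> / 2) \<subseteq> \<Omega>" "ball x0 \<rho> \<subseteq> \<Omega>" "ball x0 (2 * \<rho>) \<subseteq> \<Omega>" "ball x0 \<rho> \<subseteq> ball x0 (2 * \<rho>)"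
      using bl \<rho> by (auto simp: subset_iff)
    have ne: "ball x0 (\<rho> / 2) \<noteq> {}" using \<rho> by simp
    obtain i0 where i0: "ess_inf_on (ball x0 (\<rho> / 2)) u = ereal i0" "0 \<le> i0"
      by (rule ess_inf_on_real[OF um \<Omega> open_ball subs(1) ne aev v0])
    define I where "I = i0 + \<rho>"
    have I: "0 < I" using i0 \<rho> by (simp add: I_def)
    define E where "E = 2 * 2 ^ ((J + 1) * 449) * (M powr (1 / p) / c0) ^ (J + 2)"
    have c01: "c0 \<le> 1" using c0 by simp
    have E1: "1 \<le> E" unfolding E_def by (rule exponential_constant_bound(1)[OF M c0(1) c01 p \<tau>])
    \<comment> \<open>For \<open>k < \<rho>\<close> the claim is trivial since \<open>I \<ge>
      \<rho>\<close>, and so it is when the lower bound \<open>z\<close> drops below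
      \<open>\<rho>\<close>.\<close>
    have decay: "frac x0 \<rho> {x. k \<le> v x} ^ (J + 2) \<le> E * I / k" if k: "0 < k" "k \<le> K" for k
    proof (cases "\<rho> \<le> k")
      case False
      have "{x. k \<le> v x} \<in> sets borel" using v by measurable
      then have "frac x0 \<rho> {x. k \<le> v x} ^ (J + 2) \<le> 1"
        by (intro power_le_one frac_nonneg frac_le_1)
      also have "1 \<le> I / k" using False k i0 by (simp add: I_def)
      also have "I / k \<le> E * I / k"
        using E1 I k by (intro divide_right_mono) auto
      finally show ?thesis .
    next
      case True
      define A where "A = frac x0 \<rho> {x. k \<le> v x}"
      define z where "z = (c0 * A * M powr (- (1 / p))) ^ (J + 2) * (k / 2) / 2 ^ ((J + 1) * 449)"
      have zI: "z \<le> I"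
      proof (cases "\<rho> \<le> z")
        case True': True
        have "k \<le> K0 / 8" using k by (simp add: K_def)
        then have "AE x in lborel. x \<in> ball x0 (\<rho> / 2) \<longrightarrow> z \<le> v x"
          using pos[rule_format, OF adm bl True _ J] True' unfolding z_def A_def by blast
        then have "ereal z \<le> ess_inf_on (ball x0 (\<rho> / 2)) u"
          by (rule ess_inf_on_ge[OF um \<Omega> open_ball subs(1) aev])
        then show ?thesis using i0 \<rho> by (simp add: I_def)
      next
        case False
        then show ?thesis using i0 by (simp add: I_def)
      qed
      show ?thesis
        unfolding E_def A_def[symmetric] by (rule level_decay[OF M c0(1) k(1) zI[unfolded z_def]])
    qed
    define m where "m = measure lborel (ball x0 \<rho>)"
    have m: "0 < m" using \<rho> by (simp add: m_def)
    have m\<omega>: "m = \<rho> ^ ?n * \<omega>"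
      unfolding m_def \<omega>_def by (rule content_ball_scale) (use \<rho> in simp)
    define T where "T = d * m powr (- \<tau>)"
    have T: "0 \<le> T" unfolding T_def using d by simp
    have Ls: "integrable lborel (\<lambda>x. indicator D x * v x powr \<theta>) \<and>
      (\<integral>x. indicator D x * v x powr \<theta> \<partial>lborel)
        \<le> measure lborel (ball x0 \<rho>) * (T powr \<theta> * (measure lborel D / measure lborel (ball x0 \<rho>)) powr (1 - \<theta> * \<tau>))"
      if D: "D \<in> sets borel" "D \<subseteq> ball x0 \<rho>" and \<theta>: "0 < \<theta>" "\<theta> * \<tau> \<le> 1" for D \<theta>
    proof -
      have Db: "D \<subseteq> ball x0 (2 * \<rho>)" using D(2) subs(4) by blast
      have Df: "emeasure lborel D < \<infinity>"
        using emeasure_mono[OF D(2), of lborel] emeasure_lborel_ball_finite[of x0 \<rho>] by (auto intro: le_less_trans)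
      have b2: "ball x0 (2 * \<rho>) \<in> sets borel" by simp
      note LM = Lnorm_moment_bound[OF s Ln d b2 subs(3) v v0 aev D(1) Db Df \<theta>(1) \<theta>(2)[unfolded \<tau>_def]]
      have "d powr \<theta> * measure lborel D powr (1 - \<theta> * \<tau>)
          = m * (T powr \<theta> * (measure lborel D / m) powr (1 - \<theta> * \<tau>))"
      proof -
        have "T powr \<theta> = d powr \<theta> * m powr (- (\<theta> * \<tau>))"
          unfolding T_def using d m by (simp add: powr_mult powr_powr mult.commute)
        moreover have "(measure lborel D / m) powr (1 - \<theta> * \<tau>) = measure lborel D powr (1 - \<theta> * \<tau>) / m powr (1 - \<theta> * \<tau>)"
          by (simp add: powr_divide)
        moreover have "m * m powr (- (\<theta> * \<tau>)) = m powr (1 - \<theta> * \<tau>)"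
          using m powr_add[of m 1 "- (\<theta> * \<tau>)"] by simp
        ultimately have "m * (T powr \<theta> * (measure lborel D / m) powr (1 - \<theta> * \<tau>))
          = d powr \<theta> * (m powr (1 - \<theta> * \<tau>) * (measure lborel D powr (1 - \<theta> * \<tau>) / m powr (1 - \<theta> * \<tau>)))"
          by (metis mult.assoc mult.left_commute)
        also have "\<dots> = d powr \<theta> * measure lborel D powr (1 - \<theta> * \<tau>)" using m by simp
        finally show ?thesis by simp
      qed
      then show ?thesis using LM unfolding m_def \<tau>_def by simp
    qed
    define G where "G = C2 / l"
    have G1: "1 \<le> G" unfolding G_def using C2 l by (simp add: le_divide_eq)
    have TK: "T / K \<le> G"
    proof -
      have mt: "m powr (- \<tau>) = \<omega> powr (- \<tau>) * \<rho> powr (- (?n * \<tau>))"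
        unfolding m\<omega> powr_mult using \<rho> by (simp add: powr_realpow[symmetric] powr_powr)
      have "\<rho> powr (- (?n * \<tau>)) \<noteq> 0" using \<rho> by simp
      then have "T / K = 8 * d * \<omega> powr (- \<tau>) / \<epsilon> / l"
        unfolding T_def K_def K0_def mt by simp
      also have "\<dots> \<le> C2 / l" by (rule divide_right_mono) (use l in \<open>auto simp: C2_def\<close>)
      finally show ?thesis unfolding G_def .
    qed
    have Q1: "1 \<le> J + 2" by simp
    note main = integral_mean_from_decay[OF v v0 \<rho> E1 I Q1 K \<tau> T G1 TK \<theta>(1) \<theta>Q decay Ls]
    have vp: "(\<lambda>x. v x powr \<theta>) \<in> borel_measurable borel" using v by measurable
    have up: "(\<lambda>x. u x powr \<theta>) \<in> borel_measurable (lebesgue_on \<Omega>)" using um by measurable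
    have aep: "AE x in lborel. x \<in> \<Omega> \<longrightarrow> v x powr \<theta> = u x powr \<theta>"
      using aev by eventually_elim auto
    have bb: "ball x0 \<rho> \<in> sets borel" by simp
    have si: "set_integrable lebesgue (ball x0 \<rho>) (\<lambda>x. u x powr \<theta>)"
      by (rule set_integrable_from_borel[OF up \<Omega> vp main(1) aep bb subs(2)])
    have "(1 / measure lebesgue (ball x0 \<rho>) * (LINT x:ball x0 \<rho>|lebesgue. u x powr \<theta>)) powr (1 / \<theta>)
        = ((\<integral>x. indicator (ball x0 \<rho>) x * v x powr \<theta> \<partial>lborel) / measure lborel (ball x0 \<rho>)) powr (1 / \<theta>)"
      using set_integrable_lebesgue_borel(2)[OF si vp aep bb subs(2)] by simp
    also have "\<dots> \<le> I * G * 6 powr (2 * real (J + 2) + 2 * \<tau>) * E powr (2 + 2 * \<tau>)" by (rule main(2))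
    also have "\<dots> = I * G * (6 powr (2 * real (J + 2) + 2 * \<tau>) * E powr (2 + 2 * \<tau>))" by (simp only: mult.assoc)
    also have "\<dots> \<le> I * G * exp (C1 * M powr \<beta>)"
    proof (rule mult_left_mono)
      have "6 powr (2 * real (J + 2) + 2 * \<tau>) * E powr (2 + 2 * \<tau>) \<le> exp ((2 + 2 * \<tau>) * L * (real (J + 2) * M))"
        unfolding E_def L_def by (rule exponential_constant_bound(2)[OF M c0(1) c01 p \<tau>])
      also have "\<dots> \<le> exp ((2 + 2 * \<tau>) * L * I0)"
        unfolding exp_le_cancel_iff by (rule mult_left_mono[OF QM]) (use \<tau> L in simp)
      finally show "6 powr (2 * real (J + 2) + 2 * \<tau>) * E powr (2 + 2 * \<tau>) \<le> exp (C1 * M powr \<beta>)"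
        unfolding C1I .
    qed (use I G1 in simp)
    also have "\<dots> = C2 / l * exp (C1 * M powr \<beta>) * I" unfolding G_def by (simp only: mult_ac)
    finally have fin: "(1 / measure lebesgue (ball x0 \<rho>) * (LINT x:ball x0 \<rho>|lebesgue. u x powr \<theta>)) powr (1 / \<theta>)
        \<le> C2 / l * exp (C1 * M powr \<beta>) * I" .
    have "ereal (C2 / l * exp (C1 * M powr \<beta>) * I) = ereal (C2 / lam \<rho> * exp (C1 * mu \<rho> powr \<beta>)) *
            (ess_inf_on (ball x0 (\<rho> / 2)) u + ereal \<rho>)"
      unfolding i0(1) I_def l_def M_def by simp
    then show ?thesis using si fin by (metis ereal_less_eq(3))
  qed
  have C20: "0 < C2" using C2 by linarith
  show ?thesis
  proof (rule exI[of _ C1], rule conjI[OF C1], rule exI[of _ C2], rule conjI[OF C20], rule exI[of _ \<beta>],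
      rule conjI[OF \<beta>], intro allI impI)
    fix \<Omega> :: "(real^'n) set" and \<Lambda> lam mu u x0 \<rho> \<theta>
    assume 1: "open \<Omega> \<and> connected \<Omega> \<and> bounded \<Omega> \<and>
      (\<forall>x\<in>\<Omega>. \<forall>r>0. \<forall>k>0. \<Lambda> x r k > 0) \<and>
      cond_Lambda_s s \<Omega> \<Lambda> lam mu \<and> cond_lambda lam \<and>
      u \<in> DG_minus p \<Lambda> \<Omega> c q \<delta> \<and> u \<in> L_loc s \<Omega> \<and>
      (AE x in lebesgue_on \<Omega>. 0 \<le> u x)"
      and 2: "0 < \<rho> \<and> ball x0 (8 * \<rho>) \<subseteq> \<Omega> \<and>
        Lnorm s (ball x0 (2 * \<rho>)) u \<le> ennreal d \<and>
        0 < \<theta> \<and> \<theta> < 1 / (C1 * mu \<rho> powr \<beta> + 2 * recip s)"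
    show "set_integrable lebesgue (ball x0 \<rho>) (\<lambda>x. u x powr \<theta>) \<and>
        ereal ((1 / measure lebesgue (ball x0 \<rho>) *
                 (LINT x:ball x0 \<rho>|lebesgue. u x powr \<theta>)) powr (1 / \<theta>))
        \<le> ereal (C2 / lam \<rho> * exp (C1 * mu \<rho> powr \<beta>)) *
            (ess_inf_on (ball x0 (\<rho> / 2)) u + ereal \<rho>)"
      using 1 2 by (elim conjE) (rule concl)
  qed
qed

end
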